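(* Let $T,\beta,r>0$, $\alpha,\delta\in\mathbb{R}$, $u_0\in L^2(0,L)$, let $k=k(x,y;r)$ be the smooth backstepping kernel described in the context, and let the boundary feedback be $$g_0(t)=\int_0^L k(0,y)\,u(y,t)\,dy .$$ Then the closed-loop problem $$\begin{cases} iu_t+i\beta u_{xxx}+\alpha u_{xx}+i\delta u_x=0,& x\in(0,L),\ t\in(0,T),\\ u(0,t)=g_0(t),\ u(L,t)=0,\ u_x(L,t)=0,\\ u(x,0)=u_0(x)\end{cases}$$ has a unique mild solution $u\in C([0,T];L^2(0,L))\cap L^2(0,T;H^1(0,L))$ with $u_x(0,\cdot)\in L^2(0,T)$, and $$|u(\cdot,t)|_2\le c_k\,|u_0|_2\,e^{-rt},\qquad t\ge 0,$$ where $c_k\ge 0$ depends only on $k$ and is given by $c_k=\left|(I-\Upsilon_k)^{-1}\right|_{2\to 2}\left(1+|k|_{L^2(\Delta_{x,y})}\right)$.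
   Context: $L>0$ is fixed, functions are complex valued, $|\cdot|_2$ is the $L^2(0,L)$ norm, and $|\cdot|_{2\to2}$ is the operator norm on $L^2(0,L)$. Put $\tilde\alpha=\alpha/\beta$, $\tilde\delta=\delta/\beta$, $\tilde r=r/\beta$ and $\Delta_{x,y}=\{(x,y): 0<x<L,\ x<y<L\}$. Backstepping kernel: $k$ is the $C^\infty$ solution (smooth up to the boundary of $\Delta_{x,y}$) of $$k_{xxx}+k_{yyy}-i\tilde\alpha(k_{xx}-k_{yy})+\tilde\delta(k_x+k_y)+\tilde r k=0\ \text{ in }\Delta_{x,y},\quad k(x,x)=k(x,L)=0,\quad \tfrac{d}{dx}\big[k_x(x,x)\big]=-\tfrac{\tilde r}{3},$$ given by $k(x,y)=G(y-x,L-y)$, where $G$ is the limit (uniform with all derivatives on $0\le s\le L$, $0\le t\le L-s$) of $G^0=0$, $G^{n+1}(s,t)=-\frac{\tilde r}{3}st+\int_0^t\int_0^s\int_0^\omega [DG^n](\xi,\eta)\,d\xi\,d\omega\,d\eta$, with $DG=\frac13\left[3G_{tts}-G_{ttt}-i\tilde\alpha(2G_{ts}-G_{tt})-\tilde\delta G_t+\tilde rG\right]$. $(\Upsilon_k\varphi)(x)=\int_x^L k(x,y)\varphi(y)\,dy$; the operator $I-\Upsilon_k$ is boundedly invertible on $H^l(0,L)$, $l\ge0$. Mild solution: let $S(t)$ be the $C_0$-semigroup on $L^2(0,L)$ generated by $A\varphi=-\beta\varphi'''+i\alpha\varphi''-\delta\varphi'$, $D(A)=\{\varphi\in H^3(0,L):\varphi(0)=\varphi(L)=\varphi'(L)=0\}$.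 A mild solution of the closed-loop problem is a function $u$ such that $w=(I-\Upsilon_k)u$ is the mild solution $w(t)=e^{-rt}S(t)w_0$, $w_0=(I-\Upsilon_k)u_0$, of the damped target problem $iw_t+i\beta w_{xxx}+\alpha w_{xx}+i\delta w_x+irw=0$, $w(0,t)=w(L,t)=w_x(L,t)=0$, $w(x,0)=w_0(x)$. *)

theory Defs
  imports "HOL-Analysis.Analysis"
begin

section \<open>Square-integrable functions\<close>

text \<open>
  Elements of $L^2$ are represented by functions; equality is almost everywhere.
\<close>

definition L2 :: "'a measure \<Rightarrow> ('a \<Rightarrow> complex) set" where
  "L2 M = {f. f \<in> borel_measurable M \<and> integrable M (\<lambda>x. (cmod (f x))\<^sup>2)}"

definition L2_norm :: "'a measure \<Rightarrow> ('a \<Rightarrow> complex) \<Rightarrow> real" where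
  "L2_norm M f = sqrt (\<integral>x. (cmod (f x))\<^sup>2 \<partial>M)"

abbreviation ivl :: "real \<Rightarrow> real measure" where
  "ivl L \<equiv> lebesgue_on {0<..<L}"

definition L2_opnorm :: "'a measure \<Rightarrow> (('a \<Rightarrow> complex) \<Rightarrow> 'a \<Rightarrow> complex) \<Rightarrow> real" where
  "L2_opnorm M F = Sup {L2_norm M (F f) |f. f \<in> L2 M \<and> L2_norm M f \<le> 1}"

definition L2_inverse ::
    "'a measure \<Rightarrow> (('a \<Rightarrow> complex) \<Rightarrow> 'a \<Rightarrow> complex) \<Rightarrow> ('a \<Rightarrow> complex) \<Rightarrow> 'a \<Rightarrow> complex" where
  "L2_inverse M F g = (SOME f. f \<in> L2 M \<and> (AE x in M. F f x = g x))"

section \<open>Sobolev spaces on a bounded interval\<close>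

text \<open>
  A function lies in $H^m(0,L)$ iff it agrees almost everywhere with a function \<open>D 0\<close> whose
  derivatives \<open>D j\<close> of order \<open>j < m\<close> are absolutely continuous on $[0,L]$ and whose derivative
  \<open>D m\<close> is square integrable.  Absolute continuity is expressed by the integral formula.  For
  \<open>j < m\<close> the function \<open>D j\<close> is the continuous representative of the derivative of order \<open>j\<close>,
  so \<open>D j 0\<close> and \<open>D j L\<close> are its boundary traces.
\<close>

definition sobolev_rep :: "real \<Rightarrow> nat \<Rightarrow> (nat \<Rightarrow> real \<Rightarrow> complex) \<Rightarrow> (real \<Rightarrow> complex) \<Rightarrow> bool" where
  "sobolev_rep L m D f \<longleftrightarrow>
     (\<forall>j\<le>m. D j \<in> L2 (ivl L)) \<and>
     (\<forall>j<m. \<forall>x\<in>{0..L}. D j x = D j 0 + (\<integral>y. D (Suc j) y \<partial>lebesgue_on {0..x})) \<and>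
     (AE x in ivl L. f x = D 0 x)"

definition sobolev :: "real \<Rightarrow> nat \<Rightarrow> (real \<Rightarrow> complex) set" where
  "sobolev L m = {f. \<exists>D. sobolev_rep L m D f}"

text \<open>The derivatives are unique up to null sets, so the choice below is immaterial.\<close>

definition sobolev_norm :: "real \<Rightarrow> nat \<Rightarrow> (real \<Rightarrow> complex) \<Rightarrow> real" where
  "sobolev_norm L m f =
     (let D = (SOME D. sobolev_rep L m D f) in sqrt (\<Sum>j\<le>m. (L2_norm (ivl L) (D j))\<^sup>2))"

section \<open>Functions of time with values in a function space\<close>

definition cont_L2 :: "real \<Rightarrow> real \<Rightarrow> (real \<Rightarrow> real \<Rightarrow> complex) \<Rightarrow> bool" where
  "cont_L2 L T u \<longleftrightarrow>
     (\<forall>t\<in>{0..T}. u t \<in> L2 (ivl L) \<and>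
        ((\<lambda>s. L2_norm (ivl L) (\<lambda>x. u s x - u t x)) \<longlongrightarrow> 0) (at t within {0..T}))"

text \<open>
  The Bochner space $L^2(0,T;H^m(0,L))$: almost everywhere limits of simple functions, with
  square-integrable norm.
\<close>

definition simple_sobolev :: "real \<Rightarrow> nat \<Rightarrow> real \<Rightarrow> (real \<Rightarrow> real \<Rightarrow> complex) \<Rightarrow> bool" where
  "simple_sobolev L m T s \<longleftrightarrow>
     finite (s ` {0<..<T}) \<and> s ` {0<..<T} \<subseteq> sobolev L m \<and>
     (\<forall>f. {t \<in> {0<..<T}. s t = f} \<in> sets lebesgue)"

definition L2_sobolev :: "real \<Rightarrow> nat \<Rightarrow> real \<Rightarrow> (real \<Rightarrow> real \<Rightarrow> complex) \<Rightarrow> bool" where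
  "L2_sobolev L m T u \<longleftrightarrow>
     (AE t in ivl T. u t \<in> sobolev L m) \<and>
     (\<exists>s. (\<forall>n. simple_sobolev L m T (s n)) \<and>
          (AE t in ivl T. (\<lambda>n. sobolev_norm L m (\<lambda>x. u t x - s n t x)) \<longlonglongrightarrow> 0)) \<and>
     integrable (ivl T) (\<lambda>t. (sobolev_norm L m (u t))\<^sup>2)"

text \<open>
  Functions in $L^2(0,T;H^1(0,L))$ have no pointwise trace $u_x(a,\cdot)$, so the equation
  $u_x(a,\cdot)=g$ is understood in the sense of distributions in time: for each test function
  $\theta$ on $(0,T)$ the average $U=\int_0^T\theta(t)u(t)\,dt$ is regular enough in $x$ to have a
  trace $U_x(a)$, and $U_x(a)=\int_0^T\theta(t)g(t)\,dt$.  The average is a weak integral in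
  $L^2(0,L)$ because the values $u(t)$ are determined only up to null sets.
\<close>

definition test_function :: "real \<Rightarrow> (real \<Rightarrow> real) \<Rightarrow> bool" where
  "test_function T \<theta> \<longleftrightarrow>
     (\<forall>n t. (deriv ^^ n) \<theta> differentiable (at t)) \<and>
     (\<exists>a b. 0 < a \<and> b < T \<and> (\<forall>t. t \<notin> {a..b} \<longrightarrow> \<theta> t = 0))"

definition time_average ::
    "real \<Rightarrow> real \<Rightarrow> (real \<Rightarrow> real) \<Rightarrow> (real \<Rightarrow> real \<Rightarrow> complex) \<Rightarrow> (real \<Rightarrow> complex) \<Rightarrow> bool" where
  "time_average L T \<theta> u U \<longleftrightarrow>
     U \<in> L2 (ivl L) \<and>
     (\<forall>f\<in>L2 (ivl L).
        (\<integral>x. U x * f x \<partial>ivl L) = (\<integral>t. \<theta> t * (\<integral>x. u t x * f x \<partial>ivl L) \<partial>ivl T))"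

definition dx_trace ::
    "real \<Rightarrow> real \<Rightarrow> (real \<Rightarrow> real \<Rightarrow> complex) \<Rightarrow> real \<Rightarrow> (real \<Rightarrow> complex) \<Rightarrow> bool" where
  "dx_trace L T u a g \<longleftrightarrow>
     (\<forall>\<theta>. test_function T \<theta> \<longrightarrow>
        (\<exists>U D. time_average L T \<theta> u U \<and> sobolev_rep L 2 D U \<and>
               D 1 a = (\<integral>t. \<theta> t * g t \<partial>ivl T)))"

section \<open>The semigroup\<close>

text \<open>The graph of $A\varphi=-\beta\varphi'''+i\alpha\varphi''-\delta\varphi'$ on $D(A)$.\<close>

definition A_graph ::
    "real \<Rightarrow> real \<Rightarrow> real \<Rightarrow> real \<Rightarrow> (real \<Rightarrow> complex) \<Rightarrow> (real \<Rightarrow> complex) \<Rightarrow> bool" where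
  "A_graph L \<alpha> \<beta> \<delta> \<phi> \<psi> \<longleftrightarrow>
     (\<exists>D. sobolev_rep L 3 D \<phi> \<and> D 0 0 = 0 \<and> D 0 L = 0 \<and> D 1 L = 0 \<and>
          (AE x in ivl L. \<psi> x = - \<beta> * D 3 x + \<i> * \<alpha> * D 2 x - \<delta> * D 1 x))"

definition C0_semigroup ::
    "real \<Rightarrow> (real \<Rightarrow> (real \<Rightarrow> complex) \<Rightarrow> real \<Rightarrow> complex) \<Rightarrow> bool" where
  "C0_semigroup L S \<longleftrightarrow>
     (\<forall>t\<ge>0. \<forall>f\<in>L2 (ivl L). S t f \<in> L2 (ivl L)) \<and>
     (\<forall>t\<ge>0. \<forall>f\<in>L2 (ivl L). \<forall>g\<in>L2 (ivl L). \<forall>a b.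
        AE x in ivl L. S t (\<lambda>y. a * f y + b * g y) x = a * S t f x + b * S t g x) \<and>
     (\<forall>t\<ge>0. \<exists>C. \<forall>f\<in>L2 (ivl L). L2_norm (ivl L) (S t f) \<le> C * L2_norm (ivl L) f) \<and>
     (\<forall>f\<in>L2 (ivl L). AE x in ivl L. S 0 f x = f x) \<and>
     (\<forall>s\<ge>0. \<forall>t\<ge>0. \<forall>f\<in>L2 (ivl L). AE x in ivl L. S (s + t) f x = S s (S t f) x) \<and>
     (\<forall>f\<in>L2 (ivl L). ((\<lambda>t. L2_norm (ivl L) (\<lambda>x. S t f x - f x)) \<longlongrightarrow> 0) (at_right 0))"

definition generates ::
    "real \<Rightarrow> ((real \<Rightarrow> complex) \<Rightarrow> (real \<Rightarrow> complex) \<Rightarrow> bool) \<Rightarrow>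
     (real \<Rightarrow> (real \<Rightarrow> complex) \<Rightarrow> real \<Rightarrow> complex) \<Rightarrow> bool" where
  "generates L A S \<longleftrightarrow>
     C0_semigroup L S \<and>
     (\<forall>\<phi>\<in>L2 (ivl L). \<forall>\<psi>\<in>L2 (ivl L).
        A \<phi> \<psi> \<longleftrightarrow>
        ((\<lambda>t. L2_norm (ivl L) (\<lambda>x. (S t \<phi> x - \<phi> x) / t - \<psi> x)) \<longlongrightarrow> 0) (at_right 0))"

section \<open>The backstepping kernel\<close>

definition \<Delta> :: "real \<Rightarrow> (real \<times> real) set" where
  "\<Delta> L = {(x, y). 0 < x \<and> x < L \<and> x < y \<and> y < L}"

text \<open>
  \<open>smooth_jet U D f\<close>: \<open>f\<close> is smooth on the open set \<open>U\<close>, and \<open>D a b\<close> is the extension of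
  $\partial_1^a\partial_2^b f$ to a continuous function on the closure of \<open>U\<close>.
\<close>

definition smooth_jet ::
    "(real \<times> real) set \<Rightarrow> (nat \<Rightarrow> nat \<Rightarrow> real \<Rightarrow> real \<Rightarrow> complex) \<Rightarrow>
     (real \<Rightarrow> real \<Rightarrow> complex) \<Rightarrow> bool" where
  "smooth_jet U D f \<longleftrightarrow>
     (\<forall>(x, y)\<in>closure U. D 0 0 x y = f x y) \<and>
     (\<forall>a b. continuous_on (closure U) (\<lambda>(x, y). D a b x y)) \<and>
     (\<forall>a b. \<forall>(x, y)\<in>U.
        ((\<lambda>\<xi>. D a b \<xi> y) has_vector_derivative D (Suc a) b x y) (at x) \<and>
        ((\<lambda>\<eta>. D a b x \<eta>) has_vector_derivative D a (Suc b) x y) (at y))"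

definition pd_s :: "(real \<Rightarrow> real \<Rightarrow> complex) \<Rightarrow> real \<Rightarrow> real \<Rightarrow> complex" where
  "pd_s G = (\<lambda>s t. vector_derivative (\<lambda>\<sigma>. G \<sigma> t) (at s))"

definition pd_t :: "(real \<Rightarrow> real \<Rightarrow> complex) \<Rightarrow> real \<Rightarrow> real \<Rightarrow> complex" where
  "pd_t G = (\<lambda>s t. vector_derivative (\<lambda>\<tau>. G s \<tau>) (at t))"

definition D_op ::
    "real \<Rightarrow> real \<Rightarrow> real \<Rightarrow> (real \<Rightarrow> real \<Rightarrow> complex) \<Rightarrow> real \<Rightarrow> real \<Rightarrow> complex" where
  "D_op \<alpha>' \<delta>' r' G s t =
     (3 * pd_s (pd_t (pd_t G)) s t - pd_t (pd_t (pd_t G)) s t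
      - \<i> * \<alpha>' * (2 * pd_s (pd_t G) s t - pd_t (pd_t G) s t)
      - \<delta>' * pd_t G s t + r' * G s t) / 3"

text \<open>
  The integrals are oriented, so every iterate is a polynomial on the whole plane and its
  partial derivatives exist also on the boundary of the triangle.
\<close>

primrec G_iter :: "real \<Rightarrow> real \<Rightarrow> real \<Rightarrow> nat \<Rightarrow> real \<Rightarrow> real \<Rightarrow> complex" where
  "G_iter \<alpha>' \<delta>' r' 0 = (\<lambda>s t. 0)"
| "G_iter \<alpha>' \<delta>' r' (Suc n) =
     (\<lambda>s t. - (r' / 3) * s * t +
        (LBINT \<eta>=0..t. (LBINT \<omega>=0..s. (LBINT \<xi>=0..\<omega>.
          D_op \<alpha>' \<delta>' r' (G_iter \<alpha>' \<delta>' r' n) \<xi> \<eta>))))"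

text \<open>\<open>G\<close> is the limit of the iterates, uniformly with all derivatives on the closed triangle.\<close>

definition G_limit ::
    "real \<Rightarrow> real \<Rightarrow> real \<Rightarrow> real \<Rightarrow> (real \<Rightarrow> real \<Rightarrow> complex) \<Rightarrow> bool" where
  "G_limit L \<alpha>' \<delta>' r' G \<longleftrightarrow>
     (\<exists>D. smooth_jet {(s, t). 0 < s \<and> 0 < t \<and> t < L - s} D G \<and>
          (\<forall>a b. uniform_limit {(s, t). 0 \<le> s \<and> s \<le> L \<and> 0 \<le> t \<and> t \<le> L - s}
             (\<lambda>n (s, t). (pd_s ^^ a) ((pd_t ^^ b) (G_iter \<alpha>' \<delta>' r' n)) s t)
             (\<lambda>(s, t). D a b s t) sequentially))"

definition kernel_problem ::
    "real \<Rightarrow> real \<Rightarrow> real \<Rightarrow> real \<Rightarrow> (real \<Rightarrow> real \<Rightarrow> complex) \<Rightarrow> bool" where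
  "kernel_problem L \<alpha>' \<delta>' r' k \<longleftrightarrow>
     (\<exists>D. smooth_jet (\<Delta> L) D k \<and>
          (\<forall>(x, y)\<in>\<Delta> L.
             D 3 0 x y + D 0 3 x y - \<i> * \<alpha>' * (D 2 0 x y - D 0 2 x y)
             + \<delta>' * (D 1 0 x y + D 0 1 x y) + r' * k x y = 0) \<and>
          (\<forall>x\<in>{0..L}. k x x = 0 \<and> k x L = 0) \<and>
          (\<forall>x\<in>{0..L}. ((\<lambda>\<xi>. D 1 0 \<xi> \<xi>) has_vector_derivative - (r' / 3)) (at x within {0..L})))"

definition backstepping_kernel ::
    "real \<Rightarrow> real \<Rightarrow> real \<Rightarrow> real \<Rightarrow> real \<Rightarrow> (real \<Rightarrow> real \<Rightarrow> complex) \<Rightarrow> bool" where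
  "backstepping_kernel L \<alpha> \<beta> \<delta> r k \<longleftrightarrow>
     kernel_problem L (\<alpha> / \<beta>) (\<delta> / \<beta>) (r / \<beta>) k \<and>
     (\<exists>G. G_limit L (\<alpha> / \<beta>) (\<delta> / \<beta>) (r / \<beta>) G \<and>
          (\<forall>(x, y)\<in>closure (\<Delta> L). k x y = G (y - x) (L - y)))"

section \<open>The closed-loop problem\<close>

definition Upsilon ::
    "real \<Rightarrow> (real \<Rightarrow> real \<Rightarrow> complex) \<Rightarrow> (real \<Rightarrow> complex) \<Rightarrow> real \<Rightarrow> complex" where
  "Upsilon L k \<phi> x = (\<integral>y. k x y * \<phi> y \<partial>lebesgue_on {x<..<L})"

definition I_minus_Upsilon ::
    "real \<Rightarrow> (real \<Rightarrow> real \<Rightarrow> complex) \<Rightarrow> (real \<Rightarrow> complex) \<Rightarrow> real \<Rightarrow> complex" where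
  "I_minus_Upsilon L k \<phi> = (\<lambda>x. \<phi> x - Upsilon L k \<phi> x)"

definition boundary_feedback ::
    "real \<Rightarrow> (real \<Rightarrow> real \<Rightarrow> complex) \<Rightarrow> (real \<Rightarrow> real \<Rightarrow> complex) \<Rightarrow> real \<Rightarrow> complex" where
  "boundary_feedback L k u t = (\<integral>y. k 0 y * u t y \<partial>ivl L)"

text \<open>
  The state at time \<open>t\<close> is \<open>u t\<close>.  The set \<open>I\<close> is the time interval on which \<open>u\<close> is a solution,
  and \<open>S\<close> is the semigroup generated by $A$.
\<close>

definition target_mild_solution ::
    "real \<Rightarrow> real \<Rightarrow> (real \<Rightarrow> (real \<Rightarrow> complex) \<Rightarrow> real \<Rightarrow> complex) \<Rightarrow> (real \<Rightarrow> complex) \<Rightarrow>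
     real set \<Rightarrow> (real \<Rightarrow> real \<Rightarrow> complex) \<Rightarrow> bool" where
  "target_mild_solution L r S w0 I w \<longleftrightarrow>
     (\<forall>t\<in>I. w t \<in> L2 (ivl L) \<and> (AE x in ivl L. w t x = complex_of_real (exp (- r * t)) * S t w0 x))"

definition closed_loop_mild_solution ::
    "real \<Rightarrow> real \<Rightarrow> (real \<Rightarrow> (real \<Rightarrow> complex) \<Rightarrow> real \<Rightarrow> complex) \<Rightarrow> (real \<Rightarrow> real \<Rightarrow> complex) \<Rightarrow>
     (real \<Rightarrow> complex) \<Rightarrow> real set \<Rightarrow> (real \<Rightarrow> real \<Rightarrow> complex) \<Rightarrow> bool" where
  "closed_loop_mild_solution L r S k u0 I u \<longleftrightarrow>
     (\<forall>t\<in>I. u t \<in> L2 (ivl L)) \<and>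
     target_mild_solution L r S (I_minus_Upsilon L k u0) I (\<lambda>t. I_minus_Upsilon L k (u t))"

text \<open>
  $u(0,t)=g_0(t)$ and $u(L,t)=0$ for almost every $t$, and $u_x(L,\cdot)=0$ as a distribution.
\<close>

definition closed_loop_boundary_conditions ::
    "real \<Rightarrow> real \<Rightarrow> (real \<Rightarrow> complex) \<Rightarrow> (real \<Rightarrow> real \<Rightarrow> complex) \<Rightarrow> bool" where
  "closed_loop_boundary_conditions L T g0 u \<longleftrightarrow>
     (AE t in ivl T. \<exists>D. sobolev_rep L 1 D (u t) \<and> D 0 0 = g0 t \<and> D 0 L = 0) \<and>
     dx_trace L T u L (\<lambda>t. 0)"

definition decay_constant :: "real \<Rightarrow> (real \<Rightarrow> real \<Rightarrow> complex) \<Rightarrow> real" where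
  "decay_constant L k =
     L2_opnorm (ivl L) (L2_inverse (ivl L) (I_minus_Upsilon L k))
     * (1 + L2_norm (lebesgue_on (\<Delta> L)) (\<lambda>(x, y). k x y))"

end

theory Submission
  imports Defs
begin

text \<open>
  The semigroup $S$ is dissipative: twice the real part of $(A\varphi,\varphi)$ equals
  $-\beta|\varphi'(0)|^2$.  Hence it is contractive and the trace $w_x(0,\cdot)$ of a trajectory with
  initial value in $D(A)$ is bounded in $L^2(0,T)$ by $|w_0|_2$.  The multiplier $x\bar w$ (Kato
  smoothing) bounds $w_x$ in $L^2(0,T;L^2(0,L))$ in the same way, so both bounds pass to all initial
  values by density of $D(A)$.  The operator $I-\Upsilon_k$ is of Volterra type and becomes a
  contraction perturbation of the identity after conjugation with $e^{\mu x}$; this transfers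
  existence, uniqueness, decay and regularity from the target problem.  Since $k$ vanishes on the
  diagonal, $\Upsilon_k$ maps $L^2$ to $H^2$, hence $u=w+\Upsilon_k u$ inherits the traces of $w$.
  For a test function $\theta$, the average $\int\theta(t)e^{-rt}S(t)w_0\,dt$ lies in $D(A)$, and the trace
  $\varphi'(0)$ of $\varphi\in D(A)$ is a continuous linear functional of $(\varphi,A\varphi)$.
\<close>

section \<open>The space of square-integrable functions on the line\<close>

text \<open>The hypotheses speak of functions, of identities almost everywhere and of a semigroup
  known only through its generator, while the arguments need a Hilbert space. As \<open>L\<close> is
  a variable, the space of classes \<open>l2\<close> is built once, on the whole line; the functions
  on (0,L) become the fixed points of a projection \<open>proj L\<close>, and every operator is
  extended to the full type. The main obstacle is that for rough initial values neither the
  derivative nor the trace at 0 of a trajectory is a function of the state. Initial values in the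
  domain are therefore chosen to converge geometrically, so that derivatives and traces converge at
  almost every time under one integrable majorant. Lebesgue integrals in time are then taken of
  scalar functions only; integrals with values in \<open>l2\<close> occur only for continuous
  integrands. The trace obtained as a pointwise limit must still be matched with the distributional
  definition. Since the images of the approximating values under A need not converge, A is traded
  for a time derivative on the test weight before the limit is taken.\<close>

text \<open>The weight 4^n still leaves the summable bound C/4^n, so the weighted squares have an
  integrable sum S, and at almost every point the n-th increment is at most sqrt S / 2^n. The limit
  itself is not claimed to be measurable, which allows values in any Banach space; the majorant G =
  4 S serves all n at once.\<close>

lemma fast_Cauchy_AE:
  fixes f :: "nat \<Rightarrow> 'a \<Rightarrow> 'b::banach"
  assumes int: "\<And>n. integrable M (\<lambda>x. (norm (f (Suc n) x - f n x))\<^sup>2)"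
    and bound: "\<And>n. (\<integral>x. (norm (f (Suc n) x - f n x))\<^sup>2 \<partial>M) \<le> C / 16 ^ n"
  obtains G where "integrable M G"
    "AE x in M. (\<lambda>n. f n x) \<longlonglongrightarrow> lim (\<lambda>n. f n x) \<and>
       (\<forall>n. (norm (f n x - lim (\<lambda>n. f n x)))\<^sup>2 \<le> G x / 4 ^ n)"
proof -
  define g where "g n x = 4 ^ n * (norm (f (Suc n) x - f n x))\<^sup>2" for n x
  have g0: "g n x \<ge> 0" for n x by (simp add: g_def)
  have gi: "integrable M (g n)" for n unfolding g_def using int by auto
  have gb: "(\<integral>x. g n x \<partial>M) \<le> C * (1/4) ^ n" for n
  proof -
    have "(\<integral>x. g n x \<partial>M) = 4 ^ n * (\<integral>x. (norm (f (Suc n) x - f n x))\<^sup>2 \<partial>M)"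
      unfolding g_def by simp
    also have "\<dots> \<le> 4 ^ n * (C / 16 ^ n)" by (intro mult_left_mono bound) auto
    also have "\<dots> = C * (1/4) ^ n"
    proof -
      have "(16::real) ^ n = 4 ^ n * 4 ^ n" by (simp flip: power_mult_distrib)
      then show ?thesis by (simp add: power_one_over)
    qed
    finally show ?thesis .
  qed
  have sumI: "summable (\<lambda>n. \<integral>x. norm (g n x) \<partial>M)"
    by (rule summable_comparison_test'[where g = "\<lambda>n. C * (1/4) ^ n" and N = 0])
       (use g0 gb in \<open>auto intro!: summable_mult summable_geometric Bochner_Integration.integral_nonneg\<close>)
  have meas: "(\<lambda>x. ennreal (g n x)) \<in> borel_measurable M" for n
    using gi[of n] by measurable
  have "(\<integral>\<^sup>+x. (\<Sum>n. ennreal (g n x)) \<partial>M) = (\<Sum>n. \<integral>\<^sup>+x. ennreal (g n x) \<partial>M)"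
    by (intro nn_integral_suminf meas)
  also have "\<dots> = (\<Sum>n. ennreal (\<integral>x. g n x \<partial>M))"
    by (subst nn_integral_eq_integral) (use gi g0 in auto)
  also have "\<dots> = ennreal (\<Sum>n. \<integral>x. g n x \<partial>M)"
    by (intro suminf_ennreal2) (use sumI g0 in \<open>auto intro!: Bochner_Integration.integral_nonneg\<close>)
  finally have "(\<integral>\<^sup>+x. (\<Sum>n. ennreal (g n x)) \<partial>M) \<noteq> \<infinity>" by simp
  then have AE1: "AE x in M. (\<Sum>n. ennreal (g n x)) \<noteq> \<infinity>"
    by (intro nn_integral_noteq_infinite borel_measurable_suminf_order meas) auto
  have AE2: "AE x in M. summable (\<lambda>n. g n x)"
    using AE1 by eventually_elim (use g0 in \<open>auto intro!: summable_suminf_not_top simp: top_ennreal_def\<close>)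
  have sumi: "integrable M (\<lambda>x. \<Sum>n. g n x)"
    by (rule integrable_suminf) (use gi AE2 sumI g0 in auto)
  have half: "(((1/2) ^ n)\<^sup>2 :: real) = 1 / 4 ^ n" for n
    by (simp add: power_one_over power2_eq_square flip: power_mult_distrib)
  have "AE x in M. (\<lambda>n. f n x) \<longlonglongrightarrow> lim (\<lambda>n. f n x) \<and>
       (\<forall>n. (norm (f n x - lim (\<lambda>n. f n x)))\<^sup>2 \<le> (4 * (\<Sum>n. g n x)) / 4 ^ n)"
    using AE2
  proof eventually_elim
    fix x assume s: "summable (\<lambda>n. g n x)"
    define S where "S = (\<Sum>n. g n x)"
    have S0: "S \<ge> 0" unfolding S_def by (rule suminf_nonneg[OF s]) (rule g0)
    have gS: "g n x \<le> S" for n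
      unfolding S_def using sum_le_suminf[OF s, of "{n}"] g0 by auto
    have d: "norm (f (Suc n) x - f n x) \<le> sqrt S * (1/2) ^ n" for n
    proof (rule power2_le_imp_le)
      have e: "(sqrt S * (1/2) ^ n)\<^sup>2 = S / 4 ^ n"
        using S0 by (simp only: power_mult_distrib half) simp
      show "(norm (f (Suc n) x - f n x))\<^sup>2 \<le> (sqrt S * (1/2) ^ n)\<^sup>2"
        unfolding e using gS[of n] by (simp add: g_def field_simps)
    qed (use S0 in auto)
    \<comment> \<open>The subtracted term keeps the partial geometric sum exact, so that the
      induction on m closes.\<close>
    have e: "norm (f (n + m) x - f n x) \<le> 2 * sqrt S * (1/2) ^ n - 2 * sqrt S * (1/2) ^ (n + m)" for n m
    proof (induction m)
      case (Suc m)
      have "norm (f (n + Suc m) x - f n x) \<le> norm (f (Suc (n + m)) x - f (n + m) x) + norm (f (n + m) x - f n x)"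
        using norm_triangle_ineq[of "f (Suc (n + m)) x - f (n + m) x" "f (n + m) x - f n x"] by simp
      also have "\<dots> \<le> sqrt S * (1/2) ^ (n + m) + (2 * sqrt S * (1/2) ^ n - 2 * sqrt S * (1/2) ^ (n + m))"
        by (intro add_mono d Suc)
      finally show ?case by simp
    qed simp
    have e': "norm (f (n + m) x - f n x) \<le> 2 * sqrt S * (1/2) ^ n" for n m
    proof -
      have "2 * sqrt S * (1/2) ^ (n + m) \<ge> 0" using S0 by simp
      then show ?thesis using e[of n m] by linarith
    qed
    have "Cauchy (\<lambda>n. f n x)"
    proof (rule metric_CauchyI)
      fix \<epsilon> :: real assume "\<epsilon> > 0"
      have "(\<lambda>n. 2 * sqrt S * (1/2) ^ n) \<longlonglongrightarrow> 2 * sqrt S * 0"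
        by (intro tendsto_intros LIMSEQ_power_zero) auto
      then have "eventually (\<lambda>n. 2 * sqrt S * (1/2) ^ n < \<epsilon> / 2) sequentially"
        by (rule order_tendstoD) (use \<open>\<epsilon> > 0\<close> in auto)
      then obtain N where N: "2 * sqrt S * (1/2) ^ N < \<epsilon> / 2"
        by (auto simp: eventually_sequentially)
      have c: "dist (f n x) (f N x) < \<epsilon> / 2" if "n \<ge> N" for n
        using e'[of N "n - N"] N that by (simp add: dist_norm)
      show "\<exists>M. \<forall>m\<ge>M. \<forall>n\<ge>M. dist (f m x) (f n x) < \<epsilon>"
        using dist_triangle_half_l[OF c c] by blast
    qed
    then have "convergent (\<lambda>n. f n x)" by (simp add: Cauchy_convergent_iff)
    then have l: "(\<lambda>n. f n x) \<longlonglongrightarrow> lim (\<lambda>n. f n x)" by (simp add: convergent_LIMSEQ_iff)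
    have "(norm (f n x - lim (\<lambda>n. f n x)))\<^sup>2 \<le> (4 * S) / 4 ^ n" for n
    proof -
      have l2: "(\<lambda>m. norm (f (m + n) x - f n x)) \<longlonglongrightarrow> norm (lim (\<lambda>n. f n x) - f n x)"
        by (intro tendsto_intros LIMSEQ_ignore_initial_segment l)
      have "norm (lim (\<lambda>n. f n x) - f n x) \<le> 2 * sqrt S * (1/2) ^ n"
        by (rule LIMSEQ_le_const2[OF l2]) (use e'[of n] in \<open>auto simp: add.commute\<close>)
      then have "(norm (f n x - lim (\<lambda>n. f n x)))\<^sup>2 \<le> (2 * sqrt S * (1/2) ^ n)\<^sup>2"
        by (intro power_mono) (auto simp: norm_minus_commute)
      also have "\<dots> = (4 * S) / 4 ^ n"
        using S0 by (simp only: power_mult_distrib half) simp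
      finally show ?thesis .
    qed
    with l show "(\<lambda>n. f n x) \<longlonglongrightarrow> lim (\<lambda>n. f n x) \<and>
       (\<forall>n. (norm (f n x - lim (\<lambda>n. f n x)))\<^sup>2 \<le> (4 * (\<Sum>n. g n x)) / 4 ^ n)"
      unfolding S_def by blast
  qed
  then show ?thesis using that[of "\<lambda>x. 4 * (\<Sum>n. g n x)"] sumi by auto
qed

lemma sigma_finite_lebesgue: "sigma_finite_measure (lebesgue :: 'a::euclidean_space measure)"
proof
  obtain A :: "'a set set" where A: "countable A" "A \<subseteq> sets lborel" "\<Union>A = space lborel"
      "\<forall>a\<in>A. emeasure lborel a \<noteq> \<infinity>"
    using sigma_finite_measure.sigma_finite_countable[OF lborel.sigma_finite_measure_axioms] by metis
  then show "\<exists>A::'a set set. countable A \<and> A \<subseteq> sets lebesgue \<and> \<Union>A = space lebesgue \<and>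
      (\<forall>a\<in>A. emeasure lebesgue a \<noteq> \<infinity>)"
    by (intro exI[of _ A]) (auto simp: emeasure_completion main_part_sets)
qed

section \<open>Square-integrable functions over a general measure\<close>

lemma L2_I: "f \<in> borel_measurable M \<Longrightarrow> integrable M (\<lambda>x. (cmod (f x))\<^sup>2) \<Longrightarrow> f \<in> L2 M"
  by (simp add: L2_def)

lemma L2_measurable: "f \<in> L2 M \<Longrightarrow> f \<in> borel_measurable M"
  by (simp add: L2_def)

lemma L2_square_integrable: "f \<in> L2 M \<Longrightarrow> integrable M (\<lambda>x. (cmod (f x))\<^sup>2)"
  by (simp add: L2_def)

lemma L2_bound:
  assumes "f \<in> L2 M" "g \<in> borel_measurable M" "\<And>x. x \<in> space M \<Longrightarrow> cmod (g x) \<le> C * cmod (f x)"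
  shows "g \<in> L2 M"
proof (rule L2_I)
  show "integrable M (\<lambda>x. (cmod (g x))\<^sup>2)"
  proof (rule Bochner_Integration.integrable_bound)
    show "integrable M (\<lambda>x. C\<^sup>2 * (cmod (f x))\<^sup>2)" using L2_square_integrable[OF assms(1)] by simp
    show "AE x in M. norm ((cmod (g x))\<^sup>2) \<le> norm (C\<^sup>2 * (cmod (f x))\<^sup>2)"
    proof (rule AE_I2)
      fix x assume "x \<in> space M"
      then have "(cmod (g x))\<^sup>2 \<le> (C * cmod (f x))\<^sup>2" by (intro power_mono assms) auto
      then show "norm ((cmod (g x))\<^sup>2) \<le> norm (C\<^sup>2 * (cmod (f x))\<^sup>2)" by (simp add: power_mult_distrib)
    qed
  qed (use assms in measurable)
qed (rule assms)

lemma L2_mult_integrable: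
  assumes "f \<in> L2 M" "g \<in> L2 M"
  shows "integrable M (\<lambda>x. f x * g x)"
proof (rule Bochner_Integration.integrable_bound)
  show "integrable M (\<lambda>x. (cmod (f x))\<^sup>2 + (cmod (g x))\<^sup>2)"
    using assms by (simp add: L2_square_integrable)
  show "(\<lambda>x. f x * g x) \<in> borel_measurable M"
    using assms[THEN L2_measurable] by measurable
  have "a * b \<le> a\<^sup>2 + b\<^sup>2" if "a \<ge> 0" "b \<ge> 0" for a b :: real
    using sum_squares_bound[of a b] mult_nonneg_nonneg[OF that] by linarith
  then show "AE x in M. norm (f x * g x) \<le> norm ((cmod (f x))\<^sup>2 + (cmod (g x))\<^sup>2)"
    by (auto simp: norm_mult)
qed

lemma L2_zero [simp]: "(\<lambda>x. 0) \<in> L2 M"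
  by (simp add: L2_def)

lemma L2_add:
  assumes "f \<in> L2 M" "g \<in> L2 M"
  shows "(\<lambda>x. f x + g x) \<in> L2 M"
proof (rule L2_I)
  show m: "(\<lambda>x. f x + g x) \<in> borel_measurable M"
    using assms[THEN L2_measurable] by measurable
  show "integrable M (\<lambda>x. (cmod (f x + g x))\<^sup>2)"
  proof (rule Bochner_Integration.integrable_bound)
    show "integrable M (\<lambda>x. 2 * (cmod (f x))\<^sup>2 + 2 * (cmod (g x))\<^sup>2)"
      using assms by (simp add: L2_square_integrable)
    have "(cmod (a + b))\<^sup>2 \<le> 2 * (cmod a)\<^sup>2 + 2 * (cmod b)\<^sup>2" for a b
    proof -
      have "(cmod (a + b))\<^sup>2 \<le> (cmod a + cmod b)\<^sup>2" by (intro power_mono norm_triangle_ineq) auto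
      then show ?thesis using sum_squares_bound[of "cmod a" "cmod b"] by (simp add: power2_sum)
    qed
    then show "AE x in M. norm ((cmod (f x + g x))\<^sup>2) \<le> norm (2 * (cmod (f x))\<^sup>2 + 2 * (cmod (g x))\<^sup>2)"
      by (auto intro!: AE_I2)
  qed (use m in measurable)
qed

lemma L2_cmult: "f \<in> L2 M \<Longrightarrow> (\<lambda>x. c * f x) \<in> L2 M"
  by (rule L2_bound[where C = "cmod c"]) (auto simp: norm_mult dest: L2_measurable)

lemma L2_cnj: "f \<in> L2 M \<Longrightarrow> (\<lambda>x. cnj (f x)) \<in> L2 M"
  by (rule L2_bound[where C = 1])
     (auto dest: L2_measurable intro: borel_measurable_continuous_on[OF continuous_on_cnj[OF continuous_on_id]])

lemma L2_diff:
  assumes "f \<in> L2 M" "g \<in> L2 M"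
  shows "(\<lambda>x. f x - g x) \<in> L2 M"
  using L2_add[OF assms(1) L2_cmult[OF assms(2), of "-1"]] by simp

lemma L2_norm_cong_AE:
  assumes "f \<in> borel_measurable M" "g \<in> borel_measurable M" "AE x in M. f x = g x"
  shows "L2_norm M f = L2_norm M g"
  unfolding L2_norm_def using assms by (intro arg_cong[where f = sqrt] integral_cong_AE) auto

lemma L2_norm_nonneg [simp]: "L2_norm M f \<ge> 0"
  by (simp add: L2_norm_def)

\<comment> \<open>The Hilbert space of classes on the line\<close>
\<comment> \<open>The base space is the line and not the interval because a type cannot depend on
  the variable \<open>L\<close>. The relation is partial: a function outside L^2 represents no
  class.\<close>
quotient_type l2 = "real \<Rightarrow> complex" / partial:
  "\<lambda>f g. f \<in> L2 lebesgue \<and> g \<in> L2 lebesgue \<and> (AE x in lebesgue. f x = g x)"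
proof (rule part_equivpI)
  show "\<exists>f. f \<in> L2 lebesgue \<and> f \<in> L2 lebesgue \<and> (AE x in lebesgue. f x = (f x :: complex))"
    by (rule exI[of _ "\<lambda>x. 0"]) auto
qed (auto intro!: sympI transpI)

lemma rep_l2_L2 [simp]: "rep_l2 a \<in> L2 lebesgue"
  using Quotient_rep_reflp[OF Quotient_l2] by blast

lemma rep_l2_measurable [measurable, simp]: "rep_l2 a \<in> borel_measurable lebesgue"
  by (rule L2_measurable) simp

lemma abs_rep_l2 [simp]: "abs_l2 (rep_l2 a) = a"
  by (rule Quotient_abs_rep[OF Quotient_l2])

lemma rep_abs_l2: "f \<in> L2 lebesgue \<Longrightarrow> AE x in lebesgue. rep_l2 (abs_l2 f) x = f x"
  using Quotient_rep_abs[OF Quotient_l2, of f] by auto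

lemma abs_l2_eq_iff:
  "f \<in> L2 lebesgue \<Longrightarrow> g \<in> L2 lebesgue \<Longrightarrow> abs_l2 f = abs_l2 g \<longleftrightarrow> (AE x in lebesgue. f x = g x)"
  using Quotient_rel_abs2[OF Quotient_l2] Quotient_rel[OF Quotient_l2, of f g] by auto

instantiation l2 :: ab_group_add
begin
lift_definition zero_l2 :: l2 is "\<lambda>x. 0" by simp
lift_definition plus_l2 :: "l2 \<Rightarrow> l2 \<Rightarrow> l2" is "\<lambda>f g x. f x + g x"
  by (auto intro: L2_add)
lift_definition minus_l2 :: "l2 \<Rightarrow> l2 \<Rightarrow> l2" is "\<lambda>f g x. f x - g x"
  by (auto intro: L2_diff)
lift_definition uminus_l2 :: "l2 \<Rightarrow> l2" is "\<lambda>f x. - f x"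
  using L2_cmult[of _ lebesgue "-1"] by auto
instance
proof
  fix a b c :: l2
  show "a + b + c = a + (b + c)" by transfer (auto simp: algebra_simps intro: L2_add)
  show "a + b = b + a" by transfer (auto simp: algebra_simps intro: L2_add)
  show "0 + a = a" by transfer auto
  show "- a + a = 0" by transfer simp
  obtain f where f: "f \<in> L2 lebesgue" "a = abs_l2 f" by (metis abs_rep_l2 rep_l2_L2)
  obtain g where g: "g \<in> L2 lebesgue" "b = abs_l2 g" by (metis abs_rep_l2 rep_l2_L2)
  show "a - b = a + - b"
    using L2_cmult[OF g(1), of "-1"] by (simp add: f g minus_l2.abs_eq uminus_l2.abs_eq plus_l2.abs_eq)
qed
end

text \<open>The type classes provide real scalars only, so multiplication by a complex scalar is an
  operation of its own.\<close>

lift_definition cscale :: "complex \<Rightarrow> l2 \<Rightarrow> l2" is "\<lambda>c f x. c * f x"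
  by (auto intro: L2_cmult)

text \<open>Bilinear, without conjugation, to match the pairing in \<open>time_average\<close>. The
  inner product below keeps the real part of the sesquilinear form, which is all that the energy
  estimates use.\<close>

lift_definition pair_l2 :: "l2 \<Rightarrow> l2 \<Rightarrow> complex" is "\<lambda>f g. \<integral>x. f x * g x \<partial>lebesgue"
  by (intro integral_cong_AE) (auto dest!: L2_measurable)

lift_definition cnj_l2 :: "l2 \<Rightarrow> l2" is "\<lambda>f x. cnj (f x)"
  by (auto intro: L2_cnj)

instantiation l2 :: real_inner
begin
definition scaleR_l2 :: "real \<Rightarrow> l2 \<Rightarrow> l2" where "scaleR_l2 c = cscale (complex_of_real c)"
definition inner_l2 :: "l2 \<Rightarrow> l2 \<Rightarrow> real" where "inner_l2 a b = Re (pair_l2 a (cnj_l2 b))"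
definition norm_l2 :: "l2 \<Rightarrow> real" where "norm_l2 a = sqrt (inner a a)"
definition sgn_l2 :: "l2 \<Rightarrow> l2" where "sgn_l2 a = cscale (complex_of_real (inverse (norm a))) a"
definition dist_l2 :: "l2 \<Rightarrow> l2 \<Rightarrow> real" where "dist_l2 a b = norm (a - b)"
definition uniformity_l2 :: "(l2 \<times> l2) filter" where
  "uniformity_l2 = (INF e\<in>{0<..}. principal {(x, y). dist x y < e})"
definition open_l2 :: "l2 set \<Rightarrow> bool" where
  "open_l2 U \<longleftrightarrow> (\<forall>x\<in>U. \<forall>\<^sub>F (x', y) in uniformity. x' = x \<longrightarrow> y \<in> U)"

lemma inner_l2_abs: "inner (abs_l2 f) (abs_l2 g) = Re (\<integral>x. f x * cnj (g x) \<partial>lebesgue)"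
  if "f \<in> L2 lebesgue" "g \<in> L2 lebesgue"
  unfolding inner_l2_def using that by (simp add: pair_l2.abs_eq cnj_l2.abs_eq L2_cnj)

instance
proof
  fix a b c :: l2 and x y :: real
  show "x *\<^sub>R (a + b) = x *\<^sub>R a + x *\<^sub>R b"
    unfolding scaleR_l2_def by transfer (auto simp: distrib_left distrib_right intro: L2_add L2_cmult)
  show "(x + y) *\<^sub>R a = x *\<^sub>R a + y *\<^sub>R a"
    unfolding scaleR_l2_def by transfer (auto simp: distrib_left distrib_right intro: L2_add L2_cmult)
  show "x *\<^sub>R y *\<^sub>R a = (x * y) *\<^sub>R a"
    unfolding scaleR_l2_def by transfer (auto simp: mult.assoc intro: L2_cmult)
  show "1 *\<^sub>R a = a"
    unfolding scaleR_l2_def by transfer auto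
  show "dist a b = norm (a - b)" by (simp add: dist_l2_def)
  show "sgn a = inverse (norm a) *\<^sub>R a" by (simp add: sgn_l2_def scaleR_l2_def)
  show "(uniformity :: (l2 \<times> l2) filter) = (INF e\<in>{0<..}. principal {(x, y). dist x y < e})"
    by (simp add: uniformity_l2_def)
  show "open U \<longleftrightarrow> (\<forall>x\<in>U. \<forall>\<^sub>F (x', y) in uniformity. x' = x \<longrightarrow> y \<in> U)" for U :: "l2 set"
    by (simp add: open_l2_def)
  show "norm a = sqrt (inner a a)" by (simp add: norm_l2_def)
  obtain f where f: "f \<in> L2 lebesgue" "a = abs_l2 f" by (metis abs_rep_l2 rep_l2_L2)
  obtain g where g: "g \<in> L2 lebesgue" "b = abs_l2 g" by (metis abs_rep_l2 rep_l2_L2)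
  obtain h where h: "h \<in> L2 lebesgue" "c = abs_l2 h" by (metis abs_rep_l2 rep_l2_L2)
  have i: "integrable lebesgue (\<lambda>x. f x * cnj (g x))" if "f \<in> L2 lebesgue" "g \<in> L2 lebesgue" for f g
    using that by (intro L2_mult_integrable L2_cnj)
  have "(\<integral>x. f x * cnj (g x) \<partial>lebesgue) = cnj (\<integral>x. g x * cnj (f x) \<partial>lebesgue)"
    using Bochner_Integration.integral_cnj[of lebesgue "\<lambda>x. g x * cnj (f x)"] by (simp add: mult.commute)
  then show "inner a b = inner b a" using f g by (simp add: inner_l2_abs)
  show "inner (a + b) c = inner a c + inner b c"
    using f g h i[OF f(1) h(1)] i[OF g(1) h(1)]
    by (simp add: plus_l2.abs_eq inner_l2_abs L2_add distrib_right Bochner_Integration.integral_add)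
  show "inner (x *\<^sub>R a) b = x * inner a b"
    using f g by (simp add: scaleR_l2_def cscale.abs_eq inner_l2_abs L2_cmult mult.assoc)
  have aa: "inner a a = (\<integral>x. (cmod (f x))\<^sup>2 \<partial>lebesgue)"
  proof -
    have "(\<integral>x. f x * cnj (f x) \<partial>lebesgue) = complex_of_real (\<integral>x. (cmod (f x))\<^sup>2 \<partial>lebesgue)"
      by (simp only: complex_norm_square[symmetric] integral_complex_of_real)
    then show ?thesis using f by (simp add: inner_l2_abs)
  qed
  show "inner a a \<ge> 0" unfolding aa by simp
  have "inner a a = 0 \<longleftrightarrow> (AE x in lebesgue. (cmod (f x))\<^sup>2 = 0)"
    unfolding aa using L2_square_integrable[OF f(1)] by (subst integral_nonneg_eq_0_iff_AE) auto
  also have "\<dots> \<longleftrightarrow> a = 0"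
    using f by (simp add: zero_l2_def abs_l2_eq_iff)
  finally show "inner a a = 0 \<longleftrightarrow> a = 0" .
qed
end

lemma norm_abs_l2: "f \<in> L2 lebesgue \<Longrightarrow> norm (abs_l2 f) = L2_norm lebesgue f"
proof -
  assume f: "f \<in> L2 lebesgue"
  have "(\<integral>x. f x * cnj (f x) \<partial>lebesgue) = complex_of_real (\<integral>x. (cmod (f x))\<^sup>2 \<partial>lebesgue)"
    by (simp only: complex_norm_square[symmetric] integral_complex_of_real)
  then show ?thesis using f by (simp add: norm_l2_def inner_l2_abs L2_norm_def)
qed

lemma norm_l2_rep: "norm a = L2_norm lebesgue (rep_l2 a)"
  using norm_abs_l2[OF rep_l2_L2[of a]] by simp

lemma norm_l2_square: "(norm a)\<^sup>2 = (\<integral>x. (cmod (rep_l2 a x))\<^sup>2 \<partial>lebesgue)"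
  by (simp add: norm_l2_rep L2_norm_def)

lemma rep_l2_diff: "AE x in lebesgue. rep_l2 (a - b) x = rep_l2 a x - rep_l2 b x"
  using rep_abs_l2[OF L2_diff[OF rep_l2_L2[of a] rep_l2_L2[of b]]] minus_l2.abs_eq[of "rep_l2 a" "rep_l2 b"]
  by simp

text \<open>Riesz-Fischer: a subsequence with steps below 4^-n meets the hypothesis of
  \<open>fast_Cauchy_AE\<close>, its pointwise limit differs from each member by a square-integrable
  function, and a Cauchy sequence follows its convergent subsequence.\<close>

instance l2 :: complete_space
proof
  fix X :: "nat \<Rightarrow> l2" assume X: "Cauchy X"
  have "\<exists>N. \<forall>m\<ge>N. \<forall>n\<ge>N. dist (X m) (X n) < 1 / 4 ^ k" for k
    using X by (auto simp: Cauchy_def)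
  then have "\<exists>N. \<forall>k. \<forall>m\<ge>N k. \<forall>n\<ge>N k. dist (X m) (X n) < 1 / 4 ^ k" by (intro choice) blast
  then obtain N where N: "\<And>k m n. m \<ge> N k \<Longrightarrow> n \<ge> N k \<Longrightarrow> dist (X m) (X n) < 1 / 4 ^ k"
    by blast
  \<comment> \<open>Summing all thresholds up to k puts \<open>r (Suc k)\<close> above
    \<open>N k\<close> as well, so consecutive members are closer than 4^-k; the summand k drives
    the indices to infinity.\<close>
  define r where "r k = (\<Sum>j\<le>k. N j) + k" for k
  have rN: "r k \<ge> N k" for k
    unfolding r_def by (simp add: member_le_sum trans_le_add1)
  have rS: "r (Suc k) \<ge> N k" for k
    unfolding r_def using member_le_sum[of k "{..Suc k}" N] by auto
  have rk: "r k \<ge> k" for k by (simp add: r_def)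
  define f where "f n = rep_l2 (X (r n))" for n
  have fL: "f n \<in> L2 lebesgue" and fm: "f n \<in> borel_measurable lebesgue" for n by (simp_all add: f_def)
  have int: "integrable lebesgue (\<lambda>x. (norm (f (Suc n) x - f n x))\<^sup>2)" for n
    by (intro L2_square_integrable L2_diff fL)
  have bnd: "(\<integral>x. (norm (f (Suc n) x - f n x))\<^sup>2 \<partial>lebesgue) \<le> 1 / 16 ^ n" for n
  proof -
    have "(\<integral>x. (norm (f (Suc n) x - f n x))\<^sup>2 \<partial>lebesgue) = (norm (X (r (Suc n)) - X (r n)))\<^sup>2"
      unfolding norm_l2_square
    proof (rule integral_cong_AE)
      show "AE x in lebesgue. (cmod (f (Suc n) x - f n x))\<^sup>2 = (cmod (rep_l2 (X (r (Suc n)) - X (r n)) x))\<^sup>2"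
        using rep_l2_diff[of "X (r (Suc n))" "X (r n)"] by eventually_elim (simp add: f_def)
    qed (use fm in auto)
    also have "\<dots> \<le> (1 / 4 ^ n)\<^sup>2"
      using N[OF rS rN, of n] by (intro power_mono) (auto simp: dist_norm)
    also have "\<dots> = 1 / 16 ^ n" by (simp add: power_one_over power2_eq_square flip: power_mult_distrib)
    finally show ?thesis .
  qed
  obtain G where G: "integrable lebesgue G" and AE: "AE x in lebesgue. (\<lambda>n. f n x) \<longlonglongrightarrow> lim (\<lambda>n. f n x) \<and>
       (\<forall>n. (norm (f n x - lim (\<lambda>n. f n x)))\<^sup>2 \<le> G x / 4 ^ n)"
    by (rule fast_Cauchy_AE[OF int bnd])
  define l where "l x = lim (\<lambda>n. f n x)" for x
  have lm: "l \<in> borel_measurable lebesgue" unfolding l_def by (rule borel_measurable_lim_metric[OF fm])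
  have di: "integrable lebesgue (\<lambda>x. (cmod (f n x - l x))\<^sup>2)" for n
  proof (rule Bochner_Integration.integrable_bound)
    show "integrable lebesgue (\<lambda>x. G x / 4 ^ n)" using G by simp
    show "AE x in lebesgue. norm ((cmod (f n x - l x))\<^sup>2) \<le> norm (G x / 4 ^ n)"
      using AE by eventually_elim (auto simp: l_def intro: order_trans[OF _ divide_right_mono[OF abs_ge_self]])
  qed (use fm lm in measurable)
  have dL: "(\<lambda>x. f n x - l x) \<in> L2 lebesgue" for n
    using fm lm by (intro L2_I di) auto
  have lL: "l \<in> L2 lebesgue" using L2_diff[OF fL[of 0] dL[of 0]] by simp
  have dist: "(norm (X (r n) - abs_l2 l))\<^sup>2 \<le> (\<integral>x. G x \<partial>lebesgue) / 4 ^ n" for n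
  proof -
    have "X (r n) - abs_l2 l = abs_l2 (\<lambda>x. f n x - l x)"
      using minus_l2.abs_eq[of "f n" l] fL lL by (auto simp: f_def)
    then have "(norm (X (r n) - abs_l2 l))\<^sup>2 = (\<integral>x. (cmod (f n x - l x))\<^sup>2 \<partial>lebesgue)"
      by (simp add: norm_abs_l2 dL L2_norm_def)
    also have "\<dots> \<le> (\<integral>x. G x / 4 ^ n \<partial>lebesgue)"
    proof (rule integral_mono_AE[OF di])
      show "AE x in lebesgue. (cmod (f n x - l x))\<^sup>2 \<le> G x / 4 ^ n"
        using AE by eventually_elim (simp add: l_def)
    qed (use G in simp)
    finally show ?thesis by simp
  qed
  have "(\<lambda>n. (\<integral>x. G x \<partial>lebesgue) * (1 / 4) ^ n) \<longlonglongrightarrow> 0"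
    by (intro tendsto_mult_right_zero LIMSEQ_power_zero) auto
  then have z: "(\<lambda>n. (norm (X (r n) - abs_l2 l))\<^sup>2) \<longlonglongrightarrow> 0"
    by (rule Lim_null_comparison[rotated]) (use dist in \<open>auto simp: power_one_over\<close>)
  have "(\<lambda>n. norm (X (r n) - abs_l2 l)) \<longlonglongrightarrow> 0"
    using tendsto_real_sqrt[OF z] by simp
  then have "(\<lambda>n. X (r n) - abs_l2 l) \<longlonglongrightarrow> 0"
    by (rule tendsto_norm_zero_cancel)
  then have lim: "(\<lambda>n. X (r n)) \<longlonglongrightarrow> abs_l2 l"
    by (rule LIM_zero_cancel)
  have sub: "X \<longlonglongrightarrow> abs_l2 l"
  proof (rule metric_LIMSEQ_I)
    fix e :: real assume e: "e > 0"
    obtain M where M: "\<And>m n. m \<ge> M \<Longrightarrow> n \<ge> M \<Longrightarrow> dist (X m) (X n) < e / 2"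
      using metric_CauchyD[OF X half_gt_zero[OF e]] by blast
    obtain K where K: "\<And>n. n \<ge> K \<Longrightarrow> dist (X (r n)) (abs_l2 l) < e / 2"
      using metric_LIMSEQ_D[OF lim half_gt_zero[OF e]] by blast
    have "\<forall>n\<ge>M. dist (X n) (abs_l2 l) < e"
    proof (intro allI impI)
      fix n assume "n \<ge> M"
      then have a: "dist (X n) (X (r (max M K))) < e / 2"
        using rk[of "max M K"] by (intro M) auto
      have b: "dist (X (r (max M K))) (abs_l2 l) < e / 2"
        by (rule K) (rule max.cobounded2)
      show "dist (X n) (abs_l2 l) < e"
        by (rule dist_triangle_half_l[OF a]) (subst dist_commute, rule b)
    qed
    then show "\<exists>no. \<forall>n\<ge>no. dist (X n) (abs_l2 l) < e" ..
  qed
  then show "convergent X" by (auto simp: convergent_def)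
qed

instance l2 :: banach ..

section \<open>Semigroups on Banach spaces\<close>

text \<open>Banach-Steinhaus: the closed sets \<open>E m\<close> cover the complete space, so by
  Baire one of them contains a ball, and on a ball a linear map is controlled by differences of its
  values.\<close>

lemma uniform_boundedness:
  fixes F :: "nat \<Rightarrow> 'a::banach \<Rightarrow> 'b::real_normed_vector"
  assumes lin: "\<And>n. bounded_linear (F n)"
    and pt: "\<And>x. \<exists>B. \<forall>n. norm (F n x) \<le> B"
  shows "\<exists>B. \<forall>n x. norm (F n x) \<le> B * norm x"
proof -
  define E where "E m = {x. \<forall>n. norm (F n x) \<le> real m}" for m
  have cl: "closed (E m)" for m
  proof -
    have "E m = (\<Inter>n. {x. norm (F n x) \<le> real m})" by (auto simp: E_def)
    moreover have "closed {x. norm (F n x) \<le> real m}" for n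
      by (intro closed_Collect_le continuous_intros linear_continuous_on lin)
    ultimately show ?thesis by (simp add: closed_INT)
  qed
  have un: "\<Union>(range E) = UNIV"
  proof -
    have "\<exists>m. x \<in> E m" for x
    proof -
      obtain B where "\<forall>n. norm (F n x) \<le> B" using pt by blast
      moreover obtain m where "B \<le> real m" using real_arch_simple by blast
      ultimately show ?thesis unfolding E_def by (blast intro: order_trans)
    qed
    then show ?thesis by auto
  qed
  have "\<exists>m. interior (E m) \<noteq> {}"
  proof (rule ccontr)
    assume "\<not> ?thesis"
    then have i: "\<And>m. interior (E m) = {}" by blast
    have "interior (\<Union>(range E)) = {}"
      using Met_TC.metric_Baire_category_alt[of "range E"] i cl complete_UNIV
      by auto
    then show False by (simp add: un)
  qed
  then obtain m x0 e where e: "e > 0" "ball x0 e \<subseteq> E m"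
    by (meson all_not_in_conv mem_interior)
  have *: "norm (F n x) \<le> (4 * real m / e) * norm x" for n x
  proof (cases "x = 0")
    case True
    then show ?thesis using bounded_linear.linear[OF lin[of n]] by (simp add: linear_0)
  next
    case False
    interpret bounded_linear "F n" by (rule lin)
    \<comment> \<open>Length e/2 keeps \<open>x0 + y\<close> inside the ball. The difference of two
      values bounded by m is at most 2m, and rescaling gives 4m/e.\<close>
    define y where "y = (e / (2 * norm x)) *\<^sub>R x"
    have "norm y < e" using False e(1) by (simp add: y_def)
    then have "x0 + y \<in> E m" "x0 \<in> E m" using e by (auto simp: dist_norm)
    then have a: "norm (F n (x0 + y)) \<le> real m" "norm (F n x0) \<le> real m" by (auto simp: E_def)
    have "norm (F n y) \<le> 2 * real m"
      using norm_triangle_ineq4[of "F n (x0 + y)" "F n x0"] a by (simp add: add)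
    moreover have "norm (F n y) = e / (2 * norm x) * norm (F n x)"
      using e(1) by (simp add: y_def scaleR)
    ultimately show ?thesis using e(1) False by (simp add: field_simps)
  qed
  then show ?thesis by blast
qed

text \<open>Boundedness uniform in time is not part of the axioms; it comes from strong continuity
  in \<open>bounded_near_0\<close>. The values at negative times are arbitrary.\<close>

locale C0_sgrp =
  fixes S :: "real \<Rightarrow> 'a \<Rightarrow> 'a::banach"
  assumes lin: "\<And>t. t \<ge> 0 \<Longrightarrow> bounded_linear (S t)"
    and S_0: "\<And>x. S 0 x = x"
    and S_add: "\<And>s t x. s \<ge> 0 \<Longrightarrow> t \<ge> 0 \<Longrightarrow> S (s + t) x = S s (S t x)"
    and S_lim: "\<And>x. ((\<lambda>t. S t x) \<longlongrightarrow> x) (at_right 0)"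
begin

text \<open>The graph of the generator: a relation expresses membership in the domain and the value
  at once.\<close>

definition gen :: "'a \<Rightarrow> 'a \<Rightarrow> bool" where
  "gen x y \<longleftrightarrow> ((\<lambda>h. (S h x - x) /\<^sub>R h) \<longlongrightarrow> y) (at_right 0)"

lemma near_0:
  assumes "e > 0"
  obtains d where "d > 0" "\<And>h. 0 \<le> h \<Longrightarrow> h < d \<Longrightarrow> norm (S h x - x) < e"
proof -
  from tendstoD[OF S_lim assms, of x] obtain d where "d > 0"
      "\<And>h. 0 < h \<Longrightarrow> h < d \<Longrightarrow> dist (S h x) x < e"
    by (auto simp: eventually_at_right_field)
  then show ?thesis using that[of d] S_0 assms
    by (metis diff_self dist_norm norm_zero order_le_less)
qed

text \<open>If no bound held near 0, there would be times \<open>t n\<close> tending to 0 along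
  which the operator norms exceed every n. Strong continuity bounds each orbit along these times,
  which contradicts uniform boundedness.\<close>

lemma bounded_near_0: "\<exists>M d. d > 0 \<and> (\<forall>t x. 0 \<le> t \<and> t \<le> d \<longrightarrow> norm (S t x) \<le> M * norm x)"
proof (rule ccontr)
  assume "\<not> ?thesis"
  then have "\<exists>t x. 0 \<le> t \<and> t \<le> 1 / real (Suc n) \<and> norm (S t x) > real n * norm x" for n
    using zero_less_divide_1_iff[of "real (Suc n)"] by (metis not_le of_nat_0_less_iff zero_less_Suc)
  then obtain t x where tx: "\<And>n. 0 \<le> t n" "\<And>n. t n \<le> 1 / real (Suc n)"
      "\<And>n. norm (S (t n) (x n)) > real n * norm (x n)" by metis
  have t0: "t \<longlonglongrightarrow> 0"
    by (rule Lim_null_comparison[OF _ LIMSEQ_inverse_real_of_nat])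
       (use tx in \<open>auto simp: inverse_eq_divide\<close>)
  have "\<exists>B. \<forall>n x. norm (S (t n) x) \<le> B * norm x"
  proof (rule uniform_boundedness)
    show "bounded_linear (S (t n))" for n by (rule lin[OF tx(1)])
    fix x
    obtain d where d: "d > 0" "\<And>h. 0 \<le> h \<Longrightarrow> h < d \<Longrightarrow> norm (S h x - x) < 1"
      using near_0[of 1 x] by auto
    have "eventually (\<lambda>n. t n < d) sequentially" by (rule order_tendstoD(2)[OF t0 d(1)])
    then have "eventually (\<lambda>n. norm (S (t n) x) \<le> 1 + norm x) sequentially"
    proof eventually_elim
      fix n assume "t n < d"
      then have "norm (S (t n) x - x) < 1" using d(2) tx(1) by blast
      then show "norm (S (t n) x) \<le> 1 + norm x" using norm_triangle_sub[of "S (t n) x" x] by simp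
    qed
    then have "Bseq (\<lambda>n. S (t n) x)"
      by (rule BfunI)
    then show "\<exists>B. \<forall>n. norm (S (t n) x) \<le> B" by (meson BseqE)
  qed
  then obtain B where B: "\<And>n x. norm (S (t n) x) \<le> B * norm x" by blast
  obtain n where n: "B \<le> real n" using real_arch_simple by blast
  have "norm (S (t n) (x n)) \<le> real n * norm (x n)"
    by (rule order_trans[OF B mult_right_mono[OF n norm_ge_zero]])
  then show False using tx(3)[of n] by simp
qed

lemma bounded_on_interval:
  obtains M where "M \<ge> 0" "\<And>t x. 0 \<le> t \<Longrightarrow> t \<le> T \<Longrightarrow> norm (S t x) \<le> M * norm x"
proof -
  obtain M d where d: "d > 0" and "\<And>t x. 0 \<le> t \<Longrightarrow> t \<le> d \<Longrightarrow> norm (S t x) \<le> M * norm x"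
    using bounded_near_0 by blast
  \<comment> \<open>The factor \<bar>M\<bar> + 1 is at least 1, so its powers grow with the number
    of steps and the last one also covers all shorter times.\<close>
  then have M: "norm (S t x) \<le> (\<bar>M\<bar> + 1) * norm x" if "0 \<le> t" "t \<le> d" for t x
    using order_trans[OF _ mult_right_mono[of M "\<bar>M\<bar> + 1" "norm x"]] that by force
  have *: "norm (S t x) \<le> (\<bar>M\<bar> + 1) ^ n * norm x" if "0 \<le> t" "t \<le> real n * d" for n t x
    using that
  proof (induction n arbitrary: t x)
    case 0
    then show ?case using S_0 by simp
  next
    case (Suc n)
    show ?case
    proof (cases "t \<le> d")
      case True
      have "norm (S t x) \<le> (\<bar>M\<bar> + 1) * norm x" using M Suc.prems True by blast
      also have "\<dots> \<le> (\<bar>M\<bar> + 1) ^ Suc n * norm x"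
        by (intro mult_right_mono self_le_power) auto
      finally show ?thesis .
    next
      case False
      have "S t x = S (t - d) (S d x)" using S_add[of "t - d" d x] False d by simp
      also have "norm \<dots> \<le> (\<bar>M\<bar> + 1) ^ n * norm (S d x)"
        using Suc.prems False by (intro Suc.IH) (auto simp: algebra_simps)
      also have "\<dots> \<le> (\<bar>M\<bar> + 1) ^ n * ((\<bar>M\<bar> + 1) * norm x)"
        using d by (intro mult_left_mono M) auto
      finally show ?thesis by (simp add: algebra_simps)
    qed
  qed
  obtain n where "T \<le> real n * d" using reals_Archimedean3[OF d] less_imp_le by blast
  with * show ?thesis by (intro that[of "(\<bar>M\<bar> + 1) ^ n"]) auto
qed

lemma S_diff: "t \<ge> 0 \<Longrightarrow> S t (x - y) = S t x - S t y"
  by (rule linear_diff[OF bounded_linear.linear[OF lin]])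

lemma S_scaleR: "t \<ge> 0 \<Longrightarrow> S t (c *\<^sub>R x) = c *\<^sub>R S t x"
  by (rule linear_scale[OF bounded_linear.linear[OF lin]])

text \<open>Continuity from both sides follows from one estimate of \<open>S s (S h x - x)\<close>.
  From the left the base point s moves with h, hence the bound on the operators over the whole of
  [0, t+1].\<close>

lemma continuous_on_S: "continuous_on {0..} (\<lambda>t. S t x)"
  unfolding continuous_on_iff
proof (intro ballI allI impI)
  fix t :: real and e :: real assume t: "t \<in> {0..}" and e: "e > 0"
  obtain M where M: "M \<ge> 0" "\<And>s x. 0 \<le> s \<Longrightarrow> s \<le> t + 1 \<Longrightarrow> norm (S s x) \<le> M * norm x"
    using bounded_on_interval by blast
  obtain d where d: "d > 0" "\<And>h. 0 \<le> h \<Longrightarrow> h < d \<Longrightarrow> norm (S h x - x) < e / (M + 1)"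
    using near_0[of "e / (M + 1)" x] e M by (metis add_nonneg_pos divide_pos_pos zero_less_one)
  have main: "norm (S (s + h) x - S s x) < e" if "0 \<le> s" "s \<le> t + 1" "0 \<le> h" "h < d" for s h
  proof -
    have "norm (S (s + h) x - S s x) = norm (S s (S h x - x))"
      using that by (simp add: S_add S_diff)
    also have "\<dots> \<le> M * norm (S h x - x)" using M that by blast
    also have "\<dots> \<le> M * (e / (M + 1))" using d(2)[OF that(3,4)] M(1) by (intro mult_left_mono) auto
    also have "\<dots> < e" using M(1) e by (simp add: field_simps)
    finally show ?thesis .
  qed
  show "\<exists>d>0. \<forall>x'\<in>{0..}. dist x' t < d \<longrightarrow> dist (S x' x) (S t x) < e"
  proof (intro exI[of _ "min d 1"] conjI ballI impI)
    fix s assume s: "s \<in> {0..}" "dist s t < min d 1"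
    show "dist (S s x) (S t x) < e"
    proof (cases "s \<le> t")
      case True
      then show ?thesis using main[of s "t - s"] s by (auto simp: dist_norm norm_minus_commute)
    next
      case False
      then show ?thesis using main[of t "s - t"] s t by (auto simp: dist_norm)
    qed
  qed (use d in auto)
qed

lemma gen_S:
  assumes "gen x y" "t \<ge> 0"
  shows "gen (S t x) (S t y)"
  unfolding gen_def
proof (rule Lim_transform_eventually)
  show "((\<lambda>h. S t ((S h x - x) /\<^sub>R h)) \<longlongrightarrow> S t y) (at_right 0)"
    using assms by (intro bounded_linear.tendsto[OF lin]) (auto simp: gen_def)
  have "S t ((S h x - x) /\<^sub>R h) = (S h (S t x) - S t x) /\<^sub>R h" if "h > 0" for h
    using that assms(2) S_add[of t h x] S_add[of h t x] by (simp add: S_scaleR S_diff add.commute)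
  then show "\<forall>\<^sub>F h in at_right 0. S t ((S h x - x) /\<^sub>R h) = (S h (S t x) - S t x) /\<^sub>R h"
    by (auto simp: eventually_at_right_field intro: exI[of _ 1])
qed

text \<open>To the right, \<open>S t\<close> is applied to the difference quotient at 0. To the left
  the base point s < t moves, and replacing \<open>S s y\<close> by \<open>S t y\<close> costs a
  second error; each of the two gets half of e.\<close>

lemma S_has_vector_derivative:
  assumes g: "gen x y" and t: "t \<ge> 0"
  shows "((\<lambda>t. S t x) has_vector_derivative S t y) (at t within {0..})"
  unfolding has_vector_derivative_def has_derivative_within_alt
proof (intro conjI allI impI)
  show "bounded_linear (\<lambda>h. h *\<^sub>R S t y)" by (rule bounded_linear_scaleR_left)
  fix e :: real assume e: "e > 0"
  obtain M where M: "M \<ge> 0" "\<And>s x. 0 \<le> s \<Longrightarrow> s \<le> t + 1 \<Longrightarrow> norm (S s x) \<le> M * norm x"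
    using bounded_on_interval by blast
  have e2: "e / (2 * (M + 1)) > 0" using e M by simp
  have Me: "M * (e / (2 * (M + 1))) \<le> e / 2" using M(1) e by (simp add: field_simps)
  obtain d1 where d1: "d1 > 0" "\<And>h. 0 < h \<Longrightarrow> h < d1 \<Longrightarrow> norm ((S h x - x) /\<^sub>R h - y) < e / (2 * (M + 1))"
    using tendstoD[OF g[unfolded gen_def] e2] by (auto simp: eventually_at_right_field dist_norm)
  have q: "norm (S h x - x - h *\<^sub>R y) \<le> h * (e / (2 * (M + 1)))" if "0 < h" "h < d1" for h
  proof -
    have "S h x - x - h *\<^sub>R y = h *\<^sub>R ((S h x - x) /\<^sub>R h - y)" using that by (simp add: algebra_simps)
    then show ?thesis using mult_left_mono[OF less_imp_le[OF d1(2)[OF that]], of h] that by simp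
  qed
  obtain d2 where d2: "d2 > 0" "\<And>s. 0 \<le> s \<Longrightarrow> dist s t < d2 \<Longrightarrow> dist (S s y) (S t y) < e / 2"
    using continuous_on_S[of y] t half_gt_zero[OF e] unfolding continuous_on_iff by (metis atLeast_iff)
  show "\<exists>d>0. \<forall>s\<in>{0..}. norm (s - t) < d \<longrightarrow>
      norm (S s x - S t x - (s - t) *\<^sub>R S t y) \<le> e * norm (s - t)"
  proof (intro exI[of _ "min d1 d2"] conjI ballI impI)
    fix s assume s: "s \<in> {0..}" "norm (s - t) < min d1 d2"
    consider "s = t" | "s > t" | "s < t" by linarith
    then show "norm (S s x - S t x - (s - t) *\<^sub>R S t y) \<le> e * norm (s - t)"
    proof cases
      case 2
      define h where "h = s - t"
      have h: "h > 0" "h < d1" using 2 s by (auto simp: h_def)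
      have "S s x - S t x - (s - t) *\<^sub>R S t y = S t (S h x - x - h *\<^sub>R y)"
        using S_add[of t h x] h t by (simp add: S_diff S_scaleR h_def)
      also have "norm \<dots> \<le> M * (h * (e / (2 * (M + 1))))"
        using t by (intro order_trans[OF M(2)] mult_left_mono q h M) auto
      also have "\<dots> = h * (M * (e / (2 * (M + 1))))" by simp
      also have "\<dots> \<le> h * e" using h e by (intro mult_left_mono order_trans[OF Me]) auto
      finally show ?thesis using h by (simp add: h_def mult.commute)
    next
      case 3
      define h where "h = t - s"
      have h: "h > 0" "h < d1" using 3 s by (auto simp: h_def)
      have "S s x - S t x - (s - t) *\<^sub>R S t y = - S s (S h x - x - h *\<^sub>R y) - h *\<^sub>R (S s y - S t y)"
        using S_add[of s h x] h s by (simp add: S_diff S_scaleR h_def scaleR_diff_left scaleR_diff_right)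
      also have "norm \<dots> \<le> norm (S s (S h x - x - h *\<^sub>R y)) + h * norm (S s y - S t y)"
        using h norm_triangle_ineq4[of "- S s (S h x - x - h *\<^sub>R y)" "h *\<^sub>R (S s y - S t y)"] by simp
      also have "\<dots> \<le> M * (h * (e / (2 * (M + 1)))) + h * (e / 2)"
      proof (intro add_mono mult_left_mono)
        show "norm (S s (S h x - x - h *\<^sub>R y)) \<le> M * (h * (e / (2 * (M + 1))))"
          using s 3 by (intro order_trans[OF M(2)] mult_left_mono q h M) auto
        show "norm (S s y - S t y) \<le> e / 2"
          using d2(2)[of s] s by (simp add: dist_norm)
      qed (use h in auto)
      also have "M * (h * (e / (2 * (M + 1)))) = h * (M * (e / (2 * (M + 1))))" by simp
      also have "\<dots> + h * (e / 2) \<le> h * (e / 2) + h * (e / 2)" using h Me by (intro add_mono mult_left_mono) auto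
      finally show ?thesis using h by (simp add: h_def abs_if algebra_simps)
    qed (use e in simp)
  qed (use d1 d2 in auto)
qed

lemma S_integrable: "0 \<le> a \<Longrightarrow> (\<lambda>t. S t x) integrable_on {a..b}"
  by (intro integrable_continuous_real continuous_on_subset[OF continuous_on_S]) auto

text \<open>A bounded operator passes under the integral, and the gained time is moved into the
  weight by translation.\<close>

lemma S_integral_shift:
  assumes "0 \<le> a" "a \<le> b" "0 \<le> h" "continuous_on UNIV \<eta>"
  shows "S h (integral {a..b} (\<lambda>t. \<eta> t *\<^sub>R S t x)) = integral {a + h..b + h} (\<lambda>t. \<eta> (t - h) *\<^sub>R S t x)"
proof -
  have c: "continuous_on {a..b} (\<lambda>t. \<eta> t *\<^sub>R S t x)"
    using assms by (intro continuous_intros continuous_on_subset[OF continuous_on_S] continuous_on_subset[OF assms(4)]) auto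
  have "S h (integral {a..b} (\<lambda>t. \<eta> t *\<^sub>R S t x)) = integral {a..b} (S h \<circ> (\<lambda>t. \<eta> t *\<^sub>R S t x))"
    by (rule integral_linear[symmetric, OF integrable_continuous_real[OF c] lin[OF assms(3)]])
  also have "\<dots> = integral {a..b} ((\<lambda>t. \<eta> (t - h) *\<^sub>R S t x) \<circ> (+) h)"
    by (rule integral_cong) (use assms in \<open>auto simp: S_scaleR S_add\<close>)
  also have "\<dots> = integral {a + h..b + h} (\<lambda>t. \<eta> (t - h) *\<^sub>R S t x)"
    by (rule integral_shift_Icc_real)
  finally show ?thesis .
qed

lemma mean_tendsto: "((\<lambda>h. integral {0..h} (\<lambda>t. S t x) /\<^sub>R h) \<longlongrightarrow> x) (at_right 0)"
proof -
  have "((\<lambda>u. integral {0..u} (\<lambda>t. S t x)) has_vector_derivative S 0 x) (at 0 within {0..1})"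
    by (rule integral_has_vector_derivative) (auto intro: continuous_on_subset[OF continuous_on_S])
  then have "((\<lambda>u. (1 / norm (u - 0)) *\<^sub>R (integral {0..u} (\<lambda>t. S t x) - (integral {0..0} (\<lambda>t. S t x) + (u - 0) *\<^sub>R x))) \<longlongrightarrow> 0)
      (at_right 0)"
    using at_within_Icc_at_right[of 0 "1::real"]
    by (simp only: has_vector_derivative_def has_derivative_within S_0)
  then have "((\<lambda>u. integral {0..u} (\<lambda>t. S t x) /\<^sub>R u - x) \<longlongrightarrow> 0) (at_right 0)"
    by (rule Lim_transform_eventually)
       (auto simp: eventually_at_right_field scaleR_diff_right inverse_eq_divide intro!: exI[of _ 1])
  then show ?thesis by (rule LIM_zero_cancel)
qed

text \<open>With J(h) the integral over [0,h], the sums J(\<tau>) + S(\<tau>) J(h) and J(h) + S(h)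
  J(\<tau>) are both J(h+\<tau>). Hence the difference quotient of J(h) equals
  \<open>S h - I\<close> applied to the mean J(\<tau>)/\<tau>, which tends to x.\<close>

lemma gen_integral:
  assumes "h \<ge> 0"
  shows "gen (integral {0..h} (\<lambda>t. S t x)) (S h x - x)"
  unfolding gen_def
proof (rule Lim_transform_eventually)
  define J where "J h = integral {0..h} (\<lambda>t. S t x)" for h
  show "((\<lambda>\<tau>. S h (J \<tau> /\<^sub>R \<tau>) - J \<tau> /\<^sub>R \<tau>) \<longlongrightarrow> S h x - x) (at_right 0)"
    unfolding J_def by (intro tendsto_diff bounded_linear.tendsto[OF lin[OF assms]] mean_tendsto)
  have "S h (J \<tau> /\<^sub>R \<tau>) - J \<tau> /\<^sub>R \<tau> = (S \<tau> (J h) - J h) /\<^sub>R \<tau>" if "\<tau> > 0" for \<tau>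
  proof -
    have a: "S \<tau> (J h) = integral {\<tau>..h + \<tau>} (\<lambda>t. S t x)"
      unfolding J_def using S_integral_shift[of 0 h \<tau> "\<lambda>_. 1" x] that assms by (simp add: continuous_on_const)
    have b: "S h (J \<tau>) = integral {h..h + \<tau>} (\<lambda>t. S t x)"
      unfolding J_def using S_integral_shift[of 0 \<tau> h "\<lambda>_. 1" x] that assms by (simp add: continuous_on_const add.commute)
    have "J \<tau> + S \<tau> (J h) = J h + S h (J \<tau>)"
      unfolding a b unfolding J_def using that assms
      by (subst (1 2) Henstock_Kurzweil_Integration.integral_combine) (auto intro!: S_integrable)
    then have "S \<tau> (J h) - J h = S h (J \<tau>) - J \<tau>" by (simp add: algebra_simps)
    then show ?thesis by (simp add: S_scaleR[OF assms] scaleR_diff_right)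
  qed
  then show "\<forall>\<^sub>F \<tau> in at_right 0. S h (J \<tau> /\<^sub>R \<tau>) - J \<tau> /\<^sub>R \<tau> =
      (S \<tau> (integral {0..h} (\<lambda>t. S t x)) - integral {0..h} (\<lambda>t. S t x)) /\<^sub>R \<tau>"
    unfolding J_def by (auto simp: eventually_at_right_field intro: exI[of _ 1])
qed

lemma gen_scaleR: "gen x y \<Longrightarrow> gen (c *\<^sub>R x) (c *\<^sub>R y)"
  unfolding gen_def
proof (rule Lim_transform_eventually[rotated])
  assume "((\<lambda>h. (S h x - x) /\<^sub>R h) \<longlongrightarrow> y) (at_right 0)"
  then show "((\<lambda>h. c *\<^sub>R ((S h x - x) /\<^sub>R h)) \<longlongrightarrow> c *\<^sub>R y) (at_right 0)"
    by (intro tendsto_intros)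
  have "c *\<^sub>R ((S h x - x) /\<^sub>R h) = (S h (c *\<^sub>R x) - c *\<^sub>R x) /\<^sub>R h" if "h > 0" for h
    using that by (simp add: S_scaleR algebra_simps)
  then show "\<forall>\<^sub>F h in at_right 0. c *\<^sub>R ((S h x - x) /\<^sub>R h) = (S h (c *\<^sub>R x) - c *\<^sub>R x) /\<^sub>R h"
    by (auto simp: eventually_at_right_field intro: exI[of _ 1])
qed

lemma gen_diff:
  assumes "gen x y" "gen x' y'" shows "gen (x - x') (y - y')"
  unfolding gen_def
proof (rule Lim_transform_eventually)
  show "((\<lambda>h. (S h x - x) /\<^sub>R h - (S h x' - x') /\<^sub>R h) \<longlongrightarrow> y - y') (at_right 0)"
    using assms by (intro tendsto_intros) (auto simp: gen_def)
  have "(S h x - x) /\<^sub>R h - (S h x' - x') /\<^sub>R h = (S h (x - x') - (x - x')) /\<^sub>R h" if "h > 0" for h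
    using that by (simp add: S_diff algebra_simps)
  then show "\<forall>\<^sub>F h in at_right 0. (S h x - x) /\<^sub>R h - (S h x' - x') /\<^sub>R h = (S h (x - x') - (x - x')) /\<^sub>R h"
    by (auto simp: eventually_at_right_field intro: exI[of _ 1])
qed

lemma gen_dense:
  assumes "e > 0"
  obtains h where "h > 0" "norm (integral {0..h} (\<lambda>t. S t x) /\<^sub>R h - x) < e"
    "gen (integral {0..h} (\<lambda>t. S t x) /\<^sub>R h) ((S h x - x) /\<^sub>R h)"
proof -
  obtain b where b: "b > 0" "\<And>h. 0 < h \<Longrightarrow> h < b \<Longrightarrow> dist (integral {0..h} (\<lambda>t. S t x) /\<^sub>R h) x < e"
    using tendstoD[OF mean_tendsto assms] by (auto simp: eventually_at_right_field)
  show ?thesis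
    using b(2)[of "b / 2"] b(1) by (intro that[of "b / 2"] gen_scaleR gen_integral) (auto simp: dist_norm)
qed

text \<open>Applying \<open>S h\<close> translates the weight, so the difference quotient falls on
  \<eta> and not on the orbit; this is why any x is admissible. The support inside (0,T) makes the
  strips [0,h] and [T,T+h] contribute nothing once h < T - b.\<close>

lemma gen_weighted_integral:
  assumes der: "\<And>t. (\<eta> has_real_derivative \<eta>' t) (at t)" and cont: "continuous_on UNIV \<eta>'"
    and supp: "0 < a" "b < T" "0 < T" "\<And>t. t \<notin> {a..b} \<Longrightarrow> \<eta> t = 0"
  shows "gen (integral {0..T} (\<lambda>t. \<eta> t *\<^sub>R S t x)) (- integral {0..T} (\<lambda>t. \<eta>' t *\<^sub>R S t x))"
proof -
  define W where "W = integral {0..T} (\<lambda>t. \<eta> t *\<^sub>R S t x)"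
  have \<eta>c: "continuous_on UNIV \<eta>"
    using der by (meson DERIV_isCont continuous_at_imp_continuous_on)
  have Sc: "continuous_on {0..c} (\<lambda>t. S t x)" for c
    by (rule continuous_on_subset[OF continuous_on_S]) auto
  have SW: "S h W = integral {0..T} (\<lambda>t. \<eta> (t - h) *\<^sub>R S t x)" if h: "0 < h" "h < T - b" "h < T" for h
  proof -
    let ?f = "\<lambda>t. \<eta> (t - h) *\<^sub>R S t x"
    have c: "continuous_on {0..T + h} ?f"
      by (intro continuous_intros Sc continuous_on_compose2[OF \<eta>c]) auto
    have "S h W = integral {h..T + h} ?f"
      unfolding W_def using S_integral_shift[of 0 T h \<eta> x] \<eta>c supp h by simp
    also have "\<dots> = integral {0..h} ?f + integral {h..T + h} ?f"
    proof -
      have "integral {0..h} ?f = integral {0..h} (\<lambda>t. 0)"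
        by (rule integral_cong) (use supp h in auto)
      then show ?thesis by simp
    qed
    also have "\<dots> = integral {0..T + h} ?f"
      using h supp by (intro Henstock_Kurzweil_Integration.integral_combine integrable_continuous_real c) auto
    also have "\<dots> = integral {0..T} ?f + integral {T..T + h} ?f"
      using h supp by (intro Henstock_Kurzweil_Integration.integral_combine[symmetric] integrable_continuous_real c) auto
    also have "integral {T..T + h} ?f = integral {T..T + h} (\<lambda>t. 0)"
      by (rule integral_cong) (use supp h in auto)
    finally show ?thesis by simp
  qed
  obtain M where M: "M \<ge> 0" "\<And>s x. 0 \<le> s \<Longrightarrow> s \<le> T \<Longrightarrow> norm (S s x) \<le> M * norm x"
    using bounded_on_interval by blast
  \<comment> \<open>The summand 1 makes B positive and leaves the factor (B - 1)/B below 1, so the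
    final estimate is strict.\<close>
  define B where "B = M * norm x * T + 1"
  have B: "B > 0" using M supp by (simp add: B_def add_nonneg_pos)
  \<comment> \<open>The interval starts at -1 because the mean value point below lies between t - h
    and t, with t in [0,T] and h < 1.\<close>
  have uc: "uniformly_continuous_on {-1..T} \<eta>'"
    by (intro compact_uniformly_continuous continuous_on_subset[OF cont]) auto
  show ?thesis
    unfolding gen_def W_def[symmetric]
  proof (rule tendstoI)
    fix e :: real assume "e > 0"
    then have "e / B > 0" using B by simp
    then obtain d where d: "d > 0" "\<And>s t. s \<in> {-1..T} \<Longrightarrow> t \<in> {-1..T} \<Longrightarrow> dist s t < d \<Longrightarrow> dist (\<eta>' s) (\<eta>' t) < e / B"
      using uc unfolding uniformly_continuous_on_def by metis
    have "dist ((S h W - W) /\<^sub>R h) (- integral {0..T} (\<lambda>t. \<eta>' t *\<^sub>R S t x)) < e"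
      if h: "0 < h" "h < min (min 1 d) (min T (T - b))" for h
    proof -
      have i1: "(\<lambda>t. \<eta> (t - h) *\<^sub>R S t x) integrable_on {0..T}" and i2: "(\<lambda>t. \<eta> t *\<^sub>R S t x) integrable_on {0..T}"
        and i3: "(\<lambda>t. \<eta>' t *\<^sub>R S t x) integrable_on {0..T}"
        by (intro integrable_continuous_real continuous_intros Sc continuous_on_compose2[OF \<eta>c]
            continuous_on_subset[OF \<eta>c] continuous_on_subset[OF cont]; simp)+
      let ?q = "\<lambda>t. (\<eta> (t - h) - \<eta> t) / h + \<eta>' t"
      have "(S h W - W) /\<^sub>R h + integral {0..T} (\<lambda>t. \<eta>' t *\<^sub>R S t x) = integral {0..T} (\<lambda>t. ?q t *\<^sub>R S t x)"
      proof -
        have "S h W - W = integral {0..T} (\<lambda>t. \<eta> (t - h) *\<^sub>R S t x - \<eta> t *\<^sub>R S t x)"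
          using SW h i1 i2 by (simp add: W_def Henstock_Kurzweil_Integration.integral_diff)
        then have "(S h W - W) /\<^sub>R h = integral {0..T} (\<lambda>t. (\<eta> (t - h) *\<^sub>R S t x - \<eta> t *\<^sub>R S t x) /\<^sub>R h)"
          by simp
        moreover have "(\<lambda>t. (\<eta> (t - h) *\<^sub>R S t x - \<eta> t *\<^sub>R S t x) /\<^sub>R h) integrable_on {0..T}"
          by (intro integrable_cmul integrable_diff i1 i2)
        ultimately have "(S h W - W) /\<^sub>R h + integral {0..T} (\<lambda>t. \<eta>' t *\<^sub>R S t x) =
            integral {0..T} (\<lambda>t. (\<eta> (t - h) *\<^sub>R S t x - \<eta> t *\<^sub>R S t x) /\<^sub>R h + \<eta>' t *\<^sub>R S t x)"
          using i3 by (simp add: Henstock_Kurzweil_Integration.integral_add)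
        also have "\<dots> = integral {0..T} (\<lambda>t. ?q t *\<^sub>R S t x)"
          by (rule integral_cong) (use h in \<open>simp add: algebra_simps divide_inverse\<close>)
        finally show ?thesis .
      qed
      also have "norm \<dots> \<le> (e / B * (M * norm x)) * (T - 0)"
      proof (rule integral_bound)
        show "continuous_on {0..T} (\<lambda>t. ?q t *\<^sub>R S t x)"
          using h by (intro continuous_intros Sc continuous_on_compose2[OF \<eta>c]
            continuous_on_subset[OF \<eta>c] continuous_on_subset[OF cont]) auto
        fix t assume t: "t \<in> {0..T}"
        obtain z where z: "z > t - h" "z < t" "\<eta> t - \<eta> (t - h) = (t - (t - h)) * \<eta>' z"
          using MVT2[of "t - h" t \<eta> \<eta>'] der h by auto
        have "?q t = \<eta>' t - \<eta>' z" using z h by (simp add: field_simps)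
        moreover have "dist (\<eta>' t) (\<eta>' z) < e / B" by (intro d(2)) (use t z h in \<open>auto simp: dist_norm\<close>)
        ultimately have "\<bar>?q t\<bar> \<le> e / B" by (simp add: dist_norm)
        then show "norm (?q t *\<^sub>R S t x) \<le> e / B * (M * norm x)"
          unfolding norm_scaleR using t \<open>e / B > 0\<close> by (intro mult_mono M) auto
      qed (use supp in simp)
      also have "\<dots> = e * ((B - 1) / B)" by (simp add: B_def field_simps)
      also have "\<dots> < e" using \<open>e > 0\<close> B by (simp add: field_simps)
      finally show ?thesis by (simp add: dist_norm)
    qed
    then show "\<forall>\<^sub>F h in at_right 0. dist ((S h W - W) /\<^sub>R h) (- integral {0..T} (\<lambda>t. \<eta>' t *\<^sub>R S t x)) < e"
      using d supp by (auto simp: eventually_at_right_field intro!: exI[of _ "min (min 1 d) (min T (T - b))"])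
  qed
qed

end

section \<open>Functions on an interval\<close>

lemma sigma_finite_ivl: "sigma_finite_measure (ivl L)"
  by (intro sigma_finite_measure_restrict_space sigma_finite_lebesgue) auto

lemma finite_measure_ivl: "finite_measure (ivl L)"
  by (rule finite_measure_lebesgue_on) (rule lmeasurable_interval)

lemma space_ivl [simp]: "space (ivl L) = {0<..<L}"
  by simp

lemma integrable_ivl_bounded:
  fixes f :: "real \<Rightarrow> 'b::{banach, second_countable_topology}"
  assumes "f \<in> borel_measurable (ivl L)" "\<And>x. x \<in> {0<..<L} \<Longrightarrow> norm (f x) \<le> C"
  shows "integrable (ivl L) f"
  by (rule finite_measure.integrable_const_bound[OF finite_measure_ivl, where B = C])
     (use assms in auto)

lemma L2_ivl_bounded:
  assumes "f \<in> borel_measurable (ivl L)" "\<And>x. x \<in> {0<..<L} \<Longrightarrow> cmod (f x) \<le> C"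
  shows "f \<in> L2 (ivl L)"
  by (intro L2_I integrable_ivl_bounded[where C = "C\<^sup>2"])
     (use assms in \<open>auto intro: power_mono\<close>)

lemma L2_ivl_integrable: "f \<in> L2 (ivl L) \<Longrightarrow> integrable (ivl L) f"
  using L2_mult_integrable[of "\<lambda>x. 1" "ivl L" f] L2_ivl_bounded[of "\<lambda>x. 1" L 1] by simp

lemma continuous_ivl_measurable:
  "continuous_on {0..L} f \<Longrightarrow> f \<in> borel_measurable (ivl L)"
  for f :: "real \<Rightarrow> 'b::{real_normed_vector, second_countable_topology}"
  by (rule continuous_imp_measurable_on_sets_lebesgue) (auto intro: continuous_on_subset)

lemma continuous_Icc_bounded:
  fixes f :: "real \<Rightarrow> 'b::real_normed_vector"
  assumes "continuous_on {a..b} f"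
  shows "\<exists>C. \<forall>x\<in>{a..b}. norm (f x) \<le> C"
  using compact_imp_bounded[OF compact_continuous_image[OF assms compact_Icc]] unfolding bounded_iff by blast

lemma continuous_L2_ivl:
  assumes "continuous_on {0..L} f" shows "f \<in> L2 (ivl L)"
proof -
  obtain C where "\<forall>x\<in>{0..L}. norm (f x) \<le> C"
    using continuous_Icc_bounded[OF assms] by blast
  then show ?thesis by (intro L2_ivl_bounded[where C = C] continuous_ivl_measurable assms) auto
qed

lemma L2_mult_bounded:
  assumes "f \<in> L2 M" "g \<in> borel_measurable M" "\<And>x. x \<in> space M \<Longrightarrow> cmod (g x) \<le> C"
  shows "(\<lambda>x. f x * g x) \<in> L2 M" "(\<lambda>x. g x * f x) \<in> L2 M"
proof -
  have "(\<lambda>x. g x * f x) \<in> borel_measurable M"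
    using assms L2_measurable by (intro borel_measurable_times)
  then show "(\<lambda>x. g x * f x) \<in> L2 M"
    by (rule L2_bound[OF assms(1), where C = C]) (auto simp: norm_mult intro: mult_right_mono assms)
  then show "(\<lambda>x. f x * g x) \<in> L2 M" by (simp add: mult.commute)
qed

lemma L2_mult_continuous:
  assumes "f \<in> L2 (ivl L)" "continuous_on {0..L} g"
  shows "(\<lambda>x. f x * g x) \<in> L2 (ivl L)" "(\<lambda>x. g x * f x) \<in> L2 (ivl L)"
proof -
  obtain C where C: "\<forall>x\<in>{0..L}. norm (g x) \<le> C"
    using continuous_Icc_bounded[OF assms(2)] by blast
  show "(\<lambda>x. f x * g x) \<in> L2 (ivl L)" "(\<lambda>x. g x * f x) \<in> L2 (ivl L)"
    by (rule L2_mult_bounded[OF assms(1) continuous_ivl_measurable[OF assms(2)], of C]; use C in auto)+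
qed

section \<open>The interval inside the line\<close>

text \<open>The real indicator with \<open>scaleR\<close> is the form in which integrals and
  measurability over a restricted space are rewritten, so both transfer directly.\<close>

definition emb :: "real \<Rightarrow> (real \<Rightarrow> complex) \<Rightarrow> l2" where
  "emb L f = abs_l2 (\<lambda>x. indicator {0<..<L} x *\<^sub>R f x)"

lemma L2_ivl_iff: "f \<in> L2 (ivl L) \<longleftrightarrow> (\<lambda>x. indicator {0<..<L} x *\<^sub>R f x) \<in> L2 lebesgue"
proof -
  have "(\<lambda>x. (cmod (indicator {0<..<L} x *\<^sub>R f x))\<^sup>2) = (\<lambda>x. indicator {0<..<L} x *\<^sub>R (cmod (f x))\<^sup>2)"
    by (auto simp: indicator_def)
  then show ?thesis
    by (simp add: L2_def borel_measurable_restrict_space_iff integrable_restrict_space)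
qed

lemma integral_ivl: "(\<integral>x. f x \<partial>ivl L) = (\<integral>x. indicator {0<..<L} x *\<^sub>R f x \<partial>lebesgue)"
  for f :: "real \<Rightarrow> 'b::{banach, second_countable_topology}"
  by (rule integral_restrict_space) auto

lemma AE_ivl: "(AE x in ivl L. P x) \<longleftrightarrow> (AE x in lebesgue. x \<in> {0<..<L} \<longrightarrow> P x)"
  by (rule AE_restrict_space_iff) auto

lemma rep_l2_ivl [simp]: "rep_l2 a \<in> L2 (ivl L)"
proof -
  have "(\<lambda>x. indicator {0<..<L} x *\<^sub>R rep_l2 a x) \<in> L2 lebesgue"
  proof (rule L2_bound[OF rep_l2_L2[of a], where C = 1])
    show "(\<lambda>x. indicator {0<..<L} x *\<^sub>R rep_l2 a x) \<in> borel_measurable lebesgue"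
      by (intro borel_measurable_scaleR borel_measurable_indicator) auto
  qed (auto simp: indicator_def)
  then show ?thesis by (simp add: L2_ivl_iff)
qed

lemma rep_emb:
  assumes "f \<in> L2 (ivl L)" shows "AE x in ivl L. rep_l2 (emb L f) x = f x"
proof -
  have "AE x in lebesgue. rep_l2 (emb L f) x = indicator {0<..<L} x *\<^sub>R f x"
    unfolding emb_def using assms by (intro rep_abs_l2) (simp add: L2_ivl_iff)
  then show ?thesis unfolding AE_ivl by eventually_elim simp
qed

lemma emb_eq_iff:
  assumes "f \<in> L2 (ivl L)" "g \<in> L2 (ivl L)"
  shows "emb L f = emb L g \<longleftrightarrow> (AE x in ivl L. f x = g x)"
proof -
  have "emb L f = emb L g \<longleftrightarrow>
      (AE x in lebesgue. indicator {0<..<L} x *\<^sub>R f x = indicator {0<..<L} x *\<^sub>R g x)"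
    unfolding emb_def using assms by (intro abs_l2_eq_iff) (simp_all add: L2_ivl_iff)
  also have "\<dots> \<longleftrightarrow> (AE x in ivl L. f x = g x)"
    unfolding AE_ivl by (intro AE_cong) (auto simp: indicator_def)
  finally show ?thesis .
qed

lemma emb_cong_AE:
  assumes "f \<in> L2 (ivl L)" "g \<in> L2 (ivl L)" "AE x in ivl L. f x = g x" shows "emb L f = emb L g"
  using assms by (simp add: emb_eq_iff)

lemma emb_cong: "(\<And>x. x \<in> {0<..<L} \<Longrightarrow> f x = g x) \<Longrightarrow> emb L f = emb L g"
  unfolding emb_def by (intro arg_cong[where f = abs_l2] ext) (auto simp: indicator_def)

lemma norm_emb: "f \<in> L2 (ivl L) \<Longrightarrow> norm (emb L f) = L2_norm (ivl L) f"
  unfolding emb_def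
  by (subst norm_abs_l2)
     (auto simp: L2_ivl_iff L2_norm_def integral_ivl indicator_def intro!: arg_cong[where f = sqrt] Bochner_Integration.integral_cong)

lemma norm_emb_square: "f \<in> L2 (ivl L) \<Longrightarrow> (norm (emb L f))\<^sup>2 = (\<integral>x. (cmod (f x))\<^sup>2 \<partial>ivl L)"
  by (simp add: norm_emb L2_norm_def)

lemma emb_add: "f \<in> L2 (ivl L) \<Longrightarrow> g \<in> L2 (ivl L) \<Longrightarrow> emb L (\<lambda>x. f x + g x) = emb L f + emb L g"
  by (simp add: emb_def L2_ivl_iff plus_l2.abs_eq scaleR_add_right)

lemma emb_diff: "f \<in> L2 (ivl L) \<Longrightarrow> g \<in> L2 (ivl L) \<Longrightarrow> emb L (\<lambda>x. f x - g x) = emb L f - emb L g"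
  by (simp add: emb_def L2_ivl_iff minus_l2.abs_eq scaleR_diff_right)

lemma emb_cmult: "f \<in> L2 (ivl L) \<Longrightarrow> emb L (\<lambda>x. c * f x) = cscale c (emb L f)"
  by (simp add: emb_def L2_ivl_iff cscale.abs_eq)

lemma emb_scaleR: "f \<in> L2 (ivl L) \<Longrightarrow> emb L (\<lambda>x. complex_of_real c * f x) = c *\<^sub>R emb L f"
  by (simp add: emb_cmult scaleR_l2_def)

lemma pair_emb:
  assumes "f \<in> L2 (ivl L)" "g \<in> L2 (ivl L)"
  shows "pair_l2 (emb L f) (emb L g) = (\<integral>x. f x * g x \<partial>ivl L)"
  using assms by (auto simp: emb_def L2_ivl_iff pair_l2.abs_eq integral_ivl indicator_def intro!: Bochner_Integration.integral_cong)

lemma cnj_emb: "f \<in> L2 (ivl L) \<Longrightarrow> cnj_l2 (emb L f) = emb L (\<lambda>x. cnj (f x))"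
  by (simp add: emb_def L2_ivl_iff cnj_l2.abs_eq)

lemma inner_emb:
  assumes "f \<in> L2 (ivl L)" "g \<in> L2 (ivl L)"
  shows "inner (emb L f) (emb L g) = Re (\<integral>x. f x * cnj (g x) \<partial>ivl L)"
  using assms by (simp add: inner_l2_def cnj_emb pair_emb L2_cnj)

lemma pair_l2_eq_integral: "pair_l2 a b = (\<integral>x. rep_l2 a x * rep_l2 b x \<partial>lebesgue)"
  using pair_l2.abs_eq[of "rep_l2 a" "rep_l2 b"] by simp

lemma pair_l2_commute: "pair_l2 a b = pair_l2 b a"
  by (simp add: pair_l2_eq_integral mult.commute)

text \<open>Only the real Cauchy-Schwarz inequality is available. Multiplying b by a suitable unit c
  makes the pairing real and nonnegative, so its modulus is a real inner product.\<close>

lemma cmod_pair_l2: "cmod (pair_l2 a b) \<le> norm a * norm b"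
proof -
  obtain c where c: "cmod c = 1" "pair_l2 a b * c = complex_of_real (cmod (pair_l2 a b))"
  proof (cases "pair_l2 a b = 0")
    case False
    show ?thesis
      by (rule that[of "cnj (pair_l2 a b) / cmod (pair_l2 a b)"])
         (use False in \<open>simp_all add: norm_divide complex_norm_square[symmetric] power2_eq_square\<close>)
  qed (use that[of 1] in simp)
  \<comment> \<open>The conjugation undoes the one in the second argument of the inner
    product.\<close>
  define b' where "b' = cnj_l2 (cscale c b)"
  have b': "b' = abs_l2 (\<lambda>x. cnj (c * rep_l2 b x))" "(\<lambda>x. cnj (c * rep_l2 b x)) \<in> L2 lebesgue"
    unfolding b'_def using cscale.abs_eq[of "rep_l2 b" c] cnj_l2.abs_eq[of "\<lambda>x. c * rep_l2 b x"]
    by (simp_all add: L2_cmult L2_cnj del: complex_cnj_mult)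
  have "inner a b' = Re (\<integral>x. rep_l2 a x * cnj (cnj (c * rep_l2 b x)) \<partial>lebesgue)"
    using inner_l2_abs[OF rep_l2_L2[of a] b'(2)] by (simp add: b'(1))
  also have "\<dots> = Re (c * pair_l2 a b)"
    by (simp add: pair_l2_eq_integral algebra_simps flip: integral_mult_right_zero)
  also have "\<dots> = cmod (pair_l2 a b)" using c(2) by (simp add: mult.commute)
  finally have "cmod (pair_l2 a b) \<le> norm a * norm b'"
    using Cauchy_Schwarz_ineq2[of a b'] by simp
  also have "norm b' = norm b"
    unfolding b'(1) norm_abs_l2[OF b'(2)] norm_l2_rep[of b] L2_norm_def by (simp add: norm_mult c(1))
  finally show ?thesis .
qed

lemma bounded_linear_pair: "bounded_linear (\<lambda>a. pair_l2 a b)"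
proof (rule bounded_linear_intro)
  fix a a' :: l2 and r :: real
  obtain f where f: "f \<in> L2 lebesgue" "a = abs_l2 f" by (metis abs_rep_l2 rep_l2_L2)
  obtain f' where f': "f' \<in> L2 lebesgue" "a' = abs_l2 f'" by (metis abs_rep_l2 rep_l2_L2)
  obtain g where g: "g \<in> L2 lebesgue" "b = abs_l2 g" by (metis abs_rep_l2 rep_l2_L2)
  show "pair_l2 (a + a') b = pair_l2 a b + pair_l2 a' b"
    using f f' g by (simp add: plus_l2.abs_eq pair_l2.abs_eq L2_add distrib_right
        Bochner_Integration.integral_add L2_mult_integrable)
  show "pair_l2 (r *\<^sub>R a) b = r *\<^sub>R pair_l2 a b"
    using f g by (simp add: scaleR_l2_def cscale.abs_eq pair_l2.abs_eq L2_cmult mult.assoc scaleR_conv_of_real)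
  show "cmod (pair_l2 a b) \<le> norm a * norm b" by (rule cmod_pair_l2)
qed

text \<open>Restriction to (0,L). The equation \<open>proj L a = a\<close> replaces a subspace type
  for L^2(0,L); being an equation of bounded operators, it survives limits and integrals.\<close>

definition proj :: "real \<Rightarrow> l2 \<Rightarrow> l2" where "proj L a = emb L (rep_l2 a)"

lemma proj_emb: "f \<in> L2 (ivl L) \<Longrightarrow> proj L (emb L f) = emb L f"
  unfolding proj_def by (intro emb_cong_AE rep_emb) simp_all

lemma bounded_linear_proj: "bounded_linear (proj L)"
  and norm_proj_le: "norm (proj L a) \<le> norm a"
proof -
  have n: "norm (proj L a) \<le> norm a" for a
  proof -
    have "(norm (proj L a))\<^sup>2 \<le> (norm a)\<^sup>2"
      unfolding proj_def norm_emb_square[OF rep_l2_ivl] norm_l2_square[of a] integral_ivl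
      using L2_square_integrable[OF rep_l2_ivl[of a L]] L2_square_integrable[OF rep_l2_L2[of a]]
      by (intro integral_mono) (auto simp: integrable_restrict_space indicator_def)
    then show ?thesis by (rule power2_le_imp_le) simp
  qed
  show "norm (proj L a) \<le> norm a" by (rule n)
  show "bounded_linear (proj L)"
  proof (rule bounded_linear_intro)
    fix a b :: l2 and r :: real
    have ae: "AE x in lebesgue. rep_l2 (a + b) x = rep_l2 a x + rep_l2 b x"
      using rep_abs_l2[OF L2_add[OF rep_l2_L2[of a] rep_l2_L2[of b]]] plus_l2.abs_eq[of "rep_l2 a" "rep_l2 b"]
      by simp
    have "proj L (a + b) = emb L (\<lambda>x. rep_l2 a x + rep_l2 b x)"
      unfolding proj_def AE_ivl
      by (intro emb_cong_AE L2_add rep_l2_ivl, unfold AE_ivl) (use ae in \<open>auto elim: eventually_mono\<close>)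
    then show "proj L (a + b) = proj L a + proj L b"
      by (simp add: emb_add proj_def)
    have ae: "AE x in lebesgue. rep_l2 (r *\<^sub>R a) x = complex_of_real r * rep_l2 a x"
      using rep_abs_l2[OF L2_cmult[OF rep_l2_L2[of a], of r]] cscale.abs_eq[of "rep_l2 a" r]
      by (simp add: scaleR_l2_def)
    have "proj L (r *\<^sub>R a) = emb L (\<lambda>x. complex_of_real r * rep_l2 a x)"
      unfolding proj_def
      by (intro emb_cong_AE L2_cmult rep_l2_ivl, unfold AE_ivl) (use ae in \<open>auto elim: eventually_mono\<close>)
    then show "proj L (r *\<^sub>R a) = r *\<^sub>R proj L a"
      by (simp add: emb_scaleR proj_def)
    show "norm (proj L a) \<le> norm a * 1" using n by simp
  qed
qed

lemmas proj_add = linear_add[OF bounded_linear.linear[OF bounded_linear_proj]]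
lemmas proj_diff = linear_diff[OF bounded_linear.linear[OF bounded_linear_proj]]
lemmas proj_scaleR = linear_scale[OF bounded_linear.linear[OF bounded_linear_proj]]

lemma proj_proj [simp]: "proj L (proj L a) = proj L a"
  unfolding proj_def[of L a] by (rule proj_emb) simp

section \<open>Fubini with a bounded kernel\<close>

text \<open>The product is dominated by C |f(s)| |g(t)|, so square integrability plays no part and
  discontinuous kernels, such as indicators of a half plane, are covered.\<close>

lemma Fubini_kernel:
  fixes f g :: "'a \<Rightarrow> complex" and K :: "'a \<Rightarrow> 'a \<Rightarrow> complex"
  assumes "sigma_finite_measure M" and f: "integrable M f" and g: "integrable M g"
    and K: "(\<lambda>(s, t). K s t) \<in> borel_measurable (M \<Otimes>\<^sub>M M)"
    and C: "\<And>s t. s \<in> space M \<Longrightarrow> t \<in> space M \<Longrightarrow> cmod (K s t) \<le> C"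
  shows "integrable M (\<lambda>s. f s * (\<integral>t. K s t * g t \<partial>M))"
    and "(\<integral>s. f s * (\<integral>t. K s t * g t \<partial>M) \<partial>M) = (\<integral>t. (\<integral>s. f s * K s t \<partial>M) * g t \<partial>M)"
proof -
  interpret sigma_finite_measure M by fact
  interpret pair_sigma_finite M M ..
  define h where "h = (\<lambda>(s, t). f s * K s t * g t)"
  have [measurable]: "f \<in> borel_measurable M" "g \<in> borel_measurable M"
    using f g by auto
  note K[measurable]
  have hm: "h \<in> borel_measurable (M \<Otimes>\<^sub>M M)" unfolding h_def by measurable
  have h2: "integrable M (\<lambda>t. h (s, t))" if "s \<in> space M" for s
  proof (rule Bochner_Integration.integrable_bound)
    show "integrable M (\<lambda>t. cmod (f s) * C * cmod (g t))" using g by auto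
    show "(\<lambda>t. h (s, t)) \<in> borel_measurable M" using that unfolding h_def by measurable
    show "AE t in M. norm (h (s, t)) \<le> norm (cmod (f s) * C * cmod (g t))"
      using that C by (intro AE_I2) (auto simp: h_def norm_mult intro!: mult_right_mono mult_left_mono intro: order_trans[OF _ abs_ge_self])
  qed
  have int: "integrable (M \<Otimes>\<^sub>M M) h"
  proof (rule Fubini_integrable[OF hm])
    show "AE s in M. integrable M (\<lambda>t. h (s, t))" using h2 by (intro AE_I2)
    show "integrable M (\<lambda>s. \<integral>t. norm (h (s, t)) \<partial>M)"
    proof (rule Bochner_Integration.integrable_bound)
      show "integrable M (\<lambda>s. cmod (f s) * (C * (\<integral>t. cmod (g t) \<partial>M)))" using f by auto
      show "(\<lambda>s. \<integral>t. norm (h (s, t)) \<partial>M) \<in> borel_measurable M" using hm by measurable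
      show "AE s in M. norm (\<integral>t. norm (h (s, t)) \<partial>M) \<le> norm (cmod (f s) * (C * (\<integral>t. cmod (g t) \<partial>M)))"
      proof (rule AE_I2)
        fix s assume s: "s \<in> space M"
        have "(\<integral>t. norm (h (s, t)) \<partial>M) \<le> (\<integral>t. cmod (f s) * C * cmod (g t) \<partial>M)"
        proof (rule integral_mono)
          show "integrable M (\<lambda>t. norm (h (s, t)))" by (rule integrable_norm[OF h2[OF s]])
          show "integrable M (\<lambda>t. cmod (f s) * C * cmod (g t))" using g by auto
        qed (use C s in \<open>auto simp: h_def norm_mult intro!: mult_right_mono mult_left_mono\<close>)
        then show "norm (\<integral>t. norm (h (s, t)) \<partial>M) \<le> norm (cmod (f s) * (C * (\<integral>t. cmod (g t) \<partial>M)))"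
          by (simp add: mult.assoc)
      qed
    qed
  qed
  have a: "(\<integral>t. h (s, t) \<partial>M) = f s * (\<integral>t. K s t * g t \<partial>M)" for s
    by (simp add: h_def mult.assoc)
  have b: "(\<integral>s. h (s, t) \<partial>M) = (\<integral>s. f s * K s t \<partial>M) * g t" for t
    by (simp add: h_def)
  show "integrable M (\<lambda>s. f s * (\<integral>t. K s t * g t \<partial>M))"
    using integrable_fst'[OF int] by (simp add: a)
  show "(\<integral>s. f s * (\<integral>t. K s t * g t \<partial>M) \<partial>M) = (\<integral>t. (\<integral>s. f s * K s t \<partial>M) * g t \<partial>M)"
    using Fubini_integral[of "\<lambda>s t. h (s, t)"] int by (simp add: a b)
qed

text \<open>The closed interval [0,x] may contain 0 and L, where f is arbitrary because it is only
  known to be measurable on the open interval. Two points form a null set, and changing a Lebesgue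
  measurable function there keeps it measurable.\<close>

lemma integral_Icc_ivl:
  fixes f :: "real \<Rightarrow> complex"
  assumes f: "f \<in> borel_measurable (ivl L)" and x: "x \<in> {0..L}"
  shows "(\<integral>y. f y \<partial>lebesgue_on {0..x}) = (\<integral>y. indicator {..x} y * f y \<partial>ivl L)"
proof -
  define h where "h y = indicator {0<..<L} y *\<^sub>R (indicator {..x} y * f y)" for y
  have f': "(\<lambda>y. indicator {0<..<L} y *\<^sub>R f y) \<in> borel_measurable lebesgue"
    using f by (simp add: borel_measurable_restrict_space_iff)
  have hm: "h \<in> borel_measurable lebesgue"
  proof -
    have "h = (\<lambda>y. indicat_real {..x} y *\<^sub>R (indicat_real {0<..<L} y *\<^sub>R f y))"
      by (auto simp: h_def indicator_def)
    also have "\<dots> \<in> borel_measurable lebesgue"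
      by (rule borel_measurable_scaleR[OF borel_measurable_indicator f']) auto
    finally show ?thesis .
  qed
  \<comment> \<open>The case distinction isolates the two points, so that measurability follows from
    that of h.\<close>
  have e: "indicator {0..x} y *\<^sub>R f y = (if y \<in> {0, L} then (if y = 0 then f 0 else indicator {0..x} L *\<^sub>R f L) else h y)" for y
    using x by (auto simp: h_def indicator_def)
  have "(\<integral>y. f y \<partial>lebesgue_on {0..x}) = (\<integral>y. indicator {0..x} y *\<^sub>R f y \<partial>lebesgue)"
    by (rule integral_restrict_space) auto
  also have "\<dots> = (\<integral>y. h y \<partial>lebesgue)"
  proof (rule integral_cong_AE)
    show "(\<lambda>y. indicator {0..x} y *\<^sub>R f y) \<in> borel_measurable lebesgue"
    proof -
      have "(\<lambda>y. if y \<in> {0, L} then (if y = 0 then f 0 else indicator {0..x} L *\<^sub>R f L) else h y)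
          \<in> borel_measurable lebesgue"
        using hm by (intro measurable_If measurable_const) auto
      then show ?thesis by (subst (asm) e[symmetric])
    qed
    show "AE y in lebesgue. indicator {0..x} y *\<^sub>R f y = h y"
      using AE_completion[OF AE_lborel_singleton[of 0]] AE_completion[OF AE_lborel_singleton[of L]]
      by eventually_elim (subst e, simp)
  qed fact
  finally show ?thesis by (simp add: integral_ivl h_def)
qed


section \<open>Absolutely continuous functions\<close>

text \<open>One link of the chain in \<open>sobolev_rep\<close>: F is a continuous representative on
  all of [0,L], so its end values are traces, while f matters only up to null sets.\<close>

definition ac :: "real \<Rightarrow> (real \<Rightarrow> complex) \<Rightarrow> (real \<Rightarrow> complex) \<Rightarrow> bool" where
  "ac L F f \<longleftrightarrow> f \<in> L2 (ivl L) \<and> (\<forall>x\<in>{0..L}. F x = F 0 + (\<integral>y. f y \<partial>lebesgue_on {0..x}))"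

lemma ac_L2: "ac L F f \<Longrightarrow> f \<in> L2 (ivl L)"
  by (simp add: ac_def)

lemma ac_eq:
  assumes "ac L F f" "x \<in> {0..L}"
  shows "F x = F 0 + (\<integral>y. indicator {..x} y * f y \<partial>ivl L)"
proof -
  have "F x = F 0 + (\<integral>y. f y \<partial>lebesgue_on {0..x})" using assms unfolding ac_def by blast
  then show ?thesis by (simp only: integral_Icc_ivl[OF L2_measurable[OF ac_L2[OF assms(1)]] assms(2)])
qed

lemma acI:
  assumes "f \<in> L2 (ivl L)" "\<And>x. x \<in> {0..L} \<Longrightarrow> F x = F 0 + (\<integral>y. indicator {..x} y * f y \<partial>ivl L)"
  shows "ac L F f"
  unfolding ac_def
proof (intro conjI ballI)
  fix x assume x: "x \<in> {0..L}"
  show "F x = F 0 + (\<integral>y. f y \<partial>lebesgue_on {0..x})"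
    unfolding integral_Icc_ivl[OF L2_measurable[OF assms(1)] x] by (rule assms(2)[OF x])
qed fact

lemma ac_endpoint:
  assumes "ac L F f" "L > 0"
  shows "(\<integral>y. f y \<partial>ivl L) = F L - F 0"
proof -
  have "(\<integral>y. indicator {..L} y * f y \<partial>ivl L) = (\<integral>y. f y \<partial>ivl L)"
    by (intro Bochner_Integration.integral_cong) auto
  then show ?thesis using ac_eq[OF assms(1), of L] assms(2) by simp
qed

lemma integrable_ivl_indicator:
  fixes f :: "real \<Rightarrow> complex"
  assumes "integrable (ivl L) f" "A \<in> sets borel"
  shows "integrable (ivl L) (\<lambda>y. indicator A y * f y)"
proof (rule Bochner_Integration.integrable_bound[OF assms(1)])
  have "indicator A \<in> borel_measurable (ivl L)"
    by (intro measurable_restrict_space1 borel_measurable_indicator) (use assms in auto)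
  then show "(\<lambda>y. indicator A y * f y) \<in> borel_measurable (ivl L)"
    using assms by (intro borel_measurable_times) auto
qed (auto simp: indicator_def)

lemma ac_continuous:
  assumes "ac L F f" shows "continuous_on {0..L} F"
proof -
  define g where "g y = indicator {0<..<L} y *\<^sub>R f y" for y
  have g: "set_integrable lebesgue {0..x} g" for x
    unfolding set_integrable_def
  proof (rule integrable_mult_indicator)
    show "integrable lebesgue g"
      using L2_ivl_integrable[OF ac_L2[OF assms]] by (simp add: integrable_restrict_space g_def[abs_def])
  qed simp
  have "continuous_on {0..L} (\<lambda>x. F 0 + integral {0..x} g)"
    using g[of L] by (intro continuous_intros indefinite_integral_continuous_1 set_lebesgue_integral_eq_integral(1))
  moreover have "F x = F 0 + integral {0..x} g" if x: "x \<in> {0..L}" for x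
  proof -
    have "(\<integral>y. indicator {..x} y * f y \<partial>ivl L) = set_lebesgue_integral lebesgue {0..x} g"
      unfolding integral_ivl set_lebesgue_integral_def
      by (intro Bochner_Integration.integral_cong) (auto simp: g_def indicator_def)
    then show ?thesis
      using ac_eq[OF assms x] set_lebesgue_integral_eq_integral(2)[OF g] by simp
  qed
  ultimately show ?thesis by (rule continuous_on_eq[OF _ sym])
qed

lemma ac_const: "ac L (\<lambda>x. c) (\<lambda>x. 0)"
  by (rule acI) auto

lemma ac_ident:
  assumes "L > 0" shows "ac L complex_of_real (\<lambda>x. 1)"
proof (rule acI)
  show "(\<lambda>x. 1) \<in> L2 (ivl L)" by (rule L2_ivl_bounded[where C = 1]) auto
  fix x assume x: "x \<in> {0..L}"
  have "(\<integral>y. indicator {..x} y * 1 \<partial>ivl L) = (\<integral>y. 1 \<partial>lebesgue_on {0..x} :: complex)"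
    by (subst integral_Icc_ivl[OF _ x]) auto
  also have "\<dots> = complex_of_real x" using x by (simp add: measure_restrict_space scaleR_conv_of_real)
  finally show "complex_of_real x = complex_of_real 0 + (\<integral>y. indicator {..x} y * 1 \<partial>ivl L)" by simp
qed

lemma ac_add:
  assumes "ac L F f" "ac L G g" shows "ac L (\<lambda>x. F x + G x) (\<lambda>x. f x + g x)"
proof (rule acI)
  fix x assume x: "x \<in> {0..L}"
  have i: "integrable (ivl L) (\<lambda>y. indicator {..x} y * f y)" if "ac L F f" for F f
    using that by (intro integrable_ivl_indicator L2_ivl_integrable ac_L2) auto
  show "F x + G x = F 0 + G 0 + (\<integral>y. indicator {..x} y * (f y + g y) \<partial>ivl L)"
    using ac_eq[OF assms(1) x] ac_eq[OF assms(2) x] i[OF assms(1)] i[OF assms(2)]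
    by (simp add: distrib_left Bochner_Integration.integral_add)
qed (use assms in \<open>simp add: L2_add ac_L2\<close>)

lemma ac_cmult:
  assumes "ac L F f" shows "ac L (\<lambda>x. c * F x) (\<lambda>x. c * f x)"
proof (rule acI)
  fix x assume x: "x \<in> {0..L}"
  have "(\<integral>y. indicator {..x} y * (c * f y) \<partial>ivl L) = c * (\<integral>y. indicator {..x} y * f y \<partial>ivl L)"
    by (simp add: mult.left_commute flip: integral_mult_right_zero)
  then show "c * F x = c * F 0 + (\<integral>y. indicator {..x} y * (c * f y) \<partial>ivl L)"
    using ac_eq[OF assms(1) x] by (simp add: distrib_left)
qed (use assms in \<open>simp add: L2_cmult ac_L2\<close>)

lemma ac_diff:
  assumes "ac L F f" "ac L G g" shows "ac L (\<lambda>x. F x - G x) (\<lambda>x. f x - g x)"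
  using ac_add[OF assms(1) ac_cmult[OF assms(2), of "-1"]] by simp

lemma ac_cnj:
  assumes "ac L F f" shows "ac L (\<lambda>x. cnj (F x)) (\<lambda>x. cnj (f x))"
proof (rule acI)
  fix x assume x: "x \<in> {0..L}"
  have "(\<integral>y. indicator {..x} y * cnj (f y) \<partial>ivl L) = cnj (\<integral>y. indicator {..x} y * f y \<partial>ivl L)"
    by (subst Bochner_Integration.integral_cnj[symmetric])
       (auto simp: indicator_def intro!: Bochner_Integration.integral_cong)
  then show "cnj (F x) = cnj (F 0) + (\<integral>y. indicator {..x} y * cnj (f y) \<partial>ivl L)"
    using ac_eq[OF assms(1) x] by simp
qed (use assms in \<open>simp add: L2_cnj ac_L2\<close>)

text \<open>Integrate f(s) g(t) over the square [0,x] x [0,x] and split along the diagonal: the two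
  triangles give, by Fubini, the two products with the non-constant parts of G and F. Pointwise
  differentiation is avoided since f and g are only square integrable.\<close>

lemma ac_mult:
  assumes F: "ac L F f" and G: "ac L G g"
  shows "ac L (\<lambda>x. F x * G x) (\<lambda>x. f x * G x + F x * g x)"
proof (rule acI)
  show "(\<lambda>x. f x * G x + F x * g x) \<in> L2 (ivl L)"
    by (intro L2_add L2_mult_continuous ac_L2[OF F] ac_L2[OF G] ac_continuous[OF F] ac_continuous[OF G])
  fix x assume x: "x \<in> {0..L}"
  define M where "M = ivl L"
  define f' where "f' y = indicator {..x} y * f y" for y
  define g' where "g' y = indicator {..x} y * g y" for y
  define K where "K s t = (if t \<le> s then 1 else 0 :: complex)" for s t :: real
  have f': "integrable M f'" and g': "integrable M g'"
    unfolding f'_def g'_def M_def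
    by (intro integrable_ivl_indicator L2_ivl_integrable ac_L2[OF F] ac_L2[OF G]; simp)+
  have Km: "(\<lambda>(s, t). K s t) \<in> borel_measurable (M \<Otimes>\<^sub>M M)" and Km': "(\<lambda>(s, t). K t s) \<in> borel_measurable (M \<Otimes>\<^sub>M M)"
  proof -
    have [measurable]: "(\<lambda>x. x) \<in> borel_measurable M"
      unfolding M_def by (intro measurable_restrict_space1 measurable_completion) simp
    show "(\<lambda>(s, t). K s t) \<in> borel_measurable (M \<Otimes>\<^sub>M M)" "(\<lambda>(s, t). K t s) \<in> borel_measurable (M \<Otimes>\<^sub>M M)"
      unfolding K_def by measurable
  qed
  have Kb: "cmod (K s t) \<le> 1" for s t by (simp add: K_def)
  note fub = Fubini_kernel[OF sigma_finite_ivl[of L, folded M_def], where C = 1]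
  have Feq: "f y * G y + F y * g y = f y * (G 0 + (\<integral>t. K y t * g' t \<partial>M)) + g y * (F 0 + (\<integral>t. K y t * f' t \<partial>M))"
    if "y \<in> {0<..<L}" "y \<le> x" for y
  proof -
    have "(\<integral>t. K y t * g' t \<partial>M) = (\<integral>t. indicator {..y} t * g t \<partial>M)" "(\<integral>t. K y t * f' t \<partial>M) = (\<integral>t. indicator {..y} t * f t \<partial>M)"
      using that by (auto simp: K_def g'_def f'_def indicator_def intro!: Bochner_Integration.integral_cong)
    then show ?thesis using ac_eq[OF F, of y] ac_eq[OF G, of y] that by (simp add: M_def)
  qed
  have Kf: "integrable M (\<lambda>s. f' s * (\<integral>t. K s t * g' t \<partial>M))"
    and Kg: "integrable M (\<lambda>s. g' s * (\<integral>t. K s t * f' t \<partial>M))"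
    by (intro fub(1) f' g' Km Kb)+
  have Kg2: "(\<integral>s. g' s * (\<integral>t. K s t * f' t \<partial>M) \<partial>M) = (\<integral>s. f' s * (\<integral>t. K t s * g' t \<partial>M) \<partial>M)"
    by (subst fub(2)[OF g' f' Km Kb]) (simp_all add: mult.commute)
  have Kf3: "integrable M (\<lambda>s. f' s * (\<integral>t. K t s * g' t \<partial>M))"
    by (intro fub(1) f' g' Km' Kb)
  \<comment> \<open>The two triangles overlap only on the diagonal, which meets each section in one
    point.\<close>
  have KK: "(\<integral>t. K s t * g' t \<partial>M) + (\<integral>t. K t s * g' t \<partial>M) = (\<integral>t. g' t \<partial>M)" for s
  proof -
    have i: "integrable M (\<lambda>t. K s t * g' t)" "integrable M (\<lambda>t. K t s * g' t)"
    proof -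
      have k: "(\<lambda>t. K s t) = indicator {..s}" "(\<lambda>t. K t s) = indicator {s..}"
        by (auto simp: K_def indicator_def)
      show "integrable M (\<lambda>t. K s t * g' t)" "integrable M (\<lambda>t. K t s * g' t)"
        unfolding fun_cong[OF k(1)] fun_cong[OF k(2)] M_def
        by (rule integrable_ivl_indicator[OF g'[unfolded M_def]]; simp)+
    qed
    have "(\<integral>t. K s t * g' t \<partial>M) + (\<integral>t. K t s * g' t \<partial>M) = (\<integral>t. K s t * g' t + K t s * g' t \<partial>M)"
      using i by (simp add: Bochner_Integration.integral_add)
    also have "\<dots> = (\<integral>t. g' t \<partial>M)"
    proof (rule integral_cong_AE)
      show "AE t in M. K s t * g' t + K t s * g' t = g' t"
        unfolding M_def AE_ivl using AE_completion[OF AE_lborel_singleton[of s]]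
        by eventually_elim (auto simp: K_def)
    qed (use i g' in auto)
    finally show ?thesis .
  qed
  have "(\<integral>y. indicator {..x} y * (f y * G y + F y * g y) \<partial>M) =
      (\<integral>y. (G 0 * f' y + F 0 * g' y) + (f' y * (\<integral>t. K y t * g' t \<partial>M) + g' y * (\<integral>t. K y t * f' t \<partial>M)) \<partial>M)"
  proof (intro Bochner_Integration.integral_cong refl)
    fix y assume "y \<in> space M"
    then have y: "y \<in> {0<..<L}" by (simp add: M_def)
    show "indicator {..x} y * (f y * G y + F y * g y) =
        (G 0 * f' y + F 0 * g' y) + (f' y * (\<integral>t. K y t * g' t \<partial>M) + g' y * (\<integral>t. K y t * f' t \<partial>M))"
    proof (cases "y \<le> x")
      case True
      then have "indicator {..x} y = (1::complex)" "f' y = f y" "g' y = g y" by (simp_all add: f'_def g'_def)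
      then show ?thesis unfolding Feq[OF y True] by (simp only:) (simp add: algebra_simps)
    qed (simp add: f'_def g'_def)
  qed
  also have "\<dots> = (G 0 * (\<integral>y. f' y \<partial>M) + F 0 * (\<integral>y. g' y \<partial>M)) +
      ((\<integral>s. f' s * (\<integral>t. K s t * g' t \<partial>M) \<partial>M) + (\<integral>s. g' s * (\<integral>t. K s t * f' t \<partial>M) \<partial>M))"
    using f' g' Kf Kg by simp
  also have "(\<integral>s. f' s * (\<integral>t. K s t * g' t \<partial>M) \<partial>M) + (\<integral>s. g' s * (\<integral>t. K s t * f' t \<partial>M) \<partial>M)
      = (\<integral>s. f' s * ((\<integral>t. K s t * g' t \<partial>M) + (\<integral>t. K t s * g' t \<partial>M)) \<partial>M)"
    unfolding Kg2 distrib_left using Kf Kf3 by (simp add: Bochner_Integration.integral_add)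
  also have "\<dots> = (\<integral>y. f' y \<partial>M) * (\<integral>y. g' y \<partial>M)" unfolding KK by simp
  finally show "F x * G x = F 0 * G 0 + (\<integral>y. indicator {..x} y * (f y * G y + F y * g y) \<partial>ivl L)"
    using ac_eq[OF F x] ac_eq[OF G x] by (simp add: M_def f'_def g'_def algebra_simps)
qed

lemma ac_derivative_eq: "ac L F f \<Longrightarrow> f = g \<Longrightarrow> ac L F g"
  by simp

lemma sobolev_rep_ac: "sobolev_rep L m D \<phi> \<Longrightarrow> j < m \<Longrightarrow> ac L (D j) (D (Suc j))"
  unfolding sobolev_rep_def ac_def by (metis Suc_leI)

section \<open>Energy identities\<close>

text \<open>
  The arguments \<open>x\<close>, \<open>y\<close>, \<open>v\<close>, \<open>c\<close> stand for $\varphi$, $A\varphi$, $\varphi'$ and $\varphi'(0)$.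
\<close>

definition A_rel ::
    "real \<Rightarrow> real \<Rightarrow> real \<Rightarrow> real \<Rightarrow> l2 \<Rightarrow> l2 \<Rightarrow> l2 \<Rightarrow> complex \<Rightarrow> bool" where
  "A_rel L \<alpha> \<beta> \<delta> x y v c \<longleftrightarrow>
     (\<exists>D. ac L (D 0) (D 1) \<and> ac L (D 1) (D 2) \<and> ac L (D 2) (D (3::nat)) \<and>
          D 0 0 = 0 \<and> D 0 L = 0 \<and> D 1 L = 0 \<and>
          x = emb L (D 0) \<and> v = emb L (D 1) \<and> c = D 1 0 \<and>
          y = emb L (\<lambda>s. - complex_of_real \<beta> * D 3 s + \<i> * \<alpha> * D 2 s - \<delta> * D 1 s))"

section \<open>Multiplication by a continuous function\<close>

definition mop :: "real \<Rightarrow> (real \<Rightarrow> complex) \<Rightarrow> l2 \<Rightarrow> l2" where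
  "mop L m a = emb L (\<lambda>s. m s * rep_l2 a s)"

lemma mop_emb:
  assumes "f \<in> L2 (ivl L)" "continuous_on {0..L} m"
  shows "mop L m (emb L f) = emb L (\<lambda>s. m s * f s)"
  unfolding mop_def using rep_emb[OF assms(1)]
  by (intro emb_cong_AE L2_mult_continuous assms rep_l2_ivl) (auto elim: eventually_mono)

lemma norm_mop_le:
  assumes m: "continuous_on {0..L} m" and C: "\<And>s. s \<in> {0<..<L} \<Longrightarrow> cmod (m s) \<le> C"
  shows "norm (mop L m a) \<le> \<bar>C\<bar> * norm a"
proof -
  have L: "(\<lambda>s. m s * rep_l2 a s) \<in> L2 (ivl L)"
    by (intro L2_mult_continuous m rep_l2_ivl)
  have "(norm (mop L m a))\<^sup>2 = (\<integral>s. (cmod (m s * rep_l2 a s))\<^sup>2 \<partial>ivl L)"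
    unfolding mop_def by (rule norm_emb_square[OF L])
  also have "\<dots> \<le> (\<integral>s. C\<^sup>2 * (cmod (rep_l2 a s))\<^sup>2 \<partial>ivl L)"
  proof (rule integral_mono)
    fix s assume "s \<in> space (ivl L)"
    then have "cmod (m s * rep_l2 a s) \<le> C * cmod (rep_l2 a s)"
      using C by (auto simp: norm_mult intro: mult_right_mono)
    then have "(cmod (m s * rep_l2 a s))\<^sup>2 \<le> (C * cmod (rep_l2 a s))\<^sup>2" by (intro power_mono) auto
    then show "(cmod (m s * rep_l2 a s))\<^sup>2 \<le> C\<^sup>2 * (cmod (rep_l2 a s))\<^sup>2" by (simp add: power_mult_distrib)
  qed (use L2_square_integrable[OF L] L2_square_integrable[OF rep_l2_ivl] in auto)
  also have "\<dots> = C\<^sup>2 * (norm (proj L a))\<^sup>2"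
    unfolding proj_def by (simp add: norm_emb_square)
  also have "\<dots> \<le> C\<^sup>2 * (norm a)\<^sup>2" by (intro mult_left_mono power_mono norm_proj_le) auto
  finally have "(norm (mop L m a))\<^sup>2 \<le> (\<bar>C\<bar> * norm a)\<^sup>2" by (simp add: power_mult_distrib)
  then show ?thesis by (rule power2_le_imp_le) simp
qed

lemma emb_surj_proj: "\<exists>f. f \<in> L2 (ivl L) \<and> proj L a = emb L f"
  by (rule exI[of _ "rep_l2 a"]) (simp add: proj_def)

lemma mop_proj: "continuous_on {0..L} m \<Longrightarrow> mop L m (proj L a) = mop L m a"
  unfolding proj_def by (subst mop_emb) (auto simp: mop_def)

lemma bounded_linear_mop:
  assumes m: "continuous_on {0..L} m"
  shows "bounded_linear (mop L m)"
proof -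
  obtain C where C: "\<forall>x\<in>{0..L}. norm (m x) \<le> C"
    using continuous_Icc_bounded[OF m] by blast
  show ?thesis
  proof (rule bounded_linear_intro)
    fix a b :: l2 and r :: real
    obtain f where f: "f \<in> L2 (ivl L)" "proj L a = emb L f" using emb_surj_proj by blast
    obtain g where g: "g \<in> L2 (ivl L)" "proj L b = emb L g" using emb_surj_proj by blast
    have "mop L m (proj L (a + b)) = mop L m (proj L a) + mop L m (proj L b)"
      using f g m by (simp add: proj_add proj_scaleR mop_emb distrib_left L2_mult_continuous L2_add flip: emb_add)
    then show "mop L m (a + b) = mop L m a + mop L m b" by (simp add: mop_proj m)
    have "mop L m (proj L (r *\<^sub>R a)) = r *\<^sub>R mop L m (proj L a)"
      using f m by (simp add: proj_add proj_scaleR mop_emb mult.left_commute L2_mult_continuous L2_cmult flip: emb_scaleR)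
    then show "mop L m (r *\<^sub>R a) = r *\<^sub>R mop L m a" by (simp add: mop_proj m)
    show "norm (mop L m a) \<le> norm a * \<bar>C\<bar>"
      using norm_mop_le[OF m, of C a] C by (simp add: mult.commute)
  qed
qed

locale kdv_interval =
  fixes L \<alpha> \<beta> \<delta> :: real
  assumes L: "L > 0" and \<beta>: "\<beta> > 0"
begin

abbreviation "Arel \<equiv> A_rel L \<alpha> \<beta> \<delta>"
abbreviation "Xop \<equiv> mop L complex_of_real"

text \<open>The multiplier x leaves a cross term in \<alpha> and a transport term in \<delta>.
  Young's inequality turns the first into \<alpha>^2/\<beta> times |x|^2, the second is at most
  \<bar>\<delta>\<bar> times |x|^2, and both are divided by the remaining 2 \<beta>.\<close>

definition "smooth_K = (\<alpha>\<^sup>2 / \<beta> + \<bar>\<delta>\<bar>) / (2 * \<beta>)"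

lemma smooth_K_nonneg: "smooth_K \<ge> 0"
  using \<beta> by (simp add: smooth_K_def)

text \<open>Both claims come from one flux Q with derivative twice the real part of the product of
  \<phi> with the conjugate of A\<phi>. Its boundary values give the first; integrating the
  derivative against the weight s turns the flux itself into a volume term, which gives the
  second.\<close>

lemma A_rel_energy:
  assumes "Arel x y v c"
  shows "2 * inner x y = - \<beta> * (cmod c)\<^sup>2"
    and "(norm v)\<^sup>2 \<le> - inner (Xop x) y / \<beta> + smooth_K * (norm x)\<^sup>2"
proof -
  from assms obtain D :: "nat \<Rightarrow> real \<Rightarrow> complex" where a0: "ac L (D 0) (D 1)" and a1: "ac L (D 1) (D 2)" and a2: "ac L (D 2) (D (3::nat))"
    and bc: "D 0 0 = 0" "D 0 L = 0" "D 1 L = 0"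
    and x: "x = emb L (D 0)" and v: "v = emb L (D 1)" and c: "c = D 1 0"
    and y: "y = emb L (\<lambda>s. - complex_of_real \<beta> * D 3 s + \<i> * \<alpha> * D 2 s - \<delta> * D 1 s)"
    unfolding A_rel_def by (elim exE conjE) (rule that, assumption+)
  define \<psi> where "\<psi> s = - complex_of_real \<beta> * D 3 s + \<i> * \<alpha> * D 2 s - \<delta> * D 1 s" for s
  have L20: "D 0 \<in> L2 (ivl L)" and L21: "D 1 \<in> L2 (ivl L)"
    by (intro continuous_L2_ivl ac_continuous[OF a0], rule ac_L2[OF a0])
  have \<psi>L: "\<psi> \<in> L2 (ivl L)"
    unfolding \<psi>_def[abs_def] by (intro L2_add L2_diff L2_cmult ac_L2[OF a0] ac_L2[OF a1] ac_L2[OF a2])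
  note f1 = ac_mult[OF ac_cnj[OF a0] a2]
  note f2 = ac_mult[OF a0 ac_cnj[OF a2]]
  note f3 = ac_mult[OF a1 ac_cnj[OF a1]]
  note f4 = ac_mult[OF ac_cnj[OF a0] a1]
  note f5 = ac_mult[OF a0 ac_cnj[OF a1]]
  note f6 = ac_mult[OF a0 ac_cnj[OF a0]]
  \<comment> \<open>Obtained by integrating each term of A by parts: the third-order term leaves the
    two mixed products and the square of \<phi>', the second-order term a current, and the
    first-order term the density.\<close>
  define Q where "Q s = (- complex_of_real \<beta>) * (cnj (D 0 s) * D 2 s + D 0 s * cnj (D 2 s) - D 1 s * cnj (D 1 s))
     + (\<i> * \<alpha>) * (cnj (D 0 s) * D 1 s - D 0 s * cnj (D 1 s)) - \<delta> * (D 0 s * cnj (D 0 s))" for s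
  define e where "e s = cnj (D 0 s * cnj (\<psi> s)) + D 0 s * cnj (\<psi> s)" for s
  have Q: "ac L Q e"
    unfolding Q_def[abs_def]
    by (rule ac_derivative_eq[OF ac_diff[OF ac_add[OF ac_cmult[OF ac_diff[OF ac_add[OF f1 f2] f3]] ac_cmult[OF ac_diff[OF f4 f5]]] ac_cmult[OF f6]]])
       (auto simp: e_def \<psi>_def algebra_simps)
  have int: "integrable (ivl L) (\<lambda>s. D 0 s * cnj (\<psi> s))"
    by (intro L2_mult_integrable L20 L2_cnj \<psi>L)
  have Re2: "2 * inner x y = Re (\<integral>s. e s \<partial>ivl L)"
  proof -
    have "(\<integral>s. e s \<partial>ivl L) = cnj (\<integral>s. D 0 s * cnj (\<psi> s) \<partial>ivl L) + (\<integral>s. D 0 s * cnj (\<psi> s) \<partial>ivl L)"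
      unfolding e_def using int
      by (subst Bochner_Integration.integral_add) (auto simp del: complex_cnj_mult intro!: Bochner_Integration.integrable_cnj)
    then show ?thesis unfolding x y \<psi>_def[symmetric] using inner_emb[OF L20 \<psi>L] by simp
  qed
  have "2 * inner x y = Re (Q L - Q 0)"
    unfolding Re2 ac_endpoint[OF Q L] ..
  also have "\<dots> = - \<beta> * (cmod c)\<^sup>2"
    using bc by (simp add: Q_def c complex_mult_cnj cmod_power2 algebra_simps)
  finally show "2 * inner x y = - \<beta> * (cmod c)\<^sup>2" .
  have cx: "continuous_on {0..L} complex_of_real" by (intro continuous_intros)
  have X: "ac L (\<lambda>s. complex_of_real s * Q s) (\<lambda>s. 1 * Q s + complex_of_real s * e s)"
    by (rule ac_mult[OF ac_ident[OF L] Q])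
  have Xx: "Xop x = emb L (\<lambda>s. complex_of_real s * D 0 s)"
    unfolding x by (rule mop_emb[OF L20 cx])
  have XL: "(\<lambda>s. complex_of_real s * D 0 s) \<in> L2 (ivl L)" by (intro L2_mult_continuous L20 cx)
  have inte: "integrable (ivl L) (\<lambda>s. complex_of_real s * e s)"
    by (intro L2_ivl_integrable L2_mult_continuous ac_L2[OF Q] cx)
  have intQ: "integrable (ivl L) Q"
    by (intro L2_ivl_integrable continuous_L2_ivl ac_continuous[OF Q])
  \<comment> \<open>No boundary term remains: the weight vanishes at 0, and Q vanishes at L because
    \<phi> and \<phi>' do.\<close>
  have 1: "(\<integral>s. complex_of_real s * e s \<partial>ivl L) = - (\<integral>s. Q s \<partial>ivl L)"
  proof -
    have "(\<integral>s. 1 * Q s + complex_of_real s * e s \<partial>ivl L) = L * Q L - 0 * Q 0"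
      using ac_endpoint[OF X L] by simp
    moreover have "Q L = 0" using bc by (simp add: Q_def)
    ultimately show ?thesis using inte intQ by (simp add: Bochner_Integration.integral_add add_eq_0_iff)
  qed
  have 2: "2 * inner (Xop x) y = Re (\<integral>s. complex_of_real s * e s \<partial>ivl L)"
  proof -
    have i2: "integrable (ivl L) (\<lambda>s. (complex_of_real s * D 0 s) * cnj (\<psi> s))"
      by (intro L2_mult_integrable XL L2_cnj \<psi>L)
    have "(\<integral>s. complex_of_real s * e s \<partial>ivl L) =
       (\<integral>s. cnj ((complex_of_real s * D 0 s) * cnj (\<psi> s)) + (complex_of_real s * D 0 s) * cnj (\<psi> s) \<partial>ivl L)"
      by (simp add: e_def algebra_simps)
    also have "\<dots> = cnj (\<integral>s. (complex_of_real s * D 0 s) * cnj (\<psi> s) \<partial>ivl L) + (\<integral>s. (complex_of_real s * D 0 s) * cnj (\<psi> s) \<partial>ivl L)"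
      using i2
      by (subst Bochner_Integration.integral_add) (auto simp del: complex_cnj_mult intro!: Bochner_Integration.integrable_cnj)
    finally show ?thesis unfolding Xx y \<psi>_def[symmetric] using inner_emb[OF XL \<psi>L] by simp
  qed
  have R: "ac L (\<lambda>s. cnj (D 0 s) * D 1 s + D 0 s * cnj (D 1 s))
      (\<lambda>s. (cnj (D 0 s) * D 2 s + D 0 s * cnj (D 2 s)) + 2 * (D 1 s * cnj (D 1 s)))"
    by (rule ac_derivative_eq[OF ac_add[OF f4 f5]]) (auto simp: algebra_simps)
  have i11: "integrable (ivl L) (\<lambda>s. D 1 s * cnj (D 1 s))" by (intro L2_mult_integrable L21 L2_cnj)
  have i00: "integrable (ivl L) (\<lambda>s. D 0 s * cnj (D 0 s))" by (intro L2_mult_integrable L20 L2_cnj)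
  have i01: "integrable (ivl L) (\<lambda>s. D 0 s * cnj (D 1 s))" by (intro L2_mult_integrable L20 L21 L2_cnj)
  have i10: "integrable (ivl L) (\<lambda>s. cnj (D 0 s) * D 1 s)" by (intro L2_mult_integrable L20 L21 L2_cnj)
  have i02: "integrable (ivl L) (\<lambda>s. cnj (D 0 s) * D 2 s + D 0 s * cnj (D 2 s))"
    by (intro Bochner_Integration.integrable_add L2_mult_integrable L20 L2_cnj ac_L2[OF a1])
  have 3: "(\<integral>s. cnj (D 0 s) * D 2 s + D 0 s * cnj (D 2 s) \<partial>ivl L) = - 2 * (\<integral>s. D 1 s * cnj (D 1 s) \<partial>ivl L)"
    using ac_endpoint[OF R L] bc i02 i11 by (simp add: Bochner_Integration.integral_add add_eq_0_iff)
  have n: "(\<integral>s. f s * cnj (f s) \<partial>ivl L) = complex_of_real ((norm (emb L f))\<^sup>2)" if "f \<in> L2 (ivl L)" for f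
    unfolding norm_emb_square[OF that]
    by (simp only: complex_norm_square[symmetric] integral_complex_of_real)
  define I where "I = (\<integral>s. D 0 s * cnj (D 1 s) \<partial>ivl L)"
  have cI: "(\<integral>s. cnj (D 0 s) * D 1 s \<partial>ivl L) = cnj I"
    unfolding I_def by (simp flip: Bochner_Integration.integral_cnj)
  have "(\<integral>s. Q s \<partial>ivl L) = (- complex_of_real \<beta>) * ((\<integral>s. cnj (D 0 s) * D 2 s + D 0 s * cnj (D 2 s) \<partial>ivl L) - (\<integral>s. D 1 s * cnj (D 1 s) \<partial>ivl L))
     + (\<i> * \<alpha>) * ((\<integral>s. cnj (D 0 s) * D 1 s \<partial>ivl L) - I) - \<delta> * (\<integral>s. D 0 s * cnj (D 0 s) \<partial>ivl L)"
    unfolding Q_def I_def using i02 i11 i00 i01 i10 by simp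
  also have "\<dots> = 3 * \<beta> * complex_of_real ((norm v)\<^sup>2) + (\<i> * \<alpha>) * (cnj I - I) - \<delta> * complex_of_real ((norm x)\<^sup>2)"
    unfolding 3 cI n[OF L20] n[OF L21] x[symmetric] v[symmetric] by (simp add: algebra_simps)
  finally have "Re (\<integral>s. Q s \<partial>ivl L) = 3 * \<beta> * (norm v)\<^sup>2 + 2 * \<alpha> * Im I - \<delta> * (norm x)\<^sup>2"
    by simp
  then have 4: "2 * inner (Xop x) y = - 3 * \<beta> * (norm v)\<^sup>2 - 2 * \<alpha> * Im I + \<delta> * (norm x)\<^sup>2"
    unfolding 2 1 by simp
  have "cmod I \<le> norm x * norm v"
  proof -
    have "I = pair_l2 x (cnj_l2 v)" unfolding I_def x v by (simp add: cnj_emb L20 L21 L2_cnj pair_emb del: One_nat_def)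
    moreover have "norm (cnj_l2 v) = norm v"
      unfolding v by (simp add: cnj_emb L21 L2_cnj norm_emb L2_norm_def del: One_nat_def)
    ultimately show ?thesis using cmod_pair_l2[of x "cnj_l2 v"] by simp
  qed
  then have "\<bar>\<alpha>\<bar> * \<bar>Im I\<bar> \<le> \<bar>\<alpha>\<bar> * (norm x * norm v)"
    by (intro mult_left_mono order_trans[OF abs_Im_le_cmod]) auto
  then have "- 2 * \<alpha> * Im I \<le> 2 * (\<bar>\<alpha>\<bar> * (norm x * norm v))"
    using abs_ge_minus_self[of "\<alpha> * Im I", unfolded abs_mult] by linarith
  \<comment> \<open>Young's inequality spends one of the three copies of \<beta> |v|^2 on the cross
    term and leaves two.\<close>
  also have "\<dots> \<le> \<beta> * (norm v)\<^sup>2 + \<alpha>\<^sup>2 / \<beta> * (norm x)\<^sup>2"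
  proof -
    have "0 \<le> (\<beta> * norm v - \<bar>\<alpha>\<bar> * norm x)\<^sup>2 / \<beta>" using \<beta> by simp
    also have "\<dots> = \<beta> * (norm v)\<^sup>2 + \<alpha>\<^sup>2 / \<beta> * (norm x)\<^sup>2 - 2 * (\<bar>\<alpha>\<bar> * (norm x * norm v))"
      using \<beta> by (simp add: field_simps power2_eq_square)
    finally show ?thesis by simp
  qed
  finally have 5: "- 2 * \<alpha> * Im I \<le> \<beta> * (norm v)\<^sup>2 + \<alpha>\<^sup>2 / \<beta> * (norm x)\<^sup>2" .
  have 6: "\<delta> * (norm x)\<^sup>2 \<le> \<bar>\<delta>\<bar> * (norm x)\<^sup>2" by (intro mult_right_mono) auto
  have "2 * \<beta> * (norm v)\<^sup>2 \<le> - 2 * inner (Xop x) y + (\<alpha>\<^sup>2 / \<beta> + \<bar>\<delta>\<bar>) * (norm x)\<^sup>2"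
    using 4 5 6 by (simp add: distrib_right)
  have divide_eq: "(- 2 * a + K * n) / (2 * \<beta>) = - a / \<beta> + K / (2 * \<beta>) * n" for a K n
    using \<beta> by (simp add: field_simps)
  from \<open>2 * \<beta> * (norm v)\<^sup>2 \<le> _\<close> have "(norm v)\<^sup>2 \<le> (- 2 * inner (Xop x) y + (\<alpha>\<^sup>2 / \<beta> + \<bar>\<delta>\<bar>) * (norm x)\<^sup>2) / (2 * \<beta>)"
    using \<beta> by (simp add: pos_le_divide_eq mult.commute)
  then show "(norm v)\<^sup>2 \<le> - inner (Xop x) y / \<beta> + smooth_K * (norm x)\<^sup>2"
    unfolding smooth_K_def divide_eq .
qed

text \<open>
  The polynomial $p(s)=s-s^2/L$ vanishes at both ends and $p'(0)=1$, so $\int A\varphi\,p$ leaves $\varphi'(0)$ as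
  its only boundary term.
\<close>

definition "trace_p s = complex_of_real s - (1 / L) * (complex_of_real s * complex_of_real s)"
definition "trace_q s = \<delta> * (1 - (2 / L) * complex_of_real s) - \<i> * \<alpha> * (2 / L)"

lemma trace_p_L2: "trace_p \<in> L2 (ivl L)" and trace_q_L2: "trace_q \<in> L2 (ivl L)"
  unfolding trace_p_def[abs_def] trace_q_def[abs_def]
  by (intro continuous_L2_ivl continuous_intros)+

lemma A_rel_trace:
  assumes "Arel x y v c"
  shows "c = (pair_l2 x (emb L trace_q) - pair_l2 y (emb L trace_p)) / \<beta>"
proof -
  from assms obtain D :: "nat \<Rightarrow> real \<Rightarrow> complex" where a0: "ac L (D 0) (D 1)" and a1: "ac L (D 1) (D 2)" and a2: "ac L (D 2) (D (3::nat))"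
    and bc: "D 0 0 = 0" "D 0 L = 0" "D 1 L = 0"
    and x: "x = emb L (D 0)" and c: "c = D 1 0"
    and y: "y = emb L (\<lambda>s. - complex_of_real \<beta> * D 3 s + \<i> * \<alpha> * D 2 s - \<delta> * D 1 s)"
    unfolding A_rel_def by (elim exE conjE) (rule that, assumption+)
  define \<psi> where "\<psi> s = - complex_of_real \<beta> * D 3 s + \<i> * \<alpha> * D 2 s - \<delta> * D 1 s" for s
  have L20: "D 0 \<in> L2 (ivl L)"
    by (intro continuous_L2_ivl ac_continuous[OF a0])
  have \<psi>L: "\<psi> \<in> L2 (ivl L)"
    unfolding \<psi>_def[abs_def] by (intro L2_add L2_diff L2_cmult ac_L2[OF a0] ac_L2[OF a1] ac_L2[OF a2])
  define p1 where "p1 s = 1 - (2 / L) * complex_of_real s" for s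
  define p2 where "p2 = - (2 / complex_of_real L)"
  note id = ac_ident[OF L]
  have p0: "ac L trace_p p1"
    unfolding trace_p_def[abs_def]
    by (rule ac_derivative_eq[OF ac_diff[OF id ac_cmult[OF ac_mult[OF id id]]]])
       (simp add: p1_def fun_eq_iff)
  have p1: "ac L p1 (\<lambda>s. p2)"
    unfolding p1_def[abs_def]
    by (rule ac_derivative_eq[OF ac_diff[OF ac_const ac_cmult[OF id]]]) (simp add: p2_def fun_eq_iff)
  \<comment> \<open>The boundary form of A and p. As the third derivative of p vanishes, the
    transposed operator applied to p is i\<alpha> p'' + \<delta> p', which is
    \<open>trace_q\<close>.\<close>
  define F where "F s = (- complex_of_real \<beta>) * (D 2 s * trace_p s - D 1 s * p1 s + p2 * D 0 s)
      + (\<i> * \<alpha>) * (D 1 s * trace_p s - D 0 s * p1 s) - \<delta> * (D 0 s * trace_p s)" for s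
  have F: "ac L F (\<lambda>s. \<psi> s * trace_p s - D 0 s * trace_q s)"
    unfolding F_def[abs_def]
    by (rule ac_derivative_eq[OF ac_diff[OF ac_add[OF
          ac_cmult[OF ac_add[OF ac_diff[OF ac_mult[OF a2 p0] ac_mult[OF a1 p1]] ac_cmult[OF a0]]]
          ac_cmult[OF ac_diff[OF ac_mult[OF a1 p0] ac_mult[OF a0 p1]]]]
          ac_cmult[OF ac_mult[OF a0 p0]]]])
       (simp add: fun_eq_iff \<psi>_def trace_q_def p1_def p2_def algebra_simps)
  have "trace_p L = 0" using L by (simp add: trace_p_def)
  then have "(\<integral>s. \<psi> s * trace_p s - D 0 s * trace_q s \<partial>ivl L) = - \<beta> * c"
    unfolding ac_endpoint[OF F L] using bc by (simp add: F_def c p1_def trace_p_def)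
  moreover have "(\<integral>s. \<psi> s * trace_p s - D 0 s * trace_q s \<partial>ivl L)
      = pair_l2 y (emb L trace_p) - pair_l2 x (emb L trace_q)"
    unfolding x y \<psi>_def[symmetric]
    by (simp add: pair_emb \<psi>L L20 trace_p_L2 trace_q_L2 L2_mult_integrable Bochner_Integration.integral_diff)
  ultimately have "\<beta> * c = pair_l2 x (emb L trace_q) - pair_l2 y (emb L trace_p)"
    by (simp add: algebra_simps)
  then show ?thesis using \<beta> by (simp add: nonzero_eq_divide_eq mult.commute)
qed

lemma A_rel_proj:
  assumes "Arel x y v c"
  shows "proj L x = x" "proj L y = y" "proj L v = v"
proof -
  from assms obtain D :: "nat \<Rightarrow> real \<Rightarrow> complex" where a0: "ac L (D 0) (D 1)" and a1: "ac L (D 1) (D 2)" and a2: "ac L (D 2) (D (3::nat))"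
    and x: "x = emb L (D 0)" and v: "v = emb L (D 1)"
    and y: "y = emb L (\<lambda>s. - complex_of_real \<beta> * D 3 s + \<i> * \<alpha> * D 2 s - \<delta> * D 1 s)"
    unfolding A_rel_def by (elim exE conjE) (rule that, assumption+)
  show "proj L x = x" "proj L y = y" "proj L v = v"
    unfolding x y v
    by (intro proj_emb L2_add L2_diff L2_cmult continuous_L2_ivl ac_continuous[OF a0] ac_L2[OF a0] ac_L2[OF a1] ac_L2[OF a2])+
qed

text \<open>The energy estimates are quadratic; applied to differences they yield continuity in time
  and convergence of approximations.\<close>

lemma A_rel_diff:
  assumes "Arel x y v c" "Arel x' y' v' c'"
  shows "Arel (x - x') (y - y') (v - v') (c - c')"
proof -
  from assms(1) obtain D :: "nat \<Rightarrow> real \<Rightarrow> complex" where a0: "ac L (D 0) (D 1)" and a1: "ac L (D 1) (D 2)" and a2: "ac L (D 2) (D (3::nat))"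
    and bc: "D 0 0 = 0" "D 0 L = 0" "D 1 L = 0"
    and x: "x = emb L (D 0)" and v: "v = emb L (D 1)" and c: "c = D 1 0"
    and y: "y = emb L (\<lambda>s. - complex_of_real \<beta> * D 3 s + \<i> * \<alpha> * D 2 s - \<delta> * D 1 s)"
    unfolding A_rel_def by (elim exE conjE) (rule that, assumption+)
  from assms(2) obtain D' :: "nat \<Rightarrow> real \<Rightarrow> complex" where a0': "ac L (D' 0) (D' 1)" and a1': "ac L (D' 1) (D' 2)" and a2': "ac L (D' 2) (D' (3::nat))"
    and bc': "D' 0 0 = 0" "D' 0 L = 0" "D' 1 L = 0"
    and x': "x' = emb L (D' 0)" and v': "v' = emb L (D' 1)" and c': "c' = D' 1 0"
    and y': "y' = emb L (\<lambda>s. - complex_of_real \<beta> * D' 3 s + \<i> * \<alpha> * D' 2 s - \<delta> * D' 1 s)"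
    unfolding A_rel_def by (elim exE conjE) (rule that, assumption+)
  note l = continuous_L2_ivl[OF ac_continuous[OF a0]] ac_L2[OF a0] ac_L2[OF a1] ac_L2[OF a2]
  note l' = continuous_L2_ivl[OF ac_continuous[OF a0']] ac_L2[OF a0'] ac_L2[OF a1'] ac_L2[OF a2']
  show ?thesis
    unfolding A_rel_def
  proof (intro exI[of _ "\<lambda>j s. D j s - D' j s"] conjI ac_diff a0 a1 a2 a0' a1' a2')
    show "x - x' = emb L (\<lambda>s. D 0 s - D' 0 s)" "v - v' = emb L (\<lambda>s. D 1 s - D' 1 s)"
      unfolding x x' v v' by (simp_all add: emb_diff l l' del: One_nat_def)
    have "y - y' = emb L (\<lambda>s. (- complex_of_real \<beta> * D 3 s + \<i> * \<alpha> * D 2 s - \<delta> * D 1 s)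
        - (- complex_of_real \<beta> * D' 3 s + \<i> * \<alpha> * D' 2 s - \<delta> * D' 1 s))"
      unfolding y y' by (intro emb_diff[symmetric] L2_add L2_diff L2_cmult l l')
    then show "y - y' = emb L (\<lambda>s. - complex_of_real \<beta> * (D 3 s - D' 3 s) + \<i> * \<alpha> * (D 2 s - D' 2 s) - \<delta> * (D 1 s - D' 1 s))"
      by (simp add: algebra_simps)
  qed (use bc bc' c c' in auto)
qed

lemma A_graph_A_rel:
  assumes "A_graph L \<alpha> \<beta> \<delta> \<phi> \<psi>" "\<phi> \<in> L2 (ivl L)" "\<psi> \<in> L2 (ivl L)"
  shows "\<exists>v c. Arel (emb L \<phi>) (emb L \<psi>) v c"
proof -
  from assms(1) obtain D :: "nat \<Rightarrow> real \<Rightarrow> complex" where D: "sobolev_rep L 3 D \<phi>" and bc: "D 0 0 = 0" "D 0 L = 0" "D 1 L = 0"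
    and ae: "AE x in ivl L. \<psi> x = - complex_of_real \<beta> * D 3 x + \<i> * \<alpha> * D 2 x - \<delta> * D 1 x"
    unfolding A_graph_def by (elim exE conjE) (rule that, assumption+)
  have a: "ac L (D 0) (D 1)" "ac L (D 1) (D 2)" "ac L (D 2) (D 3)"
    using sobolev_rep_ac[OF D, of 0] sobolev_rep_ac[OF D, of 1] sobolev_rep_ac[OF D, of 2]
    by (simp_all add: numeral_2_eq_2 numeral_3_eq_3)
  note l = continuous_L2_ivl[OF ac_continuous[OF a(1)]] a[THEN ac_L2]
  have "emb L \<phi> = emb L (D 0)"
    using D by (intro emb_cong_AE assms l) (simp add: sobolev_rep_def)
  moreover have "emb L \<psi> = emb L (\<lambda>s. - complex_of_real \<beta> * D 3 s + \<i> * \<alpha> * D 2 s - \<delta> * D 1 s)"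
    by (intro emb_cong_AE assms L2_add L2_diff L2_cmult l ae)
  ultimately have "Arel (emb L \<phi>) (emb L \<psi>) (emb L (D 1)) (D 1 0)"
    unfolding A_rel_def by (intro exI[of _ D] conjI a bc refl)
  then show ?thesis by blast
qed

text \<open>The two conditions \<phi>(0) = 0 and \<phi>(L) = 0 are expressed through v alone by
  bounded operators. In this form they persist when only the derivatives converge in L^2.\<close>

lemma A_rel_first_derivative:
  assumes "Arel x y v c"
  shows "x = emb L (\<lambda>s. \<integral>t. indicator {..s} t * rep_l2 v t \<partial>ivl L)"
    and "pair_l2 v (emb L (\<lambda>x. 1)) = 0"
proof -
  from assms obtain D :: "nat \<Rightarrow> real \<Rightarrow> complex" where a0: "ac L (D 0) (D 1)" and bc: "D 0 0 = 0" "D 0 L = 0"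
    and x: "x = emb L (D 0)" and v: "v = emb L (D 1)"
    unfolding A_rel_def by (elim exE conjE) (rule that, assumption+)
  have m: "indicator {..s} \<in> borel_measurable (ivl L)" for s :: real
    by (intro measurable_restrict_space1 borel_measurable_indicator) auto
  have e: "D 0 s = (\<integral>t. indicator {..s} t * rep_l2 v t \<partial>ivl L)" if "s \<in> {0<..<L}" for s
  proof -
    have "D 0 s = (\<integral>t. indicator {..s} t * D 1 t \<partial>ivl L)"
      using ac_eq[OF a0, of s] bc that by simp
    also have "\<dots> = (\<integral>t. indicator {..s} t * rep_l2 v t \<partial>ivl L)"
      unfolding v using rep_emb[OF ac_L2[OF a0]] L2_measurable[OF ac_L2[OF a0]] L2_measurable[OF rep_l2_ivl] m
      by (intro integral_cong_AE borel_measurable_times) (auto elim: eventually_mono)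
    finally show ?thesis .
  qed
  then show "x = emb L (\<lambda>s. \<integral>t. indicator {..s} t * rep_l2 v t \<partial>ivl L)"
    unfolding x by (intro emb_cong)
  show "pair_l2 v (emb L (\<lambda>x. 1)) = 0"
    unfolding v using ac_endpoint[OF a0 L] bc
    by (subst pair_emb) (auto simp del: One_nat_def intro: ac_L2[OF a0] L2_ivl_bounded[of _ L 1])
qed

end

section \<open>Integral operators\<close>

text \<open>A pointwise bound in place of square integrability: every section is then square
  integrable, with no exceptional null set of s.\<close>

definition kernel_on :: "real \<Rightarrow> real \<Rightarrow> (real \<Rightarrow> real \<Rightarrow> complex) \<Rightarrow> bool" where
  "kernel_on L C \<kappa> \<longleftrightarrow> (\<lambda>(s, t). \<kappa> s t) \<in> borel_measurable (ivl L \<Otimes>\<^sub>M ivl L) \<and>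
     (\<forall>s\<in>{0<..<L}. \<forall>t\<in>{0<..<L}. cmod (\<kappa> s t) \<le> C)"

definition kop :: "real \<Rightarrow> (real \<Rightarrow> real \<Rightarrow> complex) \<Rightarrow> l2 \<Rightarrow> l2" where
  "kop L \<kappa> a = emb L (\<lambda>s. \<integral>t. \<kappa> s t * rep_l2 a t \<partial>ivl L)"

definition hs_norm_sq :: "real \<Rightarrow> (real \<Rightarrow> real \<Rightarrow> complex) \<Rightarrow> real" where
  "hs_norm_sq L \<kappa> = (\<integral>s. (\<integral>t. (cmod (\<kappa> s t))\<^sup>2 \<partial>ivl L) \<partial>ivl L)"

context
  fixes L C :: real and \<kappa> :: "real \<Rightarrow> real \<Rightarrow> complex"
  assumes K: "kernel_on L C \<kappa>"
begin

lemma kernel_measurable: "(\<lambda>(s, t). \<kappa> s t) \<in> borel_measurable (ivl L \<Otimes>\<^sub>M ivl L)"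
  and kernel_bound: "s \<in> {0<..<L} \<Longrightarrow> t \<in> {0<..<L} \<Longrightarrow> cmod (\<kappa> s t) \<le> C"
  using K by (auto simp: kernel_on_def)

lemma kernel_section_measurable: "s \<in> {0<..<L} \<Longrightarrow> \<kappa> s \<in> borel_measurable (ivl L)"
  using measurable_compose_Pair1[OF _ kernel_measurable, of s] by simp

lemma kernel_section_L2: "s \<in> {0<..<L} \<Longrightarrow> \<kappa> s \<in> L2 (ivl L)"
  by (rule L2_ivl_bounded[OF kernel_section_measurable kernel_bound])

lemma kernel_integral_L2:
  assumes f: "f \<in> L2 (ivl L)"
  shows "(\<lambda>s. \<integral>t. \<kappa> s t * f t \<partial>ivl L) \<in> L2 (ivl L)"
proof (rule L2_ivl_bounded)
  have m: "(\<lambda>p. case_prod \<kappa> p * f (snd p)) \<in> borel_measurable (ivl L \<Otimes>\<^sub>M ivl L)"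
    using kernel_measurable L2_measurable[OF f]
    by (intro borel_measurable_times measurable_compose[OF measurable_snd])
  have eq: "case_prod (\<lambda>s t. \<kappa> s t * f t) = (\<lambda>p. case_prod \<kappa> p * f (snd p))" by auto
  show "(\<lambda>s. \<integral>t. \<kappa> s t * f t \<partial>ivl L) \<in> borel_measurable (ivl L)"
    by (rule sigma_finite_measure.borel_measurable_lebesgue_integral[OF sigma_finite_ivl])
       (unfold eq, rule m)
  fix s assume s: "s \<in> {0<..<L}"
  have "cmod (\<integral>t. \<kappa> s t * f t \<partial>ivl L) \<le> (\<integral>t. cmod (\<kappa> s t * f t) \<partial>ivl L)"
    by (rule integral_norm_bound)
  also have "\<dots> \<le> (\<integral>t. C * cmod (f t) \<partial>ivl L)"
  proof (rule integral_mono)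
    show "integrable (ivl L) (\<lambda>t. cmod (\<kappa> s t * f t))"
      by (intro integrable_norm L2_mult_integrable kernel_section_L2 s f)
    show "integrable (ivl L) (\<lambda>t. C * cmod (f t))"
      using integrable_norm[OF L2_ivl_integrable[OF f]] by (rule integrable_mult_right)
  qed (use kernel_bound[OF s] in \<open>auto simp: norm_mult intro!: mult_right_mono\<close>)
  finally show "cmod (\<integral>t. \<kappa> s t * f t \<partial>ivl L) \<le> (\<integral>t. C * cmod (f t) \<partial>ivl L)" .
qed

lemma kernel_integral_cong:
  assumes "f \<in> L2 (ivl L)" "g \<in> L2 (ivl L)" "AE x in ivl L. f x = g x" "s \<in> {0<..<L}"
  shows "(\<integral>t. \<kappa> s t * f t \<partial>ivl L) = (\<integral>t. \<kappa> s t * g t \<partial>ivl L)"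
  using assms kernel_section_measurable[OF assms(4)]
  by (intro integral_cong_AE borel_measurable_times) (auto dest: L2_measurable elim: eventually_mono)

lemma kop_emb:
  assumes f: "f \<in> L2 (ivl L)"
  shows "kop L \<kappa> (emb L f) = emb L (\<lambda>s. \<integral>t. \<kappa> s t * f t \<partial>ivl L)"
  unfolding kop_def by (intro emb_cong kernel_integral_cong rep_emb f rep_l2_ivl)

lemma kop_proj: "kop L \<kappa> (proj L a) = kop L \<kappa> a"
  unfolding proj_def by (subst kop_emb) (auto simp: kop_def)

lemma proj_kop: "proj L (kop L \<kappa> a) = kop L \<kappa> a"
  unfolding kop_def by (intro proj_emb kernel_integral_L2 rep_l2_ivl)

lemma kernel_square_integral_measurable:
  "(\<lambda>s. \<integral>t. (cmod (\<kappa> s t))\<^sup>2 \<partial>ivl L) \<in> borel_measurable (ivl L)"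
proof (rule sigma_finite_measure.borel_measurable_lebesgue_integral[OF sigma_finite_ivl])
  have "case_prod (\<lambda>s t. (cmod (\<kappa> s t))\<^sup>2) = (\<lambda>p. (cmod (case_prod \<kappa> p))\<^sup>2)" by auto
  also have "\<dots> \<in> borel_measurable (ivl L \<Otimes>\<^sub>M ivl L)" using kernel_measurable by measurable
  finally show "case_prod (\<lambda>s t. (cmod (\<kappa> s t))\<^sup>2) \<in> borel_measurable (ivl L \<Otimes>\<^sub>M ivl L)" .
qed

lemma kernel_square_integrable:
  "integrable (ivl L) (\<lambda>s. \<integral>t. (cmod (\<kappa> s t))\<^sup>2 \<partial>ivl L)"
proof (rule integrable_ivl_bounded[OF kernel_square_integral_measurable])
  fix s assume s: "s \<in> {0<..<L}"
  have "(\<integral>t. (cmod (\<kappa> s t))\<^sup>2 \<partial>ivl L) \<le> (\<integral>t. C\<^sup>2 \<partial>ivl L)"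
    using L2_square_integrable[OF kernel_section_L2[OF s]] kernel_bound[OF s]
    by (intro integral_mono) (auto intro: power_mono integrable_ivl_bounded[where C = "C\<^sup>2"])
  then show "norm (\<integral>t. (cmod (\<kappa> s t))\<^sup>2 \<partial>ivl L) \<le> (\<integral>t. C\<^sup>2 \<partial>ivl L)" by simp
qed

text \<open>Cauchy-Schwarz in each section, then integration over s. This Hilbert-Schmidt bound is
  the origin of the L^2 norm of k in the decay constant.\<close>

lemma norm_kop_le: "norm (kop L \<kappa> a) \<le> sqrt (hs_norm_sq L \<kappa>) * norm a"
proof -
  define f where "f = rep_l2 a"
  have f: "f \<in> L2 (ivl L)" by (simp add: f_def)
  have pt: "(cmod (\<integral>t. \<kappa> s t * f t \<partial>ivl L))\<^sup>2 \<le> (\<integral>t. (cmod (\<kappa> s t))\<^sup>2 \<partial>ivl L) * (norm (proj L a))\<^sup>2"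
    if s: "s \<in> {0<..<L}" for s
  proof -
    have "(\<integral>t. \<kappa> s t * f t \<partial>ivl L) = pair_l2 (emb L (\<kappa> s)) (emb L f)"
      by (simp add: pair_emb kernel_section_L2[OF s] f)
    then have "cmod (\<integral>t. \<kappa> s t * f t \<partial>ivl L) \<le> norm (emb L (\<kappa> s)) * norm (emb L f)"
      using cmod_pair_l2 by metis
    then have "(cmod (\<integral>t. \<kappa> s t * f t \<partial>ivl L))\<^sup>2 \<le> (norm (emb L (\<kappa> s)) * norm (emb L f))\<^sup>2"
      by (intro power_mono) auto
    then show ?thesis
      by (simp add: power_mult_distrib norm_emb_square[OF kernel_section_L2[OF s]] f_def proj_def)
  qed
  note gL = kernel_integral_L2[OF f]
  have "(norm (kop L \<kappa> a))\<^sup>2 = (\<integral>s. (cmod (\<integral>t. \<kappa> s t * f t \<partial>ivl L))\<^sup>2 \<partial>ivl L)"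
    unfolding kop_def f_def[symmetric] by (rule norm_emb_square[OF gL])
  also have "\<dots> \<le> (\<integral>s. (\<integral>t. (cmod (\<kappa> s t))\<^sup>2 \<partial>ivl L) * (norm (proj L a))\<^sup>2 \<partial>ivl L)"
    using pt L2_square_integrable[OF gL] kernel_square_integrable by (intro integral_mono) auto
  also have "\<dots> = hs_norm_sq L \<kappa> * (norm (proj L a))\<^sup>2"
    by (simp add: hs_norm_sq_def)
  also have "\<dots> \<le> hs_norm_sq L \<kappa> * (norm a)\<^sup>2"
    by (intro mult_left_mono power_mono norm_proj_le) (auto simp: hs_norm_sq_def intro!: Bochner_Integration.integral_nonneg)
  finally have "(norm (kop L \<kappa> a))\<^sup>2 \<le> hs_norm_sq L \<kappa> * (norm a)\<^sup>2" .
  then have "sqrt ((norm (kop L \<kappa> a))\<^sup>2) \<le> sqrt (hs_norm_sq L \<kappa> * (norm a)\<^sup>2)"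
    by (rule real_sqrt_le_mono)
  then show ?thesis by (simp add: real_sqrt_mult)
qed

lemma bounded_linear_kop: "bounded_linear (kop L \<kappa>)"
proof -
  show ?thesis
  proof (rule bounded_linear_intro)
    fix a b :: l2 and r :: real
    obtain f where f: "f \<in> L2 (ivl L)" "proj L a = emb L f" using emb_surj_proj by blast
    obtain g where g: "g \<in> L2 (ivl L)" "proj L b = emb L g" using emb_surj_proj by blast
    have "kop L \<kappa> (proj L (a + b)) = kop L \<kappa> (proj L a) + kop L \<kappa> (proj L b)"
    proof -
      have "kop L \<kappa> (proj L (a + b)) = emb L (\<lambda>s. \<integral>t. \<kappa> s t * (f t + g t) \<partial>ivl L)"
        unfolding proj_add proj_scaleR f(2) g(2) emb_add[OF f(1) g(1), symmetric] by (rule kop_emb[OF L2_add[OF f(1) g(1)]])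
      also have "\<dots> = emb L (\<lambda>s. (\<integral>t. \<kappa> s t * f t \<partial>ivl L) + (\<integral>t. \<kappa> s t * g t \<partial>ivl L))"
        by (intro emb_cong)
           (simp add: distrib_left Bochner_Integration.integral_add L2_mult_integrable kernel_section_L2 f(1) g(1))
      also have "\<dots> = kop L \<kappa> (proj L a) + kop L \<kappa> (proj L b)"
        by (simp add: emb_add kernel_integral_L2 f g kop_emb)
      finally show ?thesis .
    qed
    then show "kop L \<kappa> (a + b) = kop L \<kappa> a + kop L \<kappa> b" by (simp add: kop_proj)
    have "kop L \<kappa> (proj L (r *\<^sub>R a)) = r *\<^sub>R kop L \<kappa> (proj L a)"
      unfolding proj_add proj_scaleR f(2) emb_scaleR[OF f(1), symmetric]
      by (simp add: kop_emb f(1) L2_cmult mult.left_commute kernel_integral_L2 flip: emb_scaleR)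
    then show "kop L \<kappa> (r *\<^sub>R a) = r *\<^sub>R kop L \<kappa> a" by (simp add: kop_proj)
    show "norm (kop L \<kappa> a) \<le> norm a * sqrt (hs_norm_sq L \<kappa>)"
      using norm_kop_le[of a] by (simp add: mult.commute)
  qed
qed

end

text \<open>The exponent carries 2 \<mu> because the weight enters the Hilbert-Schmidt norm squared.
  The bound is uniform in s and tends to 0 as \<mu> grows.\<close>

lemma exp_weight_integral:
  assumes "\<mu> > 0" "L > 0" "s \<in> {0<..<L}"
  shows "(\<integral>t. indicator {s..} t * exp (- (2 * \<mu> * (t - s))) \<partial>ivl L) \<le> 1 / (2 * \<mu>)"
proof -
  define F where "F t = - exp (- (2 * \<mu> * (t - s))) / (2 * \<mu>)" for t
  have d: "(F has_vector_derivative exp (- (2 * \<mu> * (t - s)))) (at t within {s..L})" for t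
    unfolding F_def has_real_derivative_iff_has_vector_derivative[symmetric]
    using assms by (auto intro!: derivative_eq_intros)
  have i: "set_integrable lborel {s..L} (\<lambda>t. exp (- (2 * \<mu> * (t - s))))"
    by (intro borel_integrable_atLeastAtMost' continuous_intros)
  have "(\<integral>t. indicator {s..} t * exp (- (2 * \<mu> * (t - s))) \<partial>ivl L)
      = (\<integral>t. indicator {s..L} t *\<^sub>R exp (- (2 * \<mu> * (t - s))) \<partial>lborel)"
  proof -
    have "(\<integral>t. indicator {s..} t * exp (- (2 * \<mu> * (t - s))) \<partial>ivl L)
      = (\<integral>t. indicator {s..<L} t *\<^sub>R exp (- (2 * \<mu> * (t - s))) \<partial>lebesgue)"
      unfolding integral_ivl using assms by (intro Bochner_Integration.integral_cong) (auto simp: indicator_def)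
    also have "\<dots> = (\<integral>t. indicator {s..<L} t *\<^sub>R exp (- (2 * \<mu> * (t - s))) \<partial>lborel)"
      by (rule integral_completion) measurable
    also have "\<dots> = (\<integral>t. indicator {s..L} t *\<^sub>R exp (- (2 * \<mu> * (t - s))) \<partial>lborel)"
    proof (rule integral_cong_AE)
      show "AE t in lborel. indicator {s..<L} t *\<^sub>R exp (- (2 * \<mu> * (t - s))) = indicator {s..L} t *\<^sub>R exp (- (2 * \<mu> * (t - s)))"
        using AE_lborel_singleton[of L] by eventually_elim (auto simp: indicator_def)
    qed measurable
    finally show ?thesis .
  qed
  also have "\<dots> = F L - F s"
    by (rule integral_FTC_Icc) (use assms d i in \<open>auto intro!: continuous_intros\<close>)
  also have "\<dots> \<le> 1 / (2 * \<mu>)" using assms by (simp add: F_def)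
  finally show ?thesis .
qed

text \<open>A Hilbert-Schmidt norm below 1 yields the a priori bound by absorption and the solution
  by a fixed point. B collects the norms of the two exponential weights and serves only to make the
  inverse bounded; the decay constant uses the operator norm of the inverse instead.\<close>

lemma triangular_kernel_inverse:
  assumes K: "kernel_on L C \<kappa>" and tri: "\<And>s t. t \<le> s \<Longrightarrow> \<kappa> s t = 0" and L: "L > 0"
  shows "\<exists>B. (\<forall>\<phi>. proj L \<phi> = \<phi> \<longrightarrow> norm \<phi> \<le> B * norm (\<phi> - kop L \<kappa> \<phi>)) \<and>
     (\<forall>g. proj L g = g \<longrightarrow> (\<exists>\<phi>. proj L \<phi> = \<phi> \<and> \<phi> - kop L \<kappa> \<phi> = g))"
proof -
  \<comment> \<open>Chosen so that L C^2 / (2 \<mu>), the bound on the squared Hilbert-Schmidt norm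
    below, is at most 1/2.\<close>
  define \<mu> where "\<mu> = 1 + L * C\<^sup>2"
  have \<mu>: "\<mu> > 0" using L by (simp add: \<mu>_def add_pos_nonneg)
  have C: "C \<ge> 0"
    using order_trans[OF norm_ge_zero kernel_bound[OF K, of "L / 2" "L / 2"]] L by simp
  define e where "e c s = complex_of_real (exp (c * s))" for c s
  have ec: "continuous_on A (e c)" for c A unfolding e_def by (intro continuous_intros)
  \<comment> \<open>The kernel lives on t > s, so the factor exp(\<mu> s) outside and exp(-\<mu> t)
    inside produces decay in t - s; the opposite signs would produce growth.\<close>
  define \<kappa>' where "\<kappa>' s t = e \<mu> s * \<kappa> s t * e (- \<mu>) t" for s t
  have idm: "(\<lambda>x. x) \<in> borel_measurable (ivl L)"
    by (intro measurable_restrict_space1 measurable_completion) simp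
  have em: "e c \<in> borel_measurable (ivl L)" for c
    unfolding e_def by (rule measurable_compose[OF idm]) measurable
  have bnd: "cmod (\<kappa>' s t) \<le> C * exp (- (\<mu> * (t - s)))" "t \<le> s \<Longrightarrow> \<kappa>' s t = 0" if "s \<in> {0<..<L}" "t \<in> {0<..<L}" for s t
  proof -
    have "cmod (\<kappa>' s t) = cmod (\<kappa> s t) * exp (- (\<mu> * (t - s)))"
      by (simp add: \<kappa>'_def e_def norm_mult algebra_simps flip: exp_add)
    then show "cmod (\<kappa>' s t) \<le> C * exp (- (\<mu> * (t - s)))"
      using kernel_bound[OF K that] by (simp add: mult_right_mono)
    show "t \<le> s \<Longrightarrow> \<kappa>' s t = 0" by (simp add: \<kappa>'_def tri)
  qed
  have K': "kernel_on L C \<kappa>'"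
    unfolding kernel_on_def
  proof (intro conjI ballI)
    have "(\<lambda>(s, t). \<kappa>' s t) = (\<lambda>p. e \<mu> (fst p) * case_prod \<kappa> p * e (- \<mu>) (snd p))" by (auto simp: \<kappa>'_def)
    also have "\<dots> \<in> borel_measurable (ivl L \<Otimes>\<^sub>M ivl L)"
      by (intro borel_measurable_times measurable_compose[OF measurable_fst em]
          measurable_compose[OF measurable_snd em] kernel_measurable[OF K])
    finally show "(\<lambda>(s, t). \<kappa>' s t) \<in> borel_measurable (ivl L \<Otimes>\<^sub>M ivl L)" .
    fix s t assume st: "s \<in> {0<..<L}" "t \<in> {0<..<L}"
    show "cmod (\<kappa>' s t) \<le> C"
    proof (cases "t \<le> s")
      case False
      then have "C * exp (- (\<mu> * (t - s))) \<le> C * 1" using \<mu> C by (intro mult_left_mono) auto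
      then show ?thesis using bnd(1)[OF st] by simp
    qed (use bnd(2)[OF st] C in simp)
  qed
  have hs: "hs_norm_sq L \<kappa>' \<le> 1 / 2"
  proof -
    have "(\<integral>t. (cmod (\<kappa>' s t))\<^sup>2 \<partial>ivl L) \<le> C\<^sup>2 / (2 * \<mu>)" if s: "s \<in> {0<..<L}" for s
    proof -
      have "(\<integral>t. (cmod (\<kappa>' s t))\<^sup>2 \<partial>ivl L) \<le> (\<integral>t. C\<^sup>2 * (indicator {s..} t * exp (- (2 * \<mu> * (t - s)))) \<partial>ivl L)"
      proof (rule integral_mono)
        show "integrable (ivl L) (\<lambda>t. (cmod (\<kappa>' s t))\<^sup>2)"
          by (rule L2_square_integrable[OF kernel_section_L2[OF K' s]])
        have "(\<lambda>t. C\<^sup>2 * (indicator {s..} t * exp (- (2 * \<mu> * (t - s))))) \<in> borel_measurable (ivl L)"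
          by (rule measurable_compose[OF idm]) measurable
        then show "integrable (ivl L) (\<lambda>t. C\<^sup>2 * (indicator {s..} t * exp (- (2 * \<mu> * (t - s)))))"
          by (rule integrable_ivl_bounded[where C = "C\<^sup>2"])
             (use \<mu> in \<open>auto simp: indicator_def mult_left_le\<close>)
        fix t assume "t \<in> space (ivl L)"
        then have t: "t \<in> {0<..<L}" by simp
        show "(cmod (\<kappa>' s t))\<^sup>2 \<le> C\<^sup>2 * (indicator {s..} t * exp (- (2 * \<mu> * (t - s))))"
        proof (cases "t \<le> s")
          case False
          have "(cmod (\<kappa>' s t))\<^sup>2 \<le> (C * exp (- (\<mu> * (t - s))))\<^sup>2" by (intro power_mono bnd(1) s t) auto
          also have "\<dots> = C\<^sup>2 * exp (- (2 * \<mu> * (t - s)))"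
            by (simp add: power_mult_distrib algebra_simps flip: exp_double)
          finally show ?thesis using False by simp
        qed (use bnd(2)[OF s t] in simp)
      qed
      also have "\<dots> = C\<^sup>2 * (\<integral>t. indicator {s..} t * exp (- (2 * \<mu> * (t - s))) \<partial>ivl L)" by simp
      also have "\<dots> \<le> C\<^sup>2 * (1 / (2 * \<mu>))"
        by (intro mult_left_mono exp_weight_integral \<mu> L s) auto
      finally show ?thesis by simp
    qed
    then have "hs_norm_sq L \<kappa>' \<le> (\<integral>s. C\<^sup>2 / (2 * \<mu>) \<partial>ivl L)"
      unfolding hs_norm_sq_def
      by (intro integral_mono kernel_square_integrable[OF K']) (auto intro!: integrable_ivl_bounded[where C = "C\<^sup>2 / (2 * \<mu>)"] simp: \<mu> less_imp_le)
    also have "\<dots> = L * C\<^sup>2 / (2 * \<mu>)" using L by (simp add: measure_restrict_space)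
    also have "\<dots> \<le> 1 / 2" using \<mu> L by (simp add: divide_simps \<mu>_def)
    finally show ?thesis .
  qed
  define q where "q = sqrt (hs_norm_sq L \<kappa>')"
  have q: "0 \<le> q" "q < 1"
  proof -
    show "0 \<le> q" unfolding q_def hs_norm_sq_def by (intro real_sqrt_ge_zero Bochner_Integration.integral_nonneg zero_le_power2)
    have "q \<le> sqrt (1/2)" unfolding q_def using hs by (rule real_sqrt_le_mono)
    also have "\<dots> < 1" by simp
    finally show "q < 1" .
  qed
  have contr: "norm (kop L \<kappa>' b) \<le> q * norm b" for b
    unfolding q_def by (rule norm_kop_le[OF K'])
  have conj: "mop L (e \<mu>) (kop L \<kappa> \<phi>) = kop L \<kappa>' (mop L (e \<mu>) \<phi>)" for \<phi>
  proof -
    obtain f where f: "f \<in> L2 (ivl L)" "proj L \<phi> = emb L f" using emb_surj_proj by blast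
    have eL: "(\<lambda>s. e \<mu> s * f s) \<in> L2 (ivl L)" by (intro L2_mult_continuous f ec)
    have "mop L (e \<mu>) (kop L \<kappa> (proj L \<phi>)) = emb L (\<lambda>s. e \<mu> s * (\<integral>t. \<kappa> s t * f t \<partial>ivl L))"
      unfolding f(2) kop_emb[OF K f(1)] by (rule mop_emb[OF kernel_integral_L2[OF K f(1)] ec])
    also have "\<dots> = emb L (\<lambda>s. \<integral>t. \<kappa>' s t * (e \<mu> t * f t) \<partial>ivl L)"
    proof (intro emb_cong)
      fix s assume "s \<in> {0<..<L}"
      have ee: "e (- \<mu>) t * e \<mu> t = 1" for t by (simp add: e_def exp_minus)
      have "\<kappa>' s t * (e \<mu> t * f t) = e \<mu> s * (\<kappa> s t * f t) * (e (- \<mu>) t * e \<mu> t)" for t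
        by (simp add: \<kappa>'_def mult_ac)
      then show "e \<mu> s * (\<integral>t. \<kappa> s t * f t \<partial>ivl L) = (\<integral>t. \<kappa>' s t * (e \<mu> t * f t) \<partial>ivl L)"
        by (simp only: ee mult_1_right integral_mult_right_zero)
    qed
    also have "\<dots> = kop L \<kappa>' (mop L (e \<mu>) (proj L \<phi>))"
      unfolding f(2) mop_emb[OF f(1) ec] by (rule kop_emb[OF K' eL, symmetric])
    finally show ?thesis by (simp add: kop_proj[OF K] mop_proj ec)
  qed
  have inv: "mop L (e (- c)) (mop L (e c) \<phi>) = proj L \<phi>" for c \<phi>
  proof -
    obtain f where f: "f \<in> L2 (ivl L)" "proj L \<phi> = emb L f" using emb_surj_proj by blast
    have "mop L (e (- c)) (mop L (e c) (proj L \<phi>)) = emb L (\<lambda>s. e (- c) s * (e c s * f s))"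
      unfolding f(2) by (simp add: mop_emb f(1) ec L2_mult_continuous)
    also have "\<dots> = emb L f"
      by (intro emb_cong) (simp add: e_def exp_minus)
    finally show ?thesis by (simp only: f(2)[symmetric] mop_proj[OF ec])
  qed
  have pm: "proj L (mop L (e c) \<phi>) = mop L (e c) \<phi>" for c \<phi>
    unfolding mop_def by (intro proj_emb L2_mult_continuous ec rep_l2_ivl)
  interpret kk: bounded_linear "kop L \<kappa>'" by (rule bounded_linear_kop[OF K'])
  interpret m1: bounded_linear "mop L (e \<mu>)" by (rule bounded_linear_mop[OF ec])
  interpret m2: bounded_linear "mop L (e (- \<mu>))" by (rule bounded_linear_mop[OF ec])
  obtain B1 where B1: "\<And>x. norm (mop L (e \<mu>) x) \<le> norm x * B1" "B1 > 0" using m1.pos_bounded by blast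
  obtain B2 where B2: "\<And>x. norm (mop L (e (- \<mu>)) x) \<le> norm x * B2" "B2 > 0" using m2.pos_bounded by blast
  show ?thesis
  proof (intro exI[of _ "B2 * B1 / (1 - q)"] conjI allI impI)
    fix \<phi> assume \<phi>: "proj L \<phi> = \<phi>"
    define b where "b = mop L (e \<mu>) \<phi>"
    have "norm b \<le> norm (b - kop L \<kappa>' b) + norm (kop L \<kappa>' b)" using norm_triangle_sub[of b] by (simp add: add.commute)
    also have "\<dots> \<le> norm (b - kop L \<kappa>' b) + q * norm b" using contr by simp
    finally have "(1 - q) * norm b \<le> norm (b - kop L \<kappa>' b)" by (simp add: algebra_simps)
    also have "b - kop L \<kappa>' b = mop L (e \<mu>) (\<phi> - kop L \<kappa> \<phi>)" by (simp add: b_def m1.diff conj)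
    also have "norm \<dots> \<le> norm (\<phi> - kop L \<kappa> \<phi>) * B1" by (rule B1)
    finally have nb: "norm b \<le> norm (\<phi> - kop L \<kappa> \<phi>) * B1 / (1 - q)" using q by (simp add: field_simps)
    have "norm \<phi> \<le> norm b * B2" using B2(1)[of b] inv[of \<mu> \<phi>] \<phi> by (simp add: b_def)
    also have "\<dots> \<le> norm (\<phi> - kop L \<kappa> \<phi>) * B1 / (1 - q) * B2" using nb B2(2) by (intro mult_right_mono) auto
    finally show "norm \<phi> \<le> B2 * B1 / (1 - q) * norm (\<phi> - kop L \<kappa> \<phi>)" by (simp add: mult_ac)
  next
    fix g assume g: "proj L g = g"
    \<comment> \<open>The fixed point is sought in the whole type, where completeness is at hand;
      its membership in the range of \<open>proj L\<close> is read off the equation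
      afterwards.\<close>
    have "\<exists>!b. mop L (e \<mu>) g + kop L \<kappa>' b = b"
    proof (rule banach_fix_type[OF q], intro allI)
      show "dist (mop L (e \<mu>) g + kop L \<kappa>' x) (mop L (e \<mu>) g + kop L \<kappa>' y) \<le> q * dist x y" for x y
        using contr[of "x - y"] by (simp add: dist_norm kk.diff)
    qed
    then obtain b where b: "mop L (e \<mu>) g + kop L \<kappa>' b = b" by blast
    define \<phi> where "\<phi> = mop L (e (- \<mu>)) b"
    \<comment> \<open>Both summands of the fixed-point equation are values of operators that map
      into the range of \<open>proj L\<close>.\<close>
    have pb: "proj L b = b"
      by (subst (1 2) b[symmetric]) (simp add: linear_add[OF bounded_linear.linear[OF bounded_linear_proj]] pm proj_kop[OF K'])
    have mb: "mop L (e \<mu>) \<phi> = b" using inv[of "- \<mu>" b] pb by (simp add: \<phi>_def)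
    have "mop L (e \<mu>) (\<phi> - kop L \<kappa> \<phi>) = b - kop L \<kappa>' b" by (simp add: m1.diff conj mb)
    also have "\<dots> = mop L (e \<mu>) g" using b by (simp add: algebra_simps)
    finally have "proj L (\<phi> - kop L \<kappa> \<phi>) = proj L g" using inv[of \<mu>] by metis
    moreover have "proj L (\<phi> - kop L \<kappa> \<phi>) = \<phi> - kop L \<kappa> \<phi>"
      by (simp add: proj_diff proj_kop[OF K]) (simp add: \<phi>_def pm)
    ultimately show "\<exists>\<phi>. proj L \<phi> = \<phi> \<and> \<phi> - kop L \<kappa> \<phi> = g"
      using g by (intro exI[of _ \<phi>]) (simp add: \<phi>_def pm)
  qed
qed

section \<open>Volterra operators with a smooth kernel\<close>

definition upper :: "(real \<Rightarrow> real \<Rightarrow> complex) \<Rightarrow> real \<Rightarrow> real \<Rightarrow> complex" where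
  "upper d s t = (if s < t then d s t else 0)"

definition closed_triangle :: "real \<Rightarrow> (real \<times> real) set" where
  "closed_triangle L = {(x, y). 0 \<le> x \<and> x \<le> y \<and> y \<le> L}"

text \<open>The jet of the kernel is given on the closure of the open triangle; here the closed
  triangle, which supplies compactness and the diagonal, is found inside it.\<close>

lemma triangle_subset_closure:
  assumes "L > 0" shows "closed_triangle L \<subseteq> closure (\<Delta> L)"
proof
  fix p assume "p \<in> closed_triangle L"
  then obtain x y where p: "p = (x, y)" "0 \<le> x" "x \<le> y" "y \<le> L" by (auto simp: closed_triangle_def)
  \<comment> \<open>Points on the segment from p to the centroid. The weights 1/(n+2) lie strictly
    between 0 and 1, so every point is interior.\<close>
  define f where "f n = ((1 - 1 / real (Suc (Suc n))) *\<^sub>R p + (1 / real (Suc (Suc n))) *\<^sub>R (L / 3, 2 * L / 3))" for n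
  have "f \<longlonglongrightarrow> (1 - 0) *\<^sub>R p + 0 *\<^sub>R (L / 3, 2 * L / 3)"
    unfolding f_def by (intro tendsto_intros LIMSEQ_Suc[OF LIMSEQ_Suc[OF lim_1_over_n]])
  then have lim: "f \<longlonglongrightarrow> p" by (simp flip: zero_prod_def)
  have "f n \<in> \<Delta> L" for n
  proof -
    define e where "e = 1 / real (Suc (Suc n))"
    have e: "0 < e" "e < 1" by (auto simp: e_def)
    have pos: "(1 - e) * x \<ge> 0" "(1 - e) * (y - x) \<ge> 0" "(1 - e) * (L - y) \<ge> 0" "e * (L / 3) > 0"
      using e p assms by auto
    have f: "f n = ((1 - e) * x + e * (L / 3), (1 - e) * y + e * (2 * L / 3))"
      by (simp add: f_def e_def p)
    show ?thesis unfolding f \<Delta>_def using pos by (auto simp: algebra_simps)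
  qed
  then show "p \<in> closure (\<Delta> L)" using lim by (auto simp: closure_sequential)
qed

lemma compact_triangle: "compact (closed_triangle L)"
proof -
  have "closed_triangle L = ({0..L} \<times> {0..L}) \<inter> {p. fst p \<le> snd p}"
    by (auto simp: closed_triangle_def)
  moreover have "compact \<dots>"
    by (intro compact_Int_closed compact_Times compact_Icc closed_Collect_le continuous_intros)
  ultimately show ?thesis by simp
qed

lemma continuous_triangle_sections:
  assumes d: "continuous_on (closed_triangle L) (\<lambda>(x, y). d x y)"
  shows "y \<le> L \<Longrightarrow> continuous_on {0..y} (\<lambda>x. d x y)"
    and "0 \<le> x \<Longrightarrow> continuous_on {x..L} (\<lambda>y. d x y)"
    and "continuous_on {0..L} (\<lambda>x. d x x)"
proof -
  have *: "continuous_on A (\<lambda>x. d (a x) (b x))"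
    if "continuous_on A a" "continuous_on A b" "\<And>x. x \<in> A \<Longrightarrow> (a x, b x) \<in> closed_triangle L" for A :: "real set" and a b
    using continuous_on_compose2[OF d, of A "\<lambda>x. (a x, b x)"] that by (auto intro: continuous_on_Pair)
  show "y \<le> L \<Longrightarrow> continuous_on {0..y} (\<lambda>x. d x y)" "0 \<le> x \<Longrightarrow> continuous_on {x..L} (\<lambda>y. d x y)"
      "continuous_on {0..L} (\<lambda>x. d x x)"
    by (auto intro!: * continuous_intros simp: closed_triangle_def)
qed

lemma Delta_borel: "\<Delta> L \<in> sets borel"
proof -
  have "\<Delta> L = ({0<..<L} \<times> {0<..<L}) \<inter> {p. fst p < snd p}"
    by (auto simp: \<Delta>_def)
  moreover have "open \<dots>"
    by (intro open_Int open_Times open_greaterThanLessThan open_Collect_less continuous_intros)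
  ultimately show ?thesis by simp
qed

lemma ivl_ident_measurable: "(\<lambda>x. x) \<in> borel_measurable (ivl L)"
  by (intro measurable_restrict_space1 measurable_completion) simp

lemma Delta_indicator_measurable:
  fixes f :: "real \<times> real \<Rightarrow> 'b::{real_normed_vector, second_countable_topology}"
  assumes "continuous_on (closed_triangle L) f"
  shows "(\<lambda>p. indicator (\<Delta> L) p *\<^sub>R f p) \<in> borel_measurable borel"
  by (intro borel_measurable_continuous_on_indicator Delta_borel continuous_on_subset[OF assms])
     (auto simp: closed_triangle_def \<Delta>_def)

lemma upper_kernel:
  assumes d: "continuous_on (closed_triangle L) (\<lambda>(x, y). d x y)"
  shows "\<exists>C. kernel_on L C (upper d)"
proof -
  have "bounded ((\<lambda>(x, y). d x y) ` closed_triangle L)"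
    by (intro compact_imp_bounded compact_continuous_image d compact_triangle)
  then obtain C where C: "\<forall>z\<in>(\<lambda>(x, y). d x y) ` closed_triangle L. norm z \<le> C" unfolding bounded_iff by blast
  have Cb: "cmod (d s t) \<le> C" if "0 \<le> s" "s \<le> t" "t \<le> L" for s t
  proof -
    have "(s, t) \<in> closed_triangle L" using that by (simp add: closed_triangle_def)
    then show ?thesis using C by force
  qed
  have "kernel_on L \<bar>C\<bar> (upper d)"
    unfolding kernel_on_def
  proof (intro conjI ballI)
    have id: "(\<lambda>p. (fst p, snd p)) \<in> measurable (ivl L \<Otimes>\<^sub>M ivl L) (borel \<Otimes>\<^sub>M borel)"
      by (intro measurable_Pair measurable_compose[OF measurable_fst ivl_ident_measurable]
          measurable_compose[OF measurable_snd ivl_ident_measurable])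
    have "(\<lambda>p. indicator (\<Delta> L) (fst p, snd p) *\<^sub>R (case (fst p, snd p) of (x, y) \<Rightarrow> d x y)) \<in> borel_measurable (ivl L \<Otimes>\<^sub>M ivl L)"
      by (rule measurable_compose[OF id]) (use Delta_indicator_measurable[OF d] in \<open>simp add: borel_prod\<close>)
    moreover have "indicator (\<Delta> L) (fst p, snd p) *\<^sub>R (case (fst p, snd p) of (x, y) \<Rightarrow> d x y) = (case p of (s, t) \<Rightarrow> upper d s t)"
      if "p \<in> space (ivl L \<Otimes>\<^sub>M ivl L)" for p
      using that by (cases p) (auto simp: space_pair_measure upper_def \<Delta>_def indicator_def split: if_splits)
    ultimately show "(\<lambda>(s, t). upper d s t) \<in> borel_measurable (ivl L \<Otimes>\<^sub>M ivl L)"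
      by (subst (asm) measurable_cong)
    fix s t assume "s \<in> {0<..<L}" "t \<in> {0<..<L}"
    then show "cmod (upper d s t) \<le> \<bar>C\<bar>"
      using Cb[of s t] by (auto simp: upper_def)
  qed
  then show ?thesis by blast
qed

lemma integral_upper_eq:
  fixes d :: "real \<Rightarrow> real \<Rightarrow> complex"
  assumes "x \<ge> 0"
  shows "(\<integral>y. d x y * f y \<partial>lebesgue_on {x<..<L}) = (\<integral>t. upper d x t * f t \<partial>ivl L)"
  unfolding integral_ivl
  by (subst integral_restrict_space)
     (use assms in \<open>auto intro!: Bochner_Integration.integral_cong simp: upper_def indicator_def\<close>)

text \<open>Leibniz' rule for an integral over [x,L], with the diagonal term from the moving limit.
  It is proved in integrated form by Fubini, because f is only square integrable and the rule need
  not hold at every x.\<close>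

lemma upper_ac:
  assumes L: "L > 0"
    and c0: "continuous_on (closed_triangle L) (\<lambda>(x, y). d0 x y)"
    and c1: "continuous_on (closed_triangle L) (\<lambda>(x, y). d1 x y)"
    and der: "\<And>x y. (x, y) \<in> \<Delta> L \<Longrightarrow> ((\<lambda>\<xi>. d0 \<xi> y) has_vector_derivative d1 x y) (at x)"
    and f: "f \<in> L2 (ivl L)"
  shows "ac L (\<lambda>x. \<integral>t. upper d0 x t * f t \<partial>ivl L)
     (\<lambda>x. (\<integral>t. upper d1 x t * f t \<partial>ivl L) - d0 x x * f x)"
proof (rule acI)
  obtain C1 where K1: "kernel_on L C1 (upper d1)" using upper_kernel[OF c1] by blast
  obtain C0 where K0: "kernel_on L C0 (upper d0)" using upper_kernel[OF c0] by blast
  have dL: "(\<lambda>x. d0 x x * f x) \<in> L2 (ivl L)"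
    by (intro L2_mult_continuous f continuous_triangle_sections(3) c0)
  note uL = kernel_integral_L2[OF K1 f]
  show "(\<lambda>x. (\<integral>t. upper d1 x t * f t \<partial>ivl L) - d0 x x * f x) \<in> L2 (ivl L)"
    by (intro L2_diff uL dL)
  \<comment> \<open>For fixed t the kernel vanishes for s above t, so the integration stops at min x
    t. For t below x this leaves \<open>d0 t t\<close>, the source of the diagonal term.\<close>
  have inn: "(\<integral>s. indicator {..x} s * upper d1 s t \<partial>ivl L) = d0 (min x t) t - d0 0 t"
    if x: "x \<in> {0..L}" and t: "t \<in> {0<..<L}" for x t
  proof -
    define m where "m = min x t"
    have m: "0 \<le> m" "m \<le> t" "m \<le> L" "m \<le> x" using x t by (auto simp: m_def)
    have c1t: "continuous_on {0..m} (\<lambda>s. d1 s t)" and c0t: "continuous_on {0..m} (\<lambda>s. d0 s t)"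
      using continuous_triangle_sections(1)[OF c1, of t] continuous_triangle_sections(1)[OF c0, of t] m t
      by (auto intro: continuous_on_subset)
    have si: "set_integrable lebesgue {0..m} (\<lambda>s. d1 s t)"
      by (rule absolutely_integrable_continuous_real[OF c1t])
    have "(\<integral>s. indicator {..x} s * upper d1 s t \<partial>ivl L) = (\<integral>s. indicator {0..m} s *\<^sub>R d1 s t \<partial>lebesgue)"
      unfolding integral_ivl
    proof (rule integral_cong_AE)
      have u: "(\<lambda>s. upper d1 s t) \<in> borel_measurable (ivl L)"
        using measurable_Pair1[OF kernel_measurable[OF K1], of t] t by simp
      have "(\<lambda>s. indicator {..x} s * upper d1 s t) \<in> borel_measurable (ivl L)"
        by (intro borel_measurable_times u measurable_restrict_space1 borel_measurable_indicator) auto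
      then show "(\<lambda>s. indicat_real {0<..<L} s *\<^sub>R (indicator {..x} s * upper d1 s t)) \<in> borel_measurable lebesgue"
        by (simp add: borel_measurable_restrict_space_iff)
      show "(\<lambda>s. indicat_real {0..m} s *\<^sub>R d1 s t) \<in> borel_measurable lebesgue"
        using si by (auto simp: set_integrable_def)
      show "AE s in lebesgue. indicat_real {0<..<L} s *\<^sub>R (indicator {..x} s * upper d1 s t) = indicat_real {0..m} s *\<^sub>R d1 s t"
        using AE_completion[OF AE_lborel_singleton[of 0]] AE_completion[OF AE_lborel_singleton[of m]] 
        by eventually_elim (use m t in \<open>auto simp: indicator_def upper_def m_def\<close>)
    qed
    also have "\<dots> = integral {0..m} (\<lambda>s. d1 s t)"
      using set_lebesgue_integral_eq_integral(2)[OF si] by (simp add: set_lebesgue_integral_def)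
    \<comment> \<open>The derivative is known in the open triangle and continuity on the closed one,
      which is what the interior form of the fundamental theorem asks for.\<close>
    also have "\<dots> = d0 m t - d0 0 t"
      by (rule integral_unique, rule fundamental_theorem_of_calculus_interior[OF m(1) c0t])
         (use m t in \<open>auto intro!: der simp: \<Delta>_def\<close>)
    finally show ?thesis by (simp add: m_def)
  qed
  fix x assume x: "x \<in> {0..L}"
  have ind: "integrable (ivl L) (\<lambda>s. indicator {..x} s :: complex)"
  proof (rule integrable_ivl_bounded[where C = 1])
    show "indicator {..x} \<in> borel_measurable (ivl L)"
      by (intro measurable_restrict_space1 borel_measurable_indicator) auto
  qed (simp add: indicator_def)
  have fub: "(\<integral>s. indicator {..x} s * (\<integral>t. upper d1 s t * f t \<partial>ivl L) \<partial>ivl L)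
      = (\<integral>t. (\<integral>s. indicator {..x} s * upper d1 s t \<partial>ivl L) * f t \<partial>ivl L)"
    by (rule Fubini_kernel(2)[OF sigma_finite_ivl ind L2_ivl_integrable[OF f] kernel_measurable[OF K1]])
       (use kernel_bound[OF K1] in auto)
  have sec: "integrable (ivl L) (\<lambda>t. upper d0 x t * f t)" if x: "x \<in> {0..L}" for x
  proof (rule L2_mult_integrable[OF _ f])
    show "upper d0 x \<in> L2 (ivl L)"
    proof (rule L2_bound[where C = 1])
      define g where "g t = d0 x (max x t)" for t
      have "continuous_on {0..L} (\<lambda>t. d0 x (max x t))"
        by (rule continuous_on_compose2[OF continuous_triangle_sections(2)[OF c0, of x]])
           (use x in \<open>auto intro!: continuous_intros\<close>)
      then have "continuous_on {0..L} g" by (simp only: g_def[abs_def])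
      then show gL: "g \<in> L2 (ivl L)" by (rule continuous_L2_ivl)
      have "(\<lambda>t. indicator {x<..} t * g t) \<in> borel_measurable (ivl L)"
        by (intro borel_measurable_times L2_measurable[OF gL] measurable_restrict_space1 borel_measurable_indicator) auto
      also have "(\<lambda>t. indicator {x<..} t * g t) = upper d0 x"
        by (auto simp: g_def upper_def indicator_def)
      finally show "upper d0 x \<in> borel_measurable (ivl L)" .
      show "cmod (upper d0 x t) \<le> 1 * cmod (g t)" for t by (auto simp: upper_def g_def)
    qed
  qed
  have i1: "integrable (ivl L) (\<lambda>s. indicator {..x} s * (d0 s s * f s))"
    by (intro integrable_ivl_indicator L2_ivl_integrable dL) auto
  have i2: "integrable (ivl L) (\<lambda>s. indicator {..x} s * (\<integral>t. upper d1 s t * f t \<partial>ivl L))"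
    by (intro integrable_ivl_indicator L2_ivl_integrable uL) auto
  have "(\<integral>t. (\<integral>s. indicator {..x} s * upper d1 s t \<partial>ivl L) * f t \<partial>ivl L)
      = (\<integral>t. (upper d0 x t * f t + indicator {..x} t * (d0 t t * f t)) - upper d0 0 t * f t \<partial>ivl L)"
  proof (intro Bochner_Integration.integral_cong refl)
    fix t assume "t \<in> space (ivl L)"
    then have t: "t \<in> {0<..<L}" by simp
    show "(\<integral>s. indicator {..x} s * upper d1 s t \<partial>ivl L) * f t
        = (upper d0 x t * f t + indicator {..x} t * (d0 t t * f t)) - upper d0 0 t * f t"
      unfolding inn[OF x t] using t by (auto simp: upper_def min_def algebra_simps)
  qed
  also have "\<dots> = ((\<integral>t. upper d0 x t * f t \<partial>ivl L) + (\<integral>t. indicator {..x} t * (d0 t t * f t) \<partial>ivl L))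
      - (\<integral>t. upper d0 0 t * f t \<partial>ivl L)"
    using sec[OF x] sec[of 0] i1 L by (simp add: Bochner_Integration.integral_add Bochner_Integration.integral_diff)
  finally have "(\<integral>s. indicator {..x} s * (\<integral>t. upper d1 s t * f t \<partial>ivl L) \<partial>ivl L) = \<dots>"
    unfolding fub .
  then show "(\<integral>t. upper d0 x t * f t \<partial>ivl L) = (\<integral>t. upper d0 0 t * f t \<partial>ivl L) +
      (\<integral>y. indicator {..x} y * ((\<integral>t. upper d1 y t * f t \<partial>ivl L) - d0 y y * f y) \<partial>ivl L)"
    using i1 i2 by (simp add: right_diff_distrib Bochner_Integration.integral_diff)
qed

text \<open>The planar norm uses completed Lebesgue measure, the iterated one completed measure in
  each variable. The function h is Borel, so both reduce to Fubini for the Borel product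
  measure.\<close>

lemma hs_norm_upper:
  assumes L: "L > 0" and d: "continuous_on (closed_triangle L) (\<lambda>(x, y). d x y)"
  shows "sqrt (hs_norm_sq L (upper d)) = L2_norm (lebesgue_on (\<Delta> L)) (\<lambda>(x, y). d x y)"
proof -
  define h where "h p = indicator (\<Delta> L) p *\<^sub>R (cmod (case p of (x, y) \<Rightarrow> d x y))\<^sup>2" for p
  have hm: "h \<in> borel_measurable borel"
    unfolding h_def[abs_def] by (rule Delta_indicator_measurable) (intro continuous_intros d)
  have "bounded ((\<lambda>(x, y). d x y) ` closed_triangle L)"
    by (intro compact_imp_bounded compact_continuous_image d compact_triangle)
  then obtain C where C: "\<forall>z\<in>(\<lambda>(x, y). d x y) ` closed_triangle L. norm z \<le> C" unfolding bounded_iff by blast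
  have hi: "integrable lborel h"
  proof (rule integrableI_bounded_set[where A = "cbox (0, 0) (L, L)" and B = "C\<^sup>2"])
    show "h \<in> borel_measurable lborel" using hm by simp
    show "emeasure lborel (cbox (0, 0) (L, L)) < \<infinity>" by (rule emeasure_bounded_finite) (rule bounded_cbox)
    have b: "norm (h p) \<le> C\<^sup>2" for p
    proof (cases "p \<in> \<Delta> L")
      case True
      then have "(case p of (x, y) \<Rightarrow> d x y) \<in> (\<lambda>(x, y). d x y) ` closed_triangle L"
        by (intro imageI) (auto simp: \<Delta>_def closed_triangle_def)
      then show ?thesis using C True by (auto simp: h_def intro!: power_mono)
    qed (simp add: h_def)
    then show "AE p in lborel. p \<in> cbox (0, 0) (L, L) \<longrightarrow> norm (h p) \<le> C\<^sup>2" by simp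
    show "AE p in lborel. p \<notin> cbox (0, 0) (L, L) \<longrightarrow> h p = 0"
      by (auto simp: h_def \<Delta>_def indicator_def)
  qed auto
  have "(\<integral>p. (cmod (case p of (x, y) \<Rightarrow> d x y))\<^sup>2 \<partial>lebesgue_on (\<Delta> L)) = (\<integral>p. h p \<partial>lebesgue)"
    unfolding h_def using Delta_borel by (intro integral_restrict_space) auto
  also have "\<dots> = (\<integral>p. h p \<partial>lborel)" using hm by (intro integral_completion) simp
  also have "\<dots> = (\<integral>s. (\<integral>t. h (s, t) \<partial>lborel) \<partial>lborel)"
    using lborel_pair.integral_fst'[of h] hi by (simp add: lborel_prod)
  also have "\<dots> = (\<integral>s. (\<integral>t. h (s, t) \<partial>lebesgue) \<partial>lebesgue)"
  proof -
    have sec: "(\<integral>t. h (s, t) \<partial>lborel) = (\<integral>t. h (s, t) \<partial>lebesgue)" for s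
      using hm by (intro integral_completion[symmetric]) simp
    have "(\<lambda>s. \<integral>t. h (s, t) \<partial>lborel) \<in> borel_measurable lborel"
      using hm by (intro lborel.borel_measurable_lebesgue_integral) (simp add: lborel_prod)
    then show ?thesis unfolding sec by (intro integral_completion[symmetric])
  qed
  also have "\<dots> = hs_norm_sq L (upper d)"
    unfolding hs_norm_sq_def integral_ivl
  proof (intro Bochner_Integration.integral_cong refl)
    fix s
    show "(\<integral>t. h (s, t) \<partial>lebesgue) = indicator {0<..<L} s *\<^sub>R (\<integral>t. indicator {0<..<L} t *\<^sub>R (cmod (upper d s t))\<^sup>2 \<partial>lebesgue)"
    proof (cases "s \<in> {0<..<L}")
      case True
      then have "h (s, t) = indicator {0<..<L} t *\<^sub>R (cmod (upper d s t))\<^sup>2" for t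
        by (auto simp: h_def \<Delta>_def upper_def indicator_def)
      then show ?thesis using True by simp
    next
      case False
      then have "h (s, t) = 0" for t by (auto simp: h_def \<Delta>_def indicator_def)
      then show ?thesis using False by simp
    qed
  qed
  finally show ?thesis by (simp add: L2_norm_def case_prod_beta)
qed

section \<open>The semigroup on the space of classes\<close>

lemma proj_eq_emb: "proj L x = x \<Longrightarrow> x = emb L (rep_l2 x)"
  by (simp add: proj_def)

text \<open>A real multiplier is symmetric; for the multiplier x this merges the two terms in the
  derivative of the weighted energy.\<close>

lemma inner_mop_real:
  assumes m: "continuous_on {0..L} (\<lambda>s. complex_of_real (m s))" and a: "proj L a = a" and b: "proj L b = b"
  shows "inner (mop L (\<lambda>s. complex_of_real (m s)) a) b = inner a (mop L (\<lambda>s. complex_of_real (m s)) b)"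
proof -
  have "inner (mop L m' a) (emb L (rep_l2 b)) = inner (emb L (rep_l2 a)) (mop L m' b)"
    if m': "m' = (\<lambda>s. complex_of_real (m s))" for m'
    unfolding mop_def m' using inner_emb[OF L2_mult_continuous(2)[OF rep_l2_ivl m] rep_l2_ivl, of a b]
      inner_emb[OF rep_l2_ivl L2_mult_continuous(2)[OF rep_l2_ivl m], of a b]
    by (simp add: mult.assoc mult.left_commute)
  then show ?thesis using a b by (simp add: proj_def)
qed

locale kdv_semigroup = kdv_interval +
  fixes S :: "real \<Rightarrow> (real \<Rightarrow> complex) \<Rightarrow> real \<Rightarrow> complex"
  assumes generates: "generates L (A_graph L \<alpha> \<beta> \<delta>) S"
begin

lemma semigroup: "C0_semigroup L S"
  using generates by (simp add: generates_def)

lemma S_L2: "t \<ge> 0 \<Longrightarrow> f \<in> L2 (ivl L) \<Longrightarrow> S t f \<in> L2 (ivl L)"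
  using semigroup by (simp add: C0_semigroup_def)

lemma S_linear:
  "t \<ge> 0 \<Longrightarrow> f \<in> L2 (ivl L) \<Longrightarrow> g \<in> L2 (ivl L) \<Longrightarrow>
     AE x in ivl L. S t (\<lambda>y. a * f y + b * g y) x = a * S t f x + b * S t g x"
  using semigroup by (simp add: C0_semigroup_def)

lemma S_semigroup_law:
  "s \<ge> 0 \<Longrightarrow> t \<ge> 0 \<Longrightarrow> f \<in> L2 (ivl L) \<Longrightarrow> AE x in ivl L. S (s + t) f x = S s (S t f) x"
  using semigroup by (simp add: C0_semigroup_def)

lemma S_limit:
  "f \<in> L2 (ivl L) \<Longrightarrow> ((\<lambda>t. L2_norm (ivl L) (\<lambda>x. S t f x - f x)) \<longlongrightarrow> 0) (at_right 0)"
  using semigroup by (simp add: C0_semigroup_def)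

lemma S_bounded: "t \<ge> 0 \<Longrightarrow> \<exists>C. \<forall>f\<in>L2 (ivl L). L2_norm (ivl L) (S t f) \<le> C * L2_norm (ivl L) f"
  using semigroup by (simp add: C0_semigroup_def)

text \<open>S acts on functions and its axioms do not say that it respects equality almost
  everywhere. Linearity and boundedness force it: the difference has norm 0, hence so has its
  image.\<close>

lemma S_cong:
  assumes t: "t \<ge> 0" and f: "f \<in> L2 (ivl L)" and g: "g \<in> L2 (ivl L)" and ae: "AE x in ivl L. f x = g x"
  shows "emb L (S t f) = emb L (S t g)"
proof -
  define d where "d y = g y - f y" for y
  have d: "d \<in> L2 (ivl L)" unfolding d_def[abs_def] by (intro L2_diff f g)
  have "L2_norm (ivl L) d = L2_norm (ivl L) (\<lambda>x. 0)"
    by (rule L2_norm_cong_AE) (use L2_measurable[OF d] ae in \<open>auto simp: d_def\<close>)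
  then have d0: "L2_norm (ivl L) d = 0" by (simp add: L2_norm_def)
  obtain C where "L2_norm (ivl L) (S t d) \<le> C * L2_norm (ivl L) d" using S_bounded[OF t] d by blast
  then have "norm (emb L (S t d)) \<le> 0" using d0 by (simp add: norm_emb S_L2[OF t d])
  then have z: "emb L (S t d) = 0" by simp
  \<comment> \<open>Written with explicit coefficients 1 to fit the linearity axiom.\<close>
  have g': "g = (\<lambda>y. 1 * f y + 1 * d y)" by (simp add: d_def)
  have "emb L (S t g) = emb L (\<lambda>x. S t f x + S t d x)"
    using S_linear[OF t f d, of 1 1]
    by (intro emb_cong_AE S_L2 t g L2_add f d) (subst g', simp)
  also have "\<dots> = emb L (S t f)" by (simp add: emb_add S_L2 t f d z)
  finally show ?thesis by simp
qed

definition Tsg :: "real \<Rightarrow> l2 \<Rightarrow> l2" where "Tsg t a = emb L (S t (rep_l2 a))"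

text \<open>
  The summand \<open>a - proj L a\<close> makes this a strongly continuous semigroup on the whole space and not
  only on the functions supported in $(0,L)$.
\<close>

definition Sh :: "real \<Rightarrow> l2 \<Rightarrow> l2" where "Sh t a = Tsg t a + (a - proj L a)"

lemma Tsg_emb: "t \<ge> 0 \<Longrightarrow> f \<in> L2 (ivl L) \<Longrightarrow> Tsg t (emb L f) = emb L (S t f)"
  unfolding Tsg_def by (intro S_cong rep_emb rep_l2_ivl)

lemma Tsg_proj: "t \<ge> 0 \<Longrightarrow> Tsg t (proj L a) = Tsg t a"
  unfolding proj_def by (subst Tsg_emb) (auto simp: Tsg_def)

lemma proj_Tsg: "t \<ge> 0 \<Longrightarrow> proj L (Tsg t a) = Tsg t a"
  unfolding Tsg_def by (intro proj_emb S_L2 rep_l2_ivl)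

lemma bounded_linear_Tsg: "t \<ge> 0 \<Longrightarrow> bounded_linear (Tsg t)"
proof -
  assume t: "t \<ge> 0"
  obtain C where C: "\<And>f. f \<in> L2 (ivl L) \<Longrightarrow> L2_norm (ivl L) (S t f) \<le> C * L2_norm (ivl L) f"
    using S_bounded[OF t] by blast
  show ?thesis
  proof (rule bounded_linear_intro)
    fix a b :: l2 and c :: real
    have *: "Tsg t (x *\<^sub>R proj L a + y *\<^sub>R proj L b) = x *\<^sub>R Tsg t (proj L a) + y *\<^sub>R Tsg t (proj L b)" for x y :: real and a b
    proof -
      obtain f where f: "f \<in> L2 (ivl L)" "proj L a = emb L f" using emb_surj_proj by blast
      obtain g where g: "g \<in> L2 (ivl L)" "proj L b = emb L g" using emb_surj_proj by blast
      have "x *\<^sub>R proj L a + y *\<^sub>R proj L b = emb L (\<lambda>s. complex_of_real x * f s + complex_of_real y * g s)"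
        by (simp add: f g emb_add emb_scaleR L2_cmult)
      then have "Tsg t (x *\<^sub>R proj L a + y *\<^sub>R proj L b) = emb L (S t (\<lambda>s. complex_of_real x * f s + complex_of_real y * g s))"
        by (simp add: Tsg_emb t f g L2_add L2_cmult)
      also have "\<dots> = emb L (\<lambda>s. complex_of_real x * S t f s + complex_of_real y * S t g s)"
        by (intro emb_cong_AE S_linear S_L2 t f g L2_add L2_cmult)
      also have "\<dots> = x *\<^sub>R Tsg t (proj L a) + y *\<^sub>R Tsg t (proj L b)"
        by (simp add: f g emb_add emb_scaleR L2_cmult S_L2 t Tsg_emb)
      finally show ?thesis .
    qed
    show "Tsg t (a + b) = Tsg t a + Tsg t b"
      using *[of 1 a 1 b] by (simp add: Tsg_proj t flip: proj_add)
    show "Tsg t (c *\<^sub>R a) = c *\<^sub>R Tsg t a"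
      using *[of c a 0 a] Tsg_proj[OF t, of "c *\<^sub>R a"] Tsg_proj[OF t, of a] by (simp add: proj_scaleR)
    have "norm (Tsg t a) \<le> C * norm (proj L a)"
      unfolding Tsg_def proj_def using C[OF rep_l2_ivl[of a]] by (simp add: norm_emb S_L2 t)
    also have "\<dots> \<le> \<bar>C\<bar> * norm a" by (intro mult_mono norm_proj_le) auto
    finally show "norm (Tsg t a) \<le> norm a * \<bar>C\<bar>" by (simp add: mult.commute)
  qed
qed

lemma Tsg_0: "Tsg 0 a = proj L a"
  unfolding Tsg_def proj_def using semigroup
  by (intro emb_cong_AE S_L2 rep_l2_ivl) (auto simp: C0_semigroup_def)

lemma Tsg_Tsg:
  assumes "s \<ge> 0" "t \<ge> 0" shows "Tsg s (Tsg t a) = Tsg (s + t) a"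
proof -
  have "Tsg s (Tsg t a) = emb L (S s (S t (rep_l2 a)))"
    unfolding Tsg_def[of t] using assms by (intro Tsg_emb S_L2 rep_l2_ivl)
  also have "\<dots> = Tsg (s + t) a"
    unfolding Tsg_def
  proof (intro emb_cong_AE S_L2 assms rep_l2_ivl add_nonneg_nonneg)
    have "AE x in ivl L. S (s + t) (rep_l2 a) x = S s (S t (rep_l2 a)) x"
      by (intro S_semigroup_law assms rep_l2_ivl)
    then show "AE x in ivl L. S s (S t (rep_l2 a)) x = S (s + t) (rep_l2 a) x" by eventually_elim simp
  qed
  finally show ?thesis .
qed

lemma proj_Sh: "t \<ge> 0 \<Longrightarrow> proj L (Sh t a) = Tsg t a"
  by (simp add: Sh_def proj_add proj_diff proj_Tsg)

lemma Sh_eq_Tsg: "proj L a = a \<Longrightarrow> Sh t a = Tsg t a"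
  by (simp add: Sh_def)

sublocale C0_sgrp Sh
proof (rule C0_sgrp.intro)
  fix t :: real assume t: "t \<ge> 0"
  show "bounded_linear (Sh t)"
    unfolding Sh_def[abs_def] by (intro bounded_linear_add bounded_linear_sub bounded_linear_Tsg bounded_linear_proj bounded_linear_ident t)
next
  show "Sh 0 x = x" for x by (simp add: Sh_def Tsg_0)
next
  fix s t :: real and x assume st: "s \<ge> 0" "t \<ge> 0"
  have "Tsg s (Sh t x) = Tsg (s + t) x"
    using Tsg_proj[OF st(1), of "Sh t x"] by (simp add: proj_Sh st Tsg_Tsg)
  then show "Sh (s + t) x = Sh s (Sh t x)"
    by (simp add: Sh_def[of s] proj_Sh st) (simp add: Sh_def)
next
  fix x
  have "((\<lambda>t. L2_norm (ivl L) (\<lambda>y. S t (rep_l2 x) y - rep_l2 x y)) \<longlongrightarrow> 0) (at_right 0)"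
    by (rule S_limit[OF rep_l2_ivl])
  then have "((\<lambda>t. norm (Sh t x - x)) \<longlongrightarrow> 0) (at_right 0)"
  proof (rule Lim_transform_eventually)
    have "L2_norm (ivl L) (\<lambda>y. S t (rep_l2 x) y - rep_l2 x y) = norm (Sh t x - x)" if "t > 0" for t
    proof -
      have "Sh t x - x = emb L (\<lambda>y. S t (rep_l2 x) y - rep_l2 x y)"
        using that by (simp add: Sh_def Tsg_def proj_def emb_diff S_L2)
      then show ?thesis using that by (simp add: norm_emb L2_diff S_L2)
    qed
    then show "\<forall>\<^sub>F t in at_right 0. L2_norm (ivl L) (\<lambda>y. S t (rep_l2 x) y - rep_l2 x y) = norm (Sh t x - x)"
      by (auto simp: eventually_at_right_field intro: exI[of _ 1])
  qed
  then show "((\<lambda>t. Sh t x) \<longlongrightarrow> x) (at_right 0)"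
    by (rule LIM_zero_cancel[OF tendsto_norm_zero_cancel])
qed

text \<open>The link between the hypothesis on S and the abstract theory: on the range of
  \<open>proj L\<close> the difference quotients of S and of \<open>Sh\<close> have the same
  norm.\<close>

lemma gen_iff_A_graph:
  assumes \<phi>: "\<phi> \<in> L2 (ivl L)" and \<psi>: "\<psi> \<in> L2 (ivl L)"
  shows "gen (emb L \<phi>) (emb L \<psi>) \<longleftrightarrow> A_graph L \<alpha> \<beta> \<delta> \<phi> \<psi>"
proof -
  have *: "L2_norm (ivl L) (\<lambda>x. (S t \<phi> x - \<phi> x) / t - \<psi> x) = norm ((Sh t (emb L \<phi>) - emb L \<phi>) /\<^sub>R t - emb L \<psi>)"
    if t: "t > 0" for t :: real
  proof -
    have l: "(\<lambda>x. complex_of_real (inverse t) * (S t \<phi> x - \<phi> x)) \<in> L2 (ivl L)"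
      using t by (intro L2_cmult L2_diff S_L2 \<phi>) auto
    have "(Sh t (emb L \<phi>) - emb L \<phi>) /\<^sub>R t - emb L \<psi> = emb L (\<lambda>x. complex_of_real (inverse t) * (S t \<phi> x - \<phi> x) - \<psi> x)"
      using t by (simp only: Sh_eq_Tsg[OF proj_emb[OF \<phi>]] Tsg_emb[OF less_imp_le[OF t] \<phi>] emb_diff[OF l \<psi>]
          emb_scaleR[OF L2_diff[OF S_L2[OF less_imp_le[OF t] \<phi>] \<phi>]] emb_diff[OF S_L2[OF less_imp_le[OF t] \<phi>] \<phi>])
    also have "norm \<dots> = L2_norm (ivl L) (\<lambda>x. complex_of_real (inverse t) * (S t \<phi> x - \<phi> x) - \<psi> x)"
      by (rule norm_emb[OF L2_diff[OF l \<psi>]])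
    finally show ?thesis by (simp add: field_simps)
  qed
  have "A_graph L \<alpha> \<beta> \<delta> \<phi> \<psi> \<longleftrightarrow> ((\<lambda>t. L2_norm (ivl L) (\<lambda>x. (S t \<phi> x - \<phi> x) / t - \<psi> x)) \<longlongrightarrow> 0) (at_right 0)"
    using generates \<phi> \<psi> unfolding generates_def by blast
  also have "\<dots> \<longleftrightarrow> ((\<lambda>t. norm ((Sh t (emb L \<phi>) - emb L \<phi>) /\<^sub>R t - emb L \<psi>)) \<longlongrightarrow> 0) (at_right 0)"
    by (rule tendsto_cong) (use * in \<open>auto simp: eventually_at_right_field intro: exI[of _ 1]\<close>)
  also have "\<dots> \<longleftrightarrow> gen (emb L \<phi>) (emb L \<psi>)"
    unfolding gen_def by (simp add: LIM_zero_iff tendsto_norm_zero_iff)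
  finally show ?thesis by simp
qed

text \<open>\<open>Sh\<close> fixes the part of x outside (0,L), so this part drops out of every
  difference quotient; the limit y stays in the range of \<open>proj L\<close> by
  continuity.\<close>

lemma proj_gen:
  assumes "gen x y" shows "gen (proj L x) y" "proj L y = y"
proof -
  have e: "(Sh h x - x) /\<^sub>R h = (Sh h (proj L x) - proj L x) /\<^sub>R h" "proj L ((Sh h x - x) /\<^sub>R h) = (Sh h x - x) /\<^sub>R h" if "h > 0" for h
    using that by (simp_all add: Sh_def Tsg_proj proj_diff proj_add proj_scaleR proj_Tsg)
  show "gen (proj L x) y"
    unfolding gen_def
    by (rule Lim_transform_eventually[OF assms[unfolded gen_def]])
       (use e(1) in \<open>auto simp: eventually_at_right_field intro: exI[of _ 1]\<close>)
  have "((\<lambda>h. proj L ((Sh h x - x) /\<^sub>R h)) \<longlongrightarrow> proj L y) (at_right 0)"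
    using assms by (intro bounded_linear.tendsto[OF bounded_linear_proj]) (simp add: gen_def)
  then have "((\<lambda>h. (Sh h x - x) /\<^sub>R h) \<longlongrightarrow> proj L y) (at_right 0)"
    by (rule Lim_transform_eventually)
       (use e(2) in \<open>auto simp: eventually_at_right_field intro: exI[of _ 1]\<close>)
  then show "proj L y = y"
    using assms unfolding gen_def by (intro tendsto_unique[of "at_right 0"]) auto
qed

lemma gen_A_rel:
  assumes "gen x y" "proj L x = x"
  shows "\<exists>v c. Arel x y v c"
proof -
  have "A_graph L \<alpha> \<beta> \<delta> (rep_l2 x) (rep_l2 y)"
    using gen_iff_A_graph[OF rep_l2_ivl rep_l2_ivl, of x y] assms proj_gen(2)[OF assms(1)]
    by (simp add: proj_def)
  from A_graph_A_rel[OF this rep_l2_ivl rep_l2_ivl] show ?thesis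
    using assms proj_gen(2)[OF assms(1)] by (simp add: proj_def)
qed

lemma proj_Sh_eq: "t \<ge> 0 \<Longrightarrow> proj L x = x \<Longrightarrow> proj L (Sh t x) = Sh t x"
  by (simp add: proj_Sh Sh_eq_Tsg proj_Tsg)

lemma gen_dense_proj:
  assumes "e > 0" "proj L x = x"
  obtains x' y' where "gen x' y'" "proj L x' = x'" "norm (x' - x) < e"
proof -
  obtain x' y' where g: "gen x' y'" "norm (x' - x) < e"
    using gen_dense[OF assms(1)] by metis
  show ?thesis
  proof (rule that[OF proj_gen(1)[OF g(1)] proj_proj])
    have "proj L x' - x = proj L (x' - x)" by (simp add: proj_diff assms(2))
    then show "norm (proj L x' - x) < e"
      using norm_proj_le[of L "x' - x"] g(2) by (metis order_le_less_trans)
  qed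
qed

context
  fixes x y assumes g: "gen x y" and px: "proj L x = x"
begin

lemma Sh_gen_A_rel: "t \<ge> 0 \<Longrightarrow> \<exists>v c. Arel (Sh t x) (Sh t y) v c"
  by (intro gen_A_rel gen_S g proj_Sh_eq px)

lemma energy_derivative:
  assumes t: "t \<ge> 0"
  shows "((\<lambda>t. (norm (Sh t x))\<^sup>2) has_real_derivative 2 * inner (Sh t x) (Sh t y)) (at t within {0..})"
proof -
  have d: "((\<lambda>t. Sh t x) has_derivative (\<lambda>h. h *\<^sub>R Sh t y)) (at t within {0..})"
    using S_has_vector_derivative[OF g t] by (simp add: has_vector_derivative_def)
  show ?thesis
    unfolding has_field_derivative_def power2_norm_eq_inner
    by (rule has_derivative_eq_rhs[OF has_derivative_inner[OF d d]])
       (auto simp: fun_eq_iff inner_commute)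
qed

lemma weighted_energy_derivative:
  assumes t: "t \<ge> 0"
  shows "((\<lambda>t. inner (Xop (Sh t x)) (Sh t x)) has_real_derivative 2 * inner (Xop (Sh t x)) (Sh t y)) (at t within {0..})"
proof -
  have cx: "continuous_on {0..L} complex_of_real" by (intro continuous_intros)
  have d: "((\<lambda>t. Sh t x) has_derivative (\<lambda>h. h *\<^sub>R Sh t y)) (at t within {0..})"
    using S_has_vector_derivative[OF g t] by (simp add: has_vector_derivative_def)
  have dX: "((\<lambda>t. Xop (Sh t x)) has_derivative (\<lambda>h. Xop (h *\<^sub>R Sh t y))) (at t within {0..})"
    by (rule bounded_linear.has_derivative[OF bounded_linear_mop[OF cx] d])
  have sc: "Xop (h *\<^sub>R a) = h *\<^sub>R Xop a" for h a
    by (rule linear_scale[OF bounded_linear.linear[OF bounded_linear_mop[OF cx]]])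
  have "inner (Xop (Sh t y)) (Sh t x) = inner (Sh t y) (Xop (Sh t x))"
    using inner_mop_real[of L "\<lambda>s. s" "Sh t y" "Sh t x"] cx t
    by (simp add: proj_Sh_eq px proj_gen(2)[OF g])
  then have sym: "inner (Xop (Sh t y)) (Sh t x) = inner (Xop (Sh t x)) (Sh t y)"
    by (simp add: inner_commute)
  show ?thesis
    unfolding has_field_derivative_def
    by (rule has_derivative_eq_rhs[OF has_derivative_inner[OF dX d]])
       (auto simp: fun_eq_iff sc sym)
qed

lemma gen_contraction:
  assumes "t \<ge> 0" shows "norm (Sh t x) \<le> norm x"
proof -
  have "(norm (Sh t x))\<^sup>2 \<le> (norm (Sh 0 x))\<^sup>2"
  proof (rule DERIV_nonpos_imp_decreasing_open[OF assms])
    fix s assume s: "0 < s" "s < t"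
    obtain v c where "Arel (Sh s x) (Sh s y) v c" using Sh_gen_A_rel[of s] s by auto
    then have "2 * inner (Sh s x) (Sh s y) \<le> 0"
      using A_rel_energy(1)[of "Sh s x" "Sh s y" v c] \<beta> by simp
    moreover have "((\<lambda>t. (norm (Sh t x))\<^sup>2) has_real_derivative 2 * inner (Sh s x) (Sh s y)) (at s)"
      using energy_derivative[of s] s at_within_interior[of s "{0..}"] by (simp add: interior_Ici)
    ultimately show "\<exists>y. ((\<lambda>t. (norm (Sh t x))\<^sup>2) has_real_derivative y) (at s) \<and> y \<le> 0" by blast
  next
    show "continuous_on {0..t} (\<lambda>t. (norm (Sh t x))\<^sup>2)"
      by (intro continuous_intros continuous_on_subset[OF continuous_on_S]) auto
  qed
  then show ?thesis unfolding S_0 by (rule power2_le_imp_le) simp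
qed

end

lemma contraction:
  assumes x: "proj L x = x" and t: "t \<ge> 0"
  shows "norm (Sh t x) \<le> norm x"
proof (rule field_le_epsilon)
  fix e :: real assume e: "e > 0"
  obtain B where B: "\<And>x. norm (Sh t x) \<le> norm x * B" "B > 0"
    using bounded_linear.pos_bounded[OF lin[OF t]] by blast
  \<comment> \<open>The approximation error enters once through the norm of x' and B times through
    \<open>Sh t\<close>.\<close>
  have e': "e / (B + 1) > 0" using e B by simp
  obtain x' y' where g: "gen x' y'" "proj L x' = x'" and n: "norm (x' - x) < e / (B + 1)"
    using gen_dense_proj[OF e' x] by blast
  have "norm (Sh t x) \<le> norm (Sh t x') + norm (Sh t (x' - x))"
    using norm_triangle_ineq4[of "Sh t x'" "Sh t (x' - x)"] t by (simp add: S_diff)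
  also have "\<dots> \<le> norm x' + norm (x' - x) * B"
    by (intro add_mono gen_contraction[OF g t] B)
  also have "\<dots> \<le> (norm x + norm (x' - x)) + norm (x' - x) * B"
    using norm_triangle_sub[of x' x] by simp
  also have "\<dots> = norm x + norm (x' - x) * (B + 1)" by (simp add: algebra_simps)
  also have "\<dots> \<le> norm x + e" using n B by (simp add: field_simps)
  finally show "norm (Sh t x) \<le> norm x + e" .
qed

end

section \<open>Smoothing and the boundary trace\<close>

lemma integral_ivl_continuous:
  fixes g :: "real \<Rightarrow> 'b::euclidean_space"
  assumes "continuous_on {0..T} g"
  shows "integrable (ivl T) g" "(\<integral>t. g t \<partial>ivl T) = integral {0..T} g"
proof -
  obtain C where C: "\<forall>x\<in>{0..T}. norm (g x) \<le> C"
    using continuous_Icc_bounded[OF assms] by blast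
  show i: "integrable (ivl T) g"
    by (rule integrable_ivl_bounded[OF continuous_ivl_measurable[OF assms], of C]) (use C in auto)
  have s: "set_integrable lebesgue {0<..<T} g"
    using i by (simp add: set_integrable_def integrable_restrict_space)
  have "(\<integral>t. g t \<partial>ivl T) = set_lebesgue_integral lebesgue {0<..<T} g"
    unfolding integral_ivl set_lebesgue_integral_def ..
  also have "\<dots> = integral {0<..<T} g"
    by (rule set_lebesgue_integral_eq_integral(2)[OF s])
  finally show "(\<integral>t. g t \<partial>ivl T) = integral {0..T} g"
    by (simp add: integral_open_interval_real)
qed

context kdv_interval
begin

text \<open>The trace c is a bounded functional of a and b. For v, the multiplier estimate applied
  to the difference of two times bounds |v(s) - v(t)|^2 by terms that tend to 0. This continuity
  makes the time integrals of v and c meaningful.\<close>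

lemma A_rel_continuous:
  assumes A: "\<And>t. t \<in> I \<Longrightarrow> Arel (a t) (b t) (v t) (c t)"
    and a: "continuous_on I a" and b: "continuous_on I b"
  shows "continuous_on I v" "continuous_on I c"
proof -
  have "continuous_on I (\<lambda>t. (pair_l2 (a t) (emb L trace_q) - pair_l2 (b t) (emb L trace_p)) / \<beta>)"
    using \<beta> by (intro continuous_intros bounded_linear.continuous_on[OF bounded_linear_pair] a b) auto
  then show "continuous_on I c"
    by (rule continuous_on_eq) (use A_rel_trace[OF A] in simp)
  have cx: "continuous_on {0..L} complex_of_real" by (intro continuous_intros)
  show "continuous_on I v"
    unfolding continuous_on_def
  proof
    fix t assume t: "t \<in> I"
    have at: "(a \<longlongrightarrow> a t) (at t within I)" and bt: "(b \<longlongrightarrow> b t) (at t within I)"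
      using a b t by (auto simp: continuous_on_def)
    have "((\<lambda>s. - inner (Xop (a s - a t)) (b s - b t) / \<beta> + smooth_K * (norm (a s - a t))\<^sup>2)
        \<longlongrightarrow> - inner (Xop (a t - a t)) (b t - b t) / \<beta> + smooth_K * (norm (a t - a t))\<^sup>2) (at t within I)"
      using \<beta> by (intro tendsto_intros bounded_linear.tendsto[OF bounded_linear_mop[OF cx]] at bt) auto
    then have z: "((\<lambda>s. - inner (Xop (a s - a t)) (b s - b t) / \<beta> + smooth_K * (norm (a s - a t))\<^sup>2) \<longlongrightarrow> 0) (at t within I)"
      by simp
    have "((\<lambda>s. (norm (v s - v t))\<^sup>2) \<longlongrightarrow> 0) (at t within I)"
    proof (rule Lim_null_comparison[OF _ z])
      show "\<forall>\<^sub>F s in at t within I. norm ((norm (v s - v t))\<^sup>2)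
          \<le> - inner (Xop (a s - a t)) (b s - b t) / \<beta> + smooth_K * (norm (a s - a t))\<^sup>2"
        using A_rel_energy(2)[OF A_rel_diff[OF A A[OF t]]]
        by (auto simp: eventually_at_filter intro!: always_eventually)
    qed
    from tendsto_real_sqrt[OF this] have "((\<lambda>s. norm (v s - v t)) \<longlongrightarrow> 0) (at t within I)" by simp
    then show "(v \<longlongrightarrow> v t) (at t within I)"
      by (rule LIM_zero_cancel[OF tendsto_norm_zero_cancel])
  qed
qed

lemma norm_Xop_le: "norm (Xop a) \<le> L * norm a"
  using norm_mop_le[of L complex_of_real L a] L by (auto intro!: continuous_intros)

end

context kdv_semigroup
begin

lemma weak_derivative_zero:
  assumes E: "ac L E e" and ae: "AE x in ivl L. E x = 0"
  shows "emb L e = 0"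
proof -
  txt \<open>Integration by parts shows that \<open>e\<close> is orthogonal to the dense domain of the generator.\<close>
  note eL = ac_L2[OF E]
  \<comment> \<open>The pairing has no conjugation, so pairing with the conjugate returns the
    squared norm.\<close>
  define z where "z = emb L (\<lambda>s. cnj (e s))"
  have zp: "proj L z = z" unfolding z_def by (intro proj_emb L2_cnj eL)
  have pz: "pair_l2 (emb L e) z = complex_of_real ((norm (emb L e))\<^sup>2)"
    unfolding z_def pair_emb[OF eL L2_cnj[OF eL]] norm_emb_square[OF eL]
    by (simp only: complex_norm_square[symmetric] integral_complex_of_real)
  have *: "pair_l2 (emb L e) x = 0" if "gen x y" "proj L x = x" for x y
  proof -
    obtain v c where "Arel x y v c" using gen_A_rel \<open>gen x y\<close> \<open>proj L x = x\<close> by blast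
    then obtain D :: "nat \<Rightarrow> real \<Rightarrow> complex" where a0: "ac L (D 0) (D 1)" and bc: "D 0 0 = 0" "D 0 L = 0" and x: "x = emb L (D 0)"
      unfolding A_rel_def by (elim exE conjE) (rule that, assumption+)
    have G: "D 0 \<in> L2 (ivl L)" by (intro continuous_L2_ivl ac_continuous[OF a0])
    have "(\<integral>s. e s * D 0 s + E s * D 1 s \<partial>ivl L) = 0"
      using ac_endpoint[OF ac_mult[OF E a0] L] bc by simp
    moreover have "(\<integral>s. e s * D 0 s + E s * D 1 s \<partial>ivl L) = (\<integral>s. e s * D 0 s \<partial>ivl L)"
    proof (rule integral_cong_AE)
      show "AE s in ivl L. e s * D 0 s + E s * D 1 s = e s * D 0 s"
        using ae by eventually_elim simp
    qed (intro borel_measurable_add borel_measurable_times L2_measurable[OF eL] L2_measurable[OF G]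
         L2_measurable[OF ac_L2[OF a0]] continuous_ivl_measurable ac_continuous[OF E])+
    ultimately show ?thesis unfolding x pair_emb[OF eL G] by simp
  qed
  have "norm (emb L e) \<le> \<epsilon>" if \<epsilon>: "\<epsilon> > 0" for \<epsilon>
  proof (cases "emb L e = 0")
    case False
    obtain x y where x: "gen x y" "proj L x = x" "norm (x - z) < \<epsilon>"
      using gen_dense_proj[OF \<epsilon> zp] by blast
    have "(norm (emb L e))\<^sup>2 = cmod (pair_l2 (emb L e) z)" unfolding pz by (simp add: norm_power)
    also have "pair_l2 (emb L e) z = pair_l2 (emb L e) x - pair_l2 (emb L e) (x - z)"
      using linear_diff[OF bounded_linear.linear[OF bounded_linear_pair[of "emb L e"]], of x z]
      by (simp add: pair_l2_commute[of "emb L e"])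
    also have "\<dots> = - pair_l2 (emb L e) (x - z)" using *[OF x(1,2)] by simp
    also have "cmod \<dots> \<le> norm (emb L e) * norm (x - z)" by (simp add: cmod_pair_l2)
    also have "\<dots> \<le> norm (emb L e) * \<epsilon>" using x(3) by (intro mult_left_mono) auto
    finally show ?thesis using False by (simp add: power2_eq_square)
  qed (use \<epsilon> in simp)
  then have "norm (emb L e) \<le> 0" by (rule field_le_epsilon[of _ 0, simplified])
  then show ?thesis by simp
qed

text \<open>Weak derivatives are unique up to null sets, so the choice inside
  \<open>sobolev_norm\<close> does not affect its value. The norm becomes that of the product
  \<open>l2\<close> x \<open>l2\<close>, where the triangle inequality and limits are
  available.\<close>

lemma sobolev_norm_1:
  assumes D: "sobolev_rep L 1 D f"
  shows "sobolev_norm L 1 f = norm (emb L (D 0), emb L (D 1))"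
proof -
  define D' where "D' = (SOME D. sobolev_rep L 1 D f)"
  have D': "sobolev_rep L 1 D' f" unfolding D'_def by (rule someI[of _ D]) (rule D)
  note a = sobolev_rep_ac[OF D, of 0, simplified] note a' = sobolev_rep_ac[OF D', of 0, simplified]
  have l: "D 0 \<in> L2 (ivl L)" "D (Suc 0) \<in> L2 (ivl L)" "D' 0 \<in> L2 (ivl L)" "D' (Suc 0) \<in> L2 (ivl L)"
    using D D' by (auto simp: sobolev_rep_def)
  have ae: "AE x in ivl L. D 0 x = D' 0 x"
  proof -
    have "AE x in ivl L. f x = D 0 x" "AE x in ivl L. f x = D' 0 x"
      using D D' by (auto simp: sobolev_rep_def)
    then show ?thesis by eventually_elim simp
  qed
  have "emb L (\<lambda>x. D (Suc 0) x - D' (Suc 0) x) = 0"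
    by (rule weak_derivative_zero[OF ac_diff[OF a a']]) (use ae in \<open>auto elim: eventually_mono\<close>)
  then have 1: "emb L (D (Suc 0)) = emb L (D' (Suc 0))" by (simp add: emb_diff l)
  have 0: "emb L (D 0) = emb L (D' 0)" by (rule emb_cong_AE[OF l(1) l(3) ae])
  have "sobolev_norm L 1 f = sqrt (\<Sum>j\<le>1. (L2_norm (ivl L) (D' j))\<^sup>2)"
    unfolding sobolev_norm_def D'_def Let_def ..
  also have "\<dots> = sqrt ((norm (emb L (D' 0)))\<^sup>2 + (norm (emb L (D' (Suc 0))))\<^sup>2)"
    by (simp add: norm_emb l)
  finally show ?thesis by (simp add: norm_Pair 0 1)
qed

text \<open>The weighted energy lies between -L |x|^2 and L |x|^2, so its change over time, divided
  by 2 \<beta>, costs at most L/\<beta>; the zero-order term is integrated over [0,T].\<close>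

definition "smooth_C T = L / \<beta> + smooth_K * T"

lemma energy_integrals:
  assumes g: "gen x y" and px: "proj L x = x" and T: "T > 0"
    and A: "\<And>t. t \<ge> 0 \<Longrightarrow> Arel (Sh t x) (Sh t y) (v t) (c t)"
  shows "continuous_on {0..} v" "continuous_on {0..} c"
    "integral {0..T} (\<lambda>t. (norm (v t))\<^sup>2) \<le> smooth_C T * (norm x)\<^sup>2"
    "integral {0..T} (\<lambda>t. (norm (c t))\<^sup>2) \<le> 1 / \<beta> * (norm x)\<^sup>2"
proof -
  show cv: "continuous_on {0..} v" and cc: "continuous_on {0..} c"
    using A_rel_continuous[of "{0..}" "\<lambda>t. Sh t x" "\<lambda>t. Sh t y" v c, OF A] continuous_on_S by auto
  have iv: "(\<lambda>t. (norm (v t))\<^sup>2) integrable_on {0..T}" and ic: "(\<lambda>t. (norm (c t))\<^sup>2) integrable_on {0..T}"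
    by (intro integrable_continuous_real continuous_intros continuous_on_subset[OF cv] continuous_on_subset[OF cc]; simp)+
  have le: "norm (Sh t x) \<le> norm x" if "t \<ge> 0" for t by (rule contraction[OF px that])
  have "((\<lambda>t. 2 * inner (Sh t x) (Sh t y)) has_integral (norm (Sh T x))\<^sup>2 - (norm (Sh 0 x))\<^sup>2) {0..T}"
    using T
    by (intro fundamental_theorem_of_calculus has_vector_derivative_within_subset[OF
          energy_derivative[OF g px, unfolded has_real_derivative_iff_has_vector_derivative]]) auto
  then have "((\<lambda>t. - \<beta> * (cmod (c t))\<^sup>2) has_integral (norm (Sh T x))\<^sup>2 - (norm (Sh 0 x))\<^sup>2) {0..T}"
    by (rule has_integral_eq[rotated]) (use A_rel_energy(1)[OF A] in auto)
  then have "integral {0..T} (\<lambda>t. - \<beta> * (cmod (c t))\<^sup>2) = (norm (Sh T x))\<^sup>2 - (norm (Sh 0 x))\<^sup>2"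
    by (rule integral_unique)
  then have "\<beta> * integral {0..T} (\<lambda>t. (cmod (c t))\<^sup>2) = (norm x)\<^sup>2 - (norm (Sh T x))\<^sup>2"
    by (simp add: S_0)
  then have "\<beta> * integral {0..T} (\<lambda>t. (cmod (c t))\<^sup>2) \<le> (norm x)\<^sup>2" by simp
  then show "integral {0..T} (\<lambda>t. (norm (c t))\<^sup>2) \<le> 1 / \<beta> * (norm x)\<^sup>2"
    using \<beta> by (simp add: field_simps)
  define F where "F t = inner (Xop (Sh t x)) (Sh t x)" for t
  have F: "\<bar>F t\<bar> \<le> L * (norm x)\<^sup>2" if "t \<ge> 0" for t
  proof -
    have "\<bar>F t\<bar> \<le> norm (Xop (Sh t x)) * norm (Sh t x)" unfolding F_def by (rule Cauchy_Schwarz_ineq2)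
    also have "\<dots> \<le> (L * norm (Sh t x)) * norm (Sh t x)" by (intro mult_right_mono norm_Xop_le) auto
    also have "\<dots> = L * (norm (Sh t x))\<^sup>2" by (simp add: power2_eq_square)
    also have "\<dots> \<le> L * (norm x)\<^sup>2" using le[OF that] L by (intro mult_left_mono power_mono) auto
    finally show ?thesis .
  qed
  have hF: "((\<lambda>t. 2 * inner (Xop (Sh t x)) (Sh t y)) has_integral F T - F 0) {0..T}"
    unfolding F_def using T
    by (intro fundamental_theorem_of_calculus has_vector_derivative_within_subset[OF
          weighted_energy_derivative[OF g px, unfolded has_real_derivative_iff_has_vector_derivative]]) auto
  \<comment> \<open>The derivative of the weighted energy carries a factor 2, which the coefficient
    -1/(2 \<beta>) adjusts to the bound on |v|^2.\<close>
  have hr: "((\<lambda>t. (- 1 / (2 * \<beta>)) * (2 * inner (Xop (Sh t x)) (Sh t y)) + smooth_K * (norm x)\<^sup>2)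
      has_integral (- 1 / (2 * \<beta>)) * (F T - F 0) + (smooth_K * (norm x)\<^sup>2) * (T - 0)) {0..T}"
    using has_integral_const_real[of "smooth_K * (norm x)\<^sup>2" 0 T] T
    by (intro has_integral_add has_integral_mult_right hF) (simp add: mult.commute)
  have "integral {0..T} (\<lambda>t. (norm (v t))\<^sup>2) \<le> (- 1 / (2 * \<beta>)) * (F T - F 0) + (smooth_K * (norm x)\<^sup>2) * (T - 0)"
  proof (rule has_integral_le[OF integrable_integral[OF iv] hr])
    fix t assume t: "t \<in> {0..T}"
    then have t: "t \<ge> 0" by simp
    have "(norm (v t))\<^sup>2 \<le> - inner (Xop (Sh t x)) (Sh t y) / \<beta> + smooth_K * (norm (Sh t x))\<^sup>2"
      by (rule A_rel_energy(2)[OF A[OF t]])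
    also have "\<dots> \<le> - inner (Xop (Sh t x)) (Sh t y) / \<beta> + smooth_K * (norm x)\<^sup>2"
      using le[OF t] smooth_K_nonneg by (intro add_left_mono mult_left_mono power_mono) auto
    also have "\<dots> = (- 1 / (2 * \<beta>)) * (2 * inner (Xop (Sh t x)) (Sh t y)) + smooth_K * (norm x)\<^sup>2"
      using \<beta> by simp
    finally show "(norm (v t))\<^sup>2 \<le> \<dots>" .
  qed
  also have "(- 1 / (2 * \<beta>)) * (F T - F 0) \<le> L / \<beta> * (norm x)\<^sup>2"
  proof -
    have "F 0 - F T \<le> 2 * (L * (norm x)\<^sup>2)" using F[of 0] F[of T] T by (simp add: abs_le_iff)
    then have "(F 0 - F T) / (2 * \<beta>) \<le> (2 * (L * (norm x)\<^sup>2)) / (2 * \<beta>)"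
      using \<beta> by (intro divide_right_mono) auto
    then show ?thesis by (simp add: diff_divide_distrib)
  qed
  finally show "integral {0..T} (\<lambda>t. (norm (v t))\<^sup>2) \<le> smooth_C T * (norm x)\<^sup>2"
    by (simp add: smooth_C_def algebra_simps)
qed

text \<open>The energy integrals are quadratic in the initial value, so approximations within 4^-n
  give differences of order 16^-n, the rate that \<open>fast_Cauchy_AE\<close> asks for. The same
  sequences are used for the boundary values, for Bochner regularity and for the trace at 0.\<close>

lemma trajectory_regularity:
  assumes w0: "proj L w0 = w0" and T: "T > 0"
  obtains x y v c G Gc where
    "\<And>n. gen (x n) (y n)" "\<And>n. proj L (x n) = x n" "x \<longlonglongrightarrow> w0"
    "\<And>n t. t \<ge> 0 \<Longrightarrow> Arel (Sh t (x n)) (Sh t (y n)) (v n t) (c n t)"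
    "\<And>n. continuous_on {0..} (v n)" "\<And>n. continuous_on {0..} (c n)"
    "integrable (ivl T) G"
    "AE t in ivl T. (\<lambda>n. v n t) \<longlonglongrightarrow> lim (\<lambda>n. v n t) \<and> (\<forall>n. (norm (v n t - lim (\<lambda>n. v n t)))\<^sup>2 \<le> G t / 4 ^ n)"
    "integrable (ivl T) Gc"
    "AE t in ivl T. (\<lambda>n. c n t) \<longlonglongrightarrow> lim (\<lambda>n. c n t) \<and> (\<forall>n. (norm (c n t - lim (\<lambda>n. c n t)))\<^sup>2 \<le> Gc t / 4 ^ n)"
proof -
  have "\<exists>x y. gen x y \<and> proj L x = x \<and> norm (x - w0) < 1 / 4 ^ n" for n
    using gen_dense_proj[OF _ w0, of "1 / 4 ^ n"] by (metis zero_less_divide_1_iff zero_less_numeral zero_less_power)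
  then obtain x y where g: "\<And>n. gen (x n) (y n)" and p: "\<And>n. proj L (x n) = x n" and n: "\<And>n. norm (x n - w0) < 1 / 4 ^ n"
    by metis
  have "\<forall>n t. \<exists>v c. t \<ge> 0 \<longrightarrow> Arel (Sh t (x n)) (Sh t (y n)) v c"
    using Sh_gen_A_rel[OF g p] by blast
  then obtain v c where A: "\<And>n t. t \<ge> 0 \<Longrightarrow> Arel (Sh t (x n)) (Sh t (y n)) (v n t) (c n t)"
    by metis
  have lim: "x \<longlonglongrightarrow> w0"
  proof (rule LIM_zero_cancel, rule Lim_null_comparison)
    show "\<forall>\<^sub>F k in sequentially. norm (x k - w0) \<le> (1 / 4) ^ k"
      using n by (auto simp: power_one_over intro!: always_eventually less_imp_le)
    show "(\<lambda>k. (1 / 4 :: real) ^ k) \<longlonglongrightarrow> 0" by (rule LIMSEQ_power_zero) simp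
  qed
  define d where "d n = x (Suc n) - x n" for n
  have dn: "(norm (d n))\<^sup>2 \<le> 4 / 16 ^ n" for n
  proof -
    have "norm (d n) \<le> norm (x (Suc n) - w0) + norm (x n - w0)"
      using norm_triangle_ineq4[of "x (Suc n) - w0" "x n - w0"] by (simp add: d_def)
    also have "\<dots> \<le> 1 / 4 ^ Suc n + 1 / 4 ^ n" using n[of n] n[of "Suc n"] by simp
    also have "\<dots> \<le> 2 / 4 ^ n" by (simp add: field_simps)
    finally have "(norm (d n))\<^sup>2 \<le> (2 / 4 ^ n)\<^sup>2" by (intro power_mono) auto
    also have "\<dots> = 4 / 16 ^ n"
      by (simp add: power_divide power2_eq_square flip: power_mult_distrib)
    finally show ?thesis .
  qed
  have gd: "gen (d n) (y (Suc n) - y n)" and pd: "proj L (d n) = d n" for n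
    unfolding d_def by (rule gen_diff[OF g g]) (simp add: proj_diff p)
  have Ad: "Arel (Sh t (d n)) (Sh t (y (Suc n) - y n)) (v (Suc n) t - v n t) (c (Suc n) t - c n t)" if "t \<ge> 0" for n t
    unfolding d_def S_diff[OF that] by (intro A_rel_diff A that)
  note E = energy_integrals[OF gd pd T Ad]
  have cd: "continuous_on {0..T} (\<lambda>t. (norm (v (Suc n) t - v n t))\<^sup>2)" "continuous_on {0..T} (\<lambda>t. (norm (c (Suc n) t - c n t))\<^sup>2)" for n
    by (intro continuous_intros continuous_on_subset[OF E(1)] continuous_on_subset[OF E(2)]; simp)+
  have C0: "smooth_C T \<ge> 0" using L \<beta> T smooth_K_nonneg by (simp add: smooth_C_def)
  obtain G where G: "integrable (ivl T) G" "AE t in ivl T. (\<lambda>n. v n t) \<longlonglongrightarrow> lim (\<lambda>n. v n t) \<and> (\<forall>n. (norm (v n t - lim (\<lambda>n. v n t)))\<^sup>2 \<le> G t / 4 ^ n)"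
  proof (rule fast_Cauchy_AE[of "ivl T" v "4 * smooth_C T"])
    show "integrable (ivl T) (\<lambda>t. (norm (v (Suc n) t - v n t))\<^sup>2)" for n
      by (rule integral_ivl_continuous[OF cd(1)])
    show "(\<integral>t. (norm (v (Suc n) t - v n t))\<^sup>2 \<partial>ivl T) \<le> 4 * smooth_C T / 16 ^ n" for n
      unfolding integral_ivl_continuous(2)[OF cd(1)]
      using order_trans[OF E(3) mult_left_mono[OF dn C0]] by (simp add: mult.commute)
  qed
  obtain Gc where Gc: "integrable (ivl T) Gc" "AE t in ivl T. (\<lambda>n. c n t) \<longlonglongrightarrow> lim (\<lambda>n. c n t) \<and> (\<forall>n. (norm (c n t - lim (\<lambda>n. c n t)))\<^sup>2 \<le> Gc t / 4 ^ n)"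
  proof (rule fast_Cauchy_AE[of "ivl T" c "4 / \<beta>"])
    show "integrable (ivl T) (\<lambda>t. (norm (c (Suc n) t - c n t))\<^sup>2)" for n
      by (rule integral_ivl_continuous[OF cd(2)])
    have b: "1 / \<beta> \<ge> 0" using \<beta> by simp
    show "(\<integral>t. (norm (c (Suc n) t - c n t))\<^sup>2 \<partial>ivl T) \<le> 4 / \<beta> / 16 ^ n" for n
      unfolding integral_ivl_continuous(2)[OF cd(2)]
      using order_trans[OF E(4) mult_left_mono[OF dn b]] by (simp add: mult.commute)
  qed
  show ?thesis
    by (rule that[OF g p lim A _ _ G Gc])
       (use energy_integrals(1,2)[OF g p T A] in auto)
qed

end

section \<open>The closed loop\<close>

lemma L2_ivl_cong:
  assumes "f \<in> L2 (ivl L)" "\<And>x. x \<in> {0<..<L} \<Longrightarrow> f x = g x"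
  shows "g \<in> L2 (ivl L)"
proof -
  have "g \<in> borel_measurable (ivl L) \<longleftrightarrow> f \<in> borel_measurable (ivl L)"
    by (rule measurable_cong) (use assms in simp)
  then show ?thesis
    using L2_bound[OF assms(1), of g 1] assms L2_measurable by auto
qed

lemma ac_derivative_cong:
  assumes "ac L F f" "\<And>x. x \<in> {0<..<L} \<Longrightarrow> f x = g x"
  shows "ac L F g"
proof (rule acI)
  show "g \<in> L2 (ivl L)" using L2_ivl_cong[OF ac_L2[OF assms(1)]] assms(2) by blast
  fix x assume x: "x \<in> {0..L}"
  have "(\<integral>y. indicator {..x} y * g y \<partial>ivl L) = (\<integral>y. indicator {..x} y * f y \<partial>ivl L)"
    using assms(2) by (intro Bochner_Integration.integral_cong) auto
  then show "F x = F 0 + (\<integral>y. indicator {..x} y * g y \<partial>ivl L)"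
    using ac_eq[OF assms(1) x] by (simp only:)
qed

text \<open>Kernel of integration from 0: \<open>kop L prim\<close> recovers a function that
  vanishes at 0 from its derivative.\<close>

definition prim :: "real \<Rightarrow> real \<Rightarrow> complex" where
  "prim s t = indicator {..s} t"

lemma kernel_prim: "kernel_on L 1 prim"
  unfolding kernel_on_def
proof (intro conjI ballI)
  note [measurable] = ivl_ident_measurable[of L]
  have "(\<lambda>(s, t). if t \<le> s then 1 else 0 :: complex) \<in> borel_measurable (ivl L \<Otimes>\<^sub>M ivl L)"
    by measurable
  also have "(\<lambda>(s, t). if t \<le> s then 1 else 0 :: complex) = (\<lambda>(s, t). prim s t)"
    by (auto simp: prim_def fun_eq_iff)
  finally show "(\<lambda>(s, t). prim s t) \<in> borel_measurable (ivl L \<Otimes>\<^sub>M ivl L)" .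
qed (auto simp: prim_def indicator_def)

section \<open>The Volterra operator of the kernel and its inverse\<close>

locale closed_loop = kdv_semigroup +
  fixes k :: "real \<Rightarrow> real \<Rightarrow> complex" and K :: "nat \<Rightarrow> nat \<Rightarrow> real \<Rightarrow> real \<Rightarrow> complex"
  assumes jet: "smooth_jet (\<Delta> L) K k" and k_diag: "\<And>x. x \<in> {0..L} \<Longrightarrow> k x x = 0"
begin

lemma K_continuous: "continuous_on (closed_triangle L) (\<lambda>(x, y). K a b x y)"
  using jet triangle_subset_closure[OF L] unfolding smooth_jet_def by (meson continuous_on_subset)

lemma K_derivative: "(x, y) \<in> \<Delta> L \<Longrightarrow> ((\<lambda>\<xi>. K a b \<xi> y) has_vector_derivative K (Suc a) b x y) (at x)"
  using jet unfolding smooth_jet_def by blast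

lemma K_eq_k: "0 \<le> x \<Longrightarrow> x \<le> y \<Longrightarrow> y \<le> L \<Longrightarrow> K 0 0 x y = k x y"
  using jet triangle_subset_closure[OF L] unfolding smooth_jet_def closed_triangle_def by blast

lemma K_diag: "x \<in> {0..L} \<Longrightarrow> K 0 0 x x = 0"
  using K_eq_k[of x x] k_diag by simp

text \<open>The Volterra operator whose kernel is the a-th x-derivative of k. \<open>V 0\<close> is
  \<Upsilon> on classes, and \<open>V 1\<close> is its derivative because k vanishes on the
  diagonal.\<close>

definition "V a = kop L (upper (K a 0))"

lemma kernel_K: "\<exists>C. kernel_on L C (upper (K a 0))"
  by (rule upper_kernel[OF K_continuous])

lemma bounded_linear_V: "bounded_linear (V a)"
  unfolding V_def using kernel_K[of a] bounded_linear_kop by blast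

lemma V_emb: "f \<in> L2 (ivl L) \<Longrightarrow> V a (emb L f) = emb L (\<lambda>s. \<integral>t. upper (K a 0) s t * f t \<partial>ivl L)"
  unfolding V_def using kernel_K[of a] kop_emb by blast

lemma V_integral_L2: "f \<in> L2 (ivl L) \<Longrightarrow> (\<lambda>s. \<integral>t. upper (K a 0) s t * f t \<partial>ivl L) \<in> L2 (ivl L)"
  using kernel_K[of a] kernel_integral_L2 by blast

lemma V_ac:
  "f \<in> L2 (ivl L) \<Longrightarrow> ac L (\<lambda>x. \<integral>t. upper (K a 0) x t * f t \<partial>ivl L)
     (\<lambda>x. (\<integral>t. upper (K (Suc a) 0) x t * f t \<partial>ivl L) - K a 0 x x * f x)"
  by (rule upper_ac[OF L K_continuous K_continuous K_derivative])

lemma upper_endpoints: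
  "(\<integral>t. upper d L t * f t \<partial>ivl L) = 0"
  "(\<integral>t. upper d 0 t * f t \<partial>ivl L) = (\<integral>t. d 0 t * f t \<partial>ivl L)"
proof -
  have "(\<integral>t. upper d L t * f t \<partial>ivl L) = (\<integral>t. 0 \<partial>ivl L)"
    by (intro Bochner_Integration.integral_cong) (auto simp: upper_def)
  then show "(\<integral>t. upper d L t * f t \<partial>ivl L) = 0" by simp
  show "(\<integral>t. upper d 0 t * f t \<partial>ivl L) = (\<integral>t. d 0 t * f t \<partial>ivl L)"
    by (intro Bochner_Integration.integral_cong) (auto simp: upper_def)
qed

lemma Upsilon_eq: "x \<in> {0..L} \<Longrightarrow> Upsilon L k f x = (\<integral>t. upper (K 0 0) x t * f t \<partial>ivl L)"
  unfolding Upsilon_def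
  by (subst integral_upper_eq) (auto intro!: Bochner_Integration.integral_cong simp: upper_def K_eq_k)

lemma Upsilon_L2: "f \<in> L2 (ivl L) \<Longrightarrow> Upsilon L k f \<in> L2 (ivl L)"
  by (rule L2_ivl_cong[OF V_integral_L2[of f 0]]) (simp_all add: Upsilon_eq)

lemma I_minus_Upsilon_L2: "f \<in> L2 (ivl L) \<Longrightarrow> I_minus_Upsilon L k f \<in> L2 (ivl L)"
  unfolding I_minus_Upsilon_def by (intro L2_diff Upsilon_L2)

lemma emb_I_minus_Upsilon:
  assumes "f \<in> L2 (ivl L)"
  shows "emb L (I_minus_Upsilon L k f) = emb L f - V 0 (emb L f)"
proof -
  have "emb L (Upsilon L k f) = V 0 (emb L f)"
    unfolding V_emb[OF assms] by (rule emb_cong) (simp add: Upsilon_eq)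
  then show ?thesis
    unfolding I_minus_Upsilon_def using assms by (simp add: emb_diff Upsilon_L2)
qed

text \<open>The inverse of I - \<Upsilon> on classes. Composing with \<open>proj L\<close> makes it
  a bounded linear map of the whole type.\<close>

definition "Rop g = (SOME \<phi>. proj L \<phi> = \<phi> \<and> \<phi> - V 0 \<phi> = proj L g)"

lemma V_inverse:
  obtains B where "\<And>\<phi>. proj L \<phi> = \<phi> \<Longrightarrow> norm \<phi> \<le> B * norm (\<phi> - V 0 \<phi>)"
    "\<And>g. proj L g = g \<Longrightarrow> \<exists>\<phi>. proj L \<phi> = \<phi> \<and> \<phi> - V 0 \<phi> = g"
proof -
  obtain C where "kernel_on L C (upper (K 0 0))" using kernel_K by blast
  from triangular_kernel_inverse[OF this _ L] show ?thesis
    using that unfolding V_def by (auto simp: upper_def)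
qed

lemma Rop_spec: "proj L (Rop g) = Rop g" "Rop g - V 0 (Rop g) = proj L g"
proof -
  have "\<exists>\<phi>. proj L \<phi> = \<phi> \<and> \<phi> - V 0 \<phi> = proj L g"
    using V_inverse proj_proj by metis
  from someI_ex[OF this] show "proj L (Rop g) = Rop g" "Rop g - V 0 (Rop g) = proj L g"
    unfolding Rop_def by blast+
qed

lemma V_diff: "V a (x - y) = V a x - V a y"
  by (rule linear_diff[OF bounded_linear.linear[OF bounded_linear_V]])

lemma V_add: "V a (x + y) = V a x + V a y"
  by (rule linear_add[OF bounded_linear.linear[OF bounded_linear_V]])

lemma V_scaleR: "V a (c *\<^sub>R x) = c *\<^sub>R V a x"
  by (rule linear_scale[OF bounded_linear.linear[OF bounded_linear_V]])

lemma Rop_unique: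
  assumes "proj L \<phi> = \<phi>" "\<phi> - V 0 \<phi> = proj L g"
  shows "\<phi> = Rop g"
proof -
  obtain B where B: "\<And>\<phi>. proj L \<phi> = \<phi> \<Longrightarrow> norm \<phi> \<le> B * norm (\<phi> - V 0 \<phi>)"
    using V_inverse by metis
  have "(\<phi> - Rop g) - V 0 (\<phi> - Rop g) = (\<phi> - V 0 \<phi>) - (Rop g - V 0 (Rop g))"
    by (simp add: V_diff)
  then have "norm (\<phi> - Rop g) \<le> B * norm (0 :: l2)"
    using B[of "\<phi> - Rop g"] assms Rop_spec[of g] by (simp add: proj_diff)
  then show ?thesis by simp
qed

lemma bounded_linear_Rop: "bounded_linear Rop"
proof -
  obtain B where B: "\<And>\<phi>. proj L \<phi> = \<phi> \<Longrightarrow> norm \<phi> \<le> B * norm (\<phi> - V 0 \<phi>)"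
    using V_inverse by metis
  show ?thesis
  proof (rule bounded_linear_intro)
    fix x y :: l2 and c :: real
    have "(Rop x + Rop y) - V 0 (Rop x + Rop y) = (Rop x - V 0 (Rop x)) + (Rop y - V 0 (Rop y))"
      by (simp add: V_add)
    then show "Rop (x + y) = Rop x + Rop y"
      by (intro Rop_unique[symmetric]) (simp_all add: proj_add Rop_spec)
    have "(c *\<^sub>R Rop x) - V 0 (c *\<^sub>R Rop x) = c *\<^sub>R (Rop x - V 0 (Rop x))"
      by (simp add: V_scaleR scaleR_diff_right)
    then show "Rop (c *\<^sub>R x) = c *\<^sub>R Rop x"
      by (intro Rop_unique[symmetric]) (simp_all add: proj_scaleR Rop_spec)
    have "norm (Rop x) \<le> B * norm (proj L x)"
      using B[OF Rop_spec(1)] by (simp add: Rop_spec)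
    also have "\<dots> \<le> \<bar>B\<bar> * norm x" by (intro mult_mono norm_proj_le) auto
    finally show "norm (Rop x) \<le> norm x * \<bar>B\<bar>" by (simp add: mult.commute)
  qed
qed

lemma Rop_emb_I_minus_Upsilon:
  "f \<in> L2 (ivl L) \<Longrightarrow> Rop (emb L (I_minus_Upsilon L k f)) = emb L f"
  by (rule Rop_unique[symmetric]) (simp_all add: proj_emb I_minus_Upsilon_L2 emb_I_minus_Upsilon[symmetric])

abbreviation "opn \<equiv> L2_opnorm (ivl L) (L2_inverse (ivl L) (I_minus_Upsilon L k))"

text \<open>\<open>L2_inverse\<close> picks some function, but every admissible choice has the class
  \<open>Rop (emb L g)\<close>, so its norm is determined.\<close>

lemma norm_L2_inverse:
  assumes g: "g \<in> L2 (ivl L)"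
  shows "L2_norm (ivl L) (L2_inverse (ivl L) (I_minus_Upsilon L k) g) = norm (Rop (emb L g))"
proof -
  let ?f = "L2_inverse (ivl L) (I_minus_Upsilon L k) g"
  have "\<exists>f. f \<in> L2 (ivl L) \<and> (AE x in ivl L. I_minus_Upsilon L k f x = g x)"
  proof (intro exI[of _ "rep_l2 (Rop (emb L g))"] conjI rep_l2_ivl)
    have r: "emb L (rep_l2 (Rop (emb L g))) = Rop (emb L g)"
      using Rop_spec(1) by (simp add: proj_def)
    have "emb L (I_minus_Upsilon L k (rep_l2 (Rop (emb L g)))) = emb L g"
      unfolding emb_I_minus_Upsilon[OF rep_l2_ivl] r Rop_spec(2) by (rule proj_emb[OF g])
    then show "AE x in ivl L. I_minus_Upsilon L k (rep_l2 (Rop (emb L g))) x = g x"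
      by (subst (asm) emb_eq_iff[OF I_minus_Upsilon_L2[OF rep_l2_ivl] g])
  qed
  from someI_ex[OF this] have f: "?f \<in> L2 (ivl L)" "AE x in ivl L. I_minus_Upsilon L k ?f x = g x"
    unfolding L2_inverse_def by blast+
  have "emb L (I_minus_Upsilon L k ?f) = emb L g"
    by (rule emb_cong_AE[OF I_minus_Upsilon_L2[OF f(1)] g f(2)])
  then have "emb L ?f = Rop (emb L g)" using Rop_emb_I_minus_Upsilon[OF f(1)] by simp
  then show ?thesis using norm_emb[OF f(1)] by simp
qed

text \<open>The supremum over the unit ball is compared with the bounded map \<open>Rop\<close>;
  homogeneity then extends the estimate from the ball to all g.\<close>

lemma opnorm_bound:
  shows "0 \<le> opn" and "proj L g = g \<Longrightarrow> norm (Rop g) \<le> opn * norm g"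
proof -
  obtain B where B: "\<And>x. norm (Rop x) \<le> norm x * B" "B > 0"
    using bounded_linear.pos_bounded[OF bounded_linear_Rop] by blast
  define A where "A = {L2_norm (ivl L) (L2_inverse (ivl L) (I_minus_Upsilon L k) f) |f. f \<in> L2 (ivl L) \<and> L2_norm (ivl L) f \<le> 1}"
  have opn: "opn = Sup A" by (simp add: L2_opnorm_def A_def)
  have inA: "norm (Rop g) \<in> A" if "proj L g = g" "norm g \<le> 1" for g
  proof -
    have "g = emb L (rep_l2 g)" using that by (simp add: proj_def)
    then show ?thesis
      using norm_L2_inverse[OF rep_l2_ivl, of g] norm_emb[OF rep_l2_ivl[of g L]] that(2)
      unfolding A_def by (metis (mono_tags, lifting) mem_Collect_eq rep_l2_ivl)
  qed
  \<comment> \<open>A real supremum is informative only for a set bounded above, and this is where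
    the boundedness of the inverse is used.\<close>
  have bdd: "bdd_above A"
  proof (rule bdd_aboveI)
    fix a assume "a \<in> A"
    then obtain f where f: "f \<in> L2 (ivl L)" "L2_norm (ivl L) f \<le> 1" "a = norm (Rop (emb L f))"
      unfolding A_def using norm_L2_inverse by auto
    have "a \<le> norm (emb L f) * B" unfolding f(3) by (rule B(1))
    also have "\<dots> \<le> 1 * B" using f B(2) by (intro mult_right_mono) (auto simp: norm_emb)
    finally show "a \<le> 1 * B" .
  qed
  have "0 \<in> A" using inA[of 0] linear_0[OF bounded_linear.linear[OF bounded_linear_Rop]]
      linear_0[OF bounded_linear.linear[OF bounded_linear_proj]] by simp
  then show 0: "0 \<le> opn" unfolding opn by (rule cSup_upper[OF _ bdd])
  assume g: "proj L g = g"
  show "norm (Rop g) \<le> opn * norm g"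
  proof (cases "g = 0")
    case True
    then show ?thesis using linear_0[OF bounded_linear.linear[OF bounded_linear_Rop]] by simp
  next
    case False
    have "norm (Rop (inverse (norm g) *\<^sub>R g)) \<in> A"
      using g False by (intro inA) (simp_all add: proj_scaleR)
    then have "norm (Rop (inverse (norm g) *\<^sub>R g)) \<le> opn"
      unfolding opn by (rule cSup_upper[OF _ bdd])
    then have "norm (Rop g) / norm g \<le> opn"
      using linear_scale[OF bounded_linear.linear[OF bounded_linear_Rop], of "inverse (norm g)" g]
      by (simp add: divide_inverse mult.commute)
    then show ?thesis using False by (simp add: field_simps)
  qed
qed

text \<open>The triangle inequality and the Hilbert-Schmidt bound produce the second factor of the
  decay constant.\<close>

lemma norm_I_minus_Upsilon:
  assumes "f \<in> L2 (ivl L)"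
  shows "norm (emb L (I_minus_Upsilon L k f)) \<le> (1 + L2_norm (lebesgue_on (\<Delta> L)) (\<lambda>(x, y). k x y)) * L2_norm (ivl L) f"
proof -
  obtain C where C: "kernel_on L C (upper (K 0 0))" using kernel_K by blast
  have "L2_norm (lebesgue_on (\<Delta> L)) (\<lambda>(x, y). K 0 0 x y) = L2_norm (lebesgue_on (\<Delta> L)) (\<lambda>(x, y). k x y)"
    unfolding L2_norm_def
    by (intro arg_cong[where f = sqrt] Bochner_Integration.integral_cong) (auto simp: \<Delta>_def K_eq_k)
  then have hs: "sqrt (hs_norm_sq L (upper (K 0 0))) = L2_norm (lebesgue_on (\<Delta> L)) (\<lambda>(x, y). k x y)"
    using hs_norm_upper[OF L K_continuous, of 0 0] by simp
  have "norm (emb L (I_minus_Upsilon L k f)) \<le> norm (emb L f) + norm (V 0 (emb L f))"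
    unfolding emb_I_minus_Upsilon[OF assms] by (rule norm_triangle_ineq4)
  also have "\<dots> \<le> norm (emb L f) + sqrt (hs_norm_sq L (upper (K 0 0))) * norm (emb L f)"
    unfolding V_def by (intro add_left_mono norm_kop_le[OF C])
  finally show ?thesis unfolding hs by (simp add: norm_emb assms algebra_simps)
qed

abbreviation "Jop \<equiv> kop L prim"

section \<open>Transfer of derivatives and traces from w to u\<close>

text \<open>Here v plays the role of w_x. At 0 the primitive of v vanishes and the Volterra term is
  the feedback integral; at L the Volterra term vanishes and the mean of v remains. As v is
  arbitrary, the formula for the norm applies to differences of trajectories as well.\<close>

lemma lift_H1:
  assumes f: "f \<in> L2 (ivl L)" and eq: "emb L f = Jop v + V 0 (emb L f)" and v: "proj L v = v"
  shows "\<exists>D. sobolev_rep L 1 D f \<and> D 0 0 = (\<integral>y. k 0 y * f y \<partial>ivl L) \<and> D 0 L = pair_l2 v (emb L (\<lambda>x. 1))"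
    and "f \<in> sobolev L 1"
    and "sobolev_norm L 1 f = norm (emb L f, v + V 1 (emb L f))"
proof -
  \<comment> \<open>The right-hand side of u = w + \<Upsilon>u evaluated at every point, which
    selects the continuous representative of f.\<close>
  define D0 where "D0 x = (\<integral>t. indicator {..x} t * rep_l2 v t \<partial>ivl L) + (\<integral>t. upper (K 0 0) x t * f t \<partial>ivl L)" for x
  define D1 where "D1 x = rep_l2 v x + (\<integral>t. upper (K 1 0) x t * f t \<partial>ivl L)" for x
  have z: "(\<integral>t. indicator {..0} t * rep_l2 v t \<partial>ivl L) = 0"
  proof -
    have "(\<integral>t. indicator {..0} t * rep_l2 v t \<partial>ivl L) = (\<integral>t. 0 \<partial>ivl L)"
      by (intro Bochner_Integration.integral_cong) auto
    then show ?thesis by simp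
  qed
  have a1: "ac L (\<lambda>x. \<integral>t. indicator {..x} t * rep_l2 v t \<partial>ivl L) (rep_l2 v)"
    by (rule acI) (simp_all add: z)
  have a2: "ac L (\<lambda>x. \<integral>t. upper (K 0 0) x t * f t \<partial>ivl L) (\<lambda>x. \<integral>t. upper (K 1 0) x t * f t \<partial>ivl L)"
    by (rule ac_derivative_cong[OF V_ac[OF f, of 0]]) (simp add: K_diag)
  have a: "ac L D0 D1" unfolding D0_def[abs_def] D1_def[abs_def] by (rule ac_add[OF a1 a2])
  have D0L: "D0 \<in> L2 (ivl L)" by (rule continuous_L2_ivl[OF ac_continuous[OF a]])
  have e0: "emb L D0 = emb L f"
  proof -
    have "emb L D0 = emb L (\<lambda>x. \<integral>t. indicator {..x} t * rep_l2 v t \<partial>ivl L) + emb L (\<lambda>x. \<integral>t. upper (K 0 0) x t * f t \<partial>ivl L)"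
      unfolding D0_def[abs_def] by (intro emb_add continuous_L2_ivl ac_continuous[OF a1] ac_continuous[OF a2])
    also have "\<dots> = Jop v + V 0 (emb L f)"
      unfolding V_emb[OF f] kop_def prim_def ..
    finally show ?thesis using eq by simp
  qed
  have e1: "emb L D1 = v + V 1 (emb L f)"
    unfolding D1_def[abs_def] V_emb[OF f]
    by (subst emb_add[OF rep_l2_ivl V_integral_L2[OF f, of 1]]) (simp add: proj_def[symmetric] v)
  define D where "D j = (if j = 0 then D0 else D1)" for j :: nat
  have D: "sobolev_rep L 1 D f"
    unfolding sobolev_rep_def
  proof (intro conjI allI impI ballI)
    show "D j \<in> L2 (ivl L)" for j unfolding D_def using D0L ac_L2[OF a] by simp
    show "D j x = D j 0 + (\<integral>y. D (Suc j) y \<partial>lebesgue_on {0..x})" if "j < 1" "x \<in> {0..L}" for j x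
    proof -
      have "D0 x = D0 0 + (\<integral>y. D1 y \<partial>lebesgue_on {0..x})"
        using a that(2) unfolding ac_def by blast
      moreover have "j = 0" using that(1) by simp
      ultimately show ?thesis by (simp only: D_def) simp
    qed
    show "AE x in ivl L. f x = D 0 x"
      using e0 f D0L by (simp add: emb_eq_iff[symmetric] D_def)
  qed
  have k0: "(\<integral>t. K 0 0 0 t * f t \<partial>ivl L) = (\<integral>t. k 0 t * f t \<partial>ivl L)"
    by (intro Bochner_Integration.integral_cong) (auto simp: K_eq_k)
  have "D 0 0 = (\<integral>y. k 0 y * f y \<partial>ivl L)"
    by (simp add: D_def D0_def z upper_endpoints k0)
  moreover have "D 0 L = pair_l2 v (emb L (\<lambda>x. 1))"
  proof -
    have "pair_l2 v (emb L (\<lambda>x. 1)) = (\<integral>t. rep_l2 v t * 1 \<partial>ivl L)"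
      by (subst proj_eq_emb[OF v], rule pair_emb) (auto intro: L2_ivl_bounded[of _ L 1])
    also have "\<dots> = (\<integral>t. indicator {..L} t * rep_l2 v t \<partial>ivl L)"
      by (intro Bochner_Integration.integral_cong) auto
    finally show ?thesis by (simp add: D_def D0_def upper_endpoints)
  qed
  ultimately show "\<exists>D. sobolev_rep L 1 D f \<and> D 0 0 = (\<integral>y. k 0 y * f y \<partial>ivl L) \<and> D 0 L = pair_l2 v (emb L (\<lambda>x. 1))"
    using D by blast
  show "f \<in> sobolev L 1" using D by (auto simp: sobolev_def)
  show "sobolev_norm L 1 f = norm (emb L f, v + V 1 (emb L f))"
    unfolding sobolev_norm_1[OF D] by (simp add: D_def e0 e1)
qed

end

section \<open>The closed-loop state: existence, uniqueness and decay\<close>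

context closed_loop
begin

text \<open>Parametrised by the initial class w0 of the target problem and not by u0, so that the
  approximating values in the domain can be inserted too.\<close>

definition "state r w0 t = Rop (exp (- r * t) *\<^sub>R Sh t w0)"

lemma proj_state [simp]: "proj L (state r w0 t) = state r w0 t"
  unfolding state_def by (rule Rop_spec)

lemma emb_rep_state: "emb L (rep_l2 (state r w0 t)) = state r w0 t"
  using proj_state by (simp add: proj_def)

lemma state_equation:
  assumes "proj L w0 = w0" "t \<ge> 0"
  shows "state r w0 t - V 0 (state r w0 t) = exp (- r * t) *\<^sub>R Sh t w0"
  unfolding state_def Rop_spec using assms by (simp add: proj_scaleR proj_Sh_eq)

lemma emb_S:
  assumes f: "f \<in> L2 (ivl L)" and t: "t \<ge> 0"
  shows "emb L (\<lambda>x. complex_of_real (exp (- r * t)) * S t f x) = exp (- r * t) *\<^sub>R Sh t (emb L f)"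
  using assms by (simp add: emb_scaleR S_L2 Sh_eq_Tsg proj_emb Tsg_emb)

lemma state_is_mild_solution:
  assumes u0: "u0 \<in> L2 (ivl L)"
  shows "closed_loop_mild_solution L r S k u0 {0..} (\<lambda>t. rep_l2 (state r (emb L (I_minus_Upsilon L k u0)) t))"
  unfolding closed_loop_mild_solution_def target_mild_solution_def
proof (intro conjI ballI rep_l2_ivl I_minus_Upsilon_L2)
  fix t :: real assume "t \<in> {0..}"
  then have t: "t \<ge> 0" by simp
  note w = I_minus_Upsilon_L2[OF u0]
  have "emb L (I_minus_Upsilon L k (rep_l2 (state r (emb L (I_minus_Upsilon L k u0)) t)))
      = emb L (\<lambda>x. complex_of_real (exp (- r * t)) * S t (I_minus_Upsilon L k u0) x)"
    unfolding emb_I_minus_Upsilon[OF rep_l2_ivl] emb_rep_state emb_S[OF w t]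
    by (rule state_equation[OF proj_emb[OF w] t])
  then show "AE x in ivl L. I_minus_Upsilon L k (rep_l2 (state r (emb L (I_minus_Upsilon L k u0)) t)) x
      = complex_of_real (exp (- r * t)) * S t (I_minus_Upsilon L k u0) x"
    by (subst (asm) emb_eq_iff) (intro I_minus_Upsilon_L2 rep_l2_ivl L2_cmult S_L2 t u0)+
qed

text \<open>Uniqueness holds time by time: at each t the class of (I - \<Upsilon>) v(t) is
  prescribed, and I - \<Upsilon> is injective.\<close>

lemma mild_solution_unique:
  assumes u0: "u0 \<in> L2 (ivl L)" and v: "closed_loop_mild_solution L r S k u0 I v" and t: "t \<in> I" "t \<ge> 0"
  shows "AE x in ivl L. v t x = rep_l2 (state r (emb L (I_minus_Upsilon L k u0)) t) x"
proof -
  note w = I_minus_Upsilon_L2[OF u0]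
  have vL: "v t \<in> L2 (ivl L)"
    and ae: "AE x in ivl L. I_minus_Upsilon L k (v t) x = complex_of_real (exp (- r * t)) * S t (I_minus_Upsilon L k u0) x"
    using v t unfolding closed_loop_mild_solution_def target_mild_solution_def by auto
  have "emb L (I_minus_Upsilon L k (v t)) = exp (- r * t) *\<^sub>R Sh t (emb L (I_minus_Upsilon L k u0))"
    unfolding emb_S[OF w t(2), symmetric]
    by (intro emb_cong_AE ae I_minus_Upsilon_L2 vL L2_cmult S_L2 t u0)
  then have "emb L (v t) = state r (emb L (I_minus_Upsilon L k u0)) t"
    unfolding state_def using Rop_emb_I_minus_Upsilon[OF vL] by simp
  then have "emb L (v t) = emb L (rep_l2 (state r (emb L (I_minus_Upsilon L k u0)) t))"
    by (simp add: emb_rep_state)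
  then show ?thesis by (simp add: emb_eq_iff vL)
qed

lemma state_continuous: "continuous_on {0..} (state r w0)"
  unfolding state_def[abs_def]
  by (intro bounded_linear.continuous_on[OF bounded_linear_Rop] continuous_intros continuous_on_S)

lemma state_cont_L2: "cont_L2 L T (\<lambda>t. rep_l2 (state r w0 t))"
  unfolding cont_L2_def
proof (intro ballI conjI rep_l2_ivl)
  fix t assume t: "t \<in> {0..T}"
  have "L2_norm (ivl L) (\<lambda>x. rep_l2 (state r w0 s) x - rep_l2 (state r w0 t) x) = norm (state r w0 s - state r w0 t)" for s
    by (subst norm_emb[symmetric]) (simp_all add: L2_diff emb_diff emb_rep_state)
  moreover have "((\<lambda>s. norm (state r w0 s - state r w0 t)) \<longlongrightarrow> norm (state r w0 t - state r w0 t)) (at t within {0..T})"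
    using continuous_on_subset[OF state_continuous, of "{0..T}" r w0] t
    by (intro tendsto_intros) (auto simp: continuous_on_def)
  ultimately show "((\<lambda>s. L2_norm (ivl L) (\<lambda>x. rep_l2 (state r w0 s) x - rep_l2 (state r w0 t) x)) \<longlongrightarrow> 0) (at t within {0..T})"
    by simp
qed

lemma state_decay:
  assumes u0: "u0 \<in> L2 (ivl L)" and t: "t \<ge> 0"
  shows "L2_norm (ivl L) (rep_l2 (state r (emb L (I_minus_Upsilon L k u0)) t))
     \<le> decay_constant L k * L2_norm (ivl L) u0 * exp (- r * t)"
proof -
  define w0 where "w0 = emb L (I_minus_Upsilon L k u0)"
  have w0: "proj L w0 = w0" unfolding w0_def by (intro proj_emb I_minus_Upsilon_L2 u0)
  have "L2_norm (ivl L) (rep_l2 (state r w0 t)) = norm (state r w0 t)"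
    using norm_emb[OF rep_l2_ivl] emb_rep_state by metis
  also have "\<dots> \<le> opn * norm (exp (- r * t) *\<^sub>R Sh t w0)"
    unfolding state_def by (rule opnorm_bound(2)) (simp add: proj_scaleR proj_Sh_eq t w0)
  also have "\<dots> = opn * (exp (- r * t) * norm (Sh t w0))" by simp
  also have "\<dots> \<le> opn * (exp (- r * t) * ((1 + L2_norm (lebesgue_on (\<Delta> L)) (\<lambda>(x, y). k x y)) * L2_norm (ivl L) u0))"
    using order_trans[OF contraction[OF w0 t] norm_I_minus_Upsilon[OF u0, folded w0_def]]
    by (intro mult_left_mono opnorm_bound(1)) auto
  finally show ?thesis
    unfolding w0_def decay_constant_def by (simp add: mult_ac)
qed

lemma decay_constant_nonneg: "0 \<le> decay_constant L k"
  unfolding decay_constant_def by (intro mult_nonneg_nonneg opnorm_bound(1) add_nonneg_nonneg) auto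

section \<open>Averages in time against test functions\<close>

text \<open>The bounded operators \<open>Rop\<close> and the pairing commute with the integral. The
  average of u is thus the image under \<open>Rop\<close> of an average of the semigroup, and also
  the weak integral required by \<open>time_average\<close>.\<close>

lemma state_average:
  assumes \<theta>: "continuous_on {0..T} \<theta>"
  shows "Rop (integral {0..T} (\<lambda>t. (\<theta> t * exp (- r * t)) *\<^sub>R Sh t w0)) = integral {0..T} (\<lambda>t. \<theta> t *\<^sub>R state r w0 t)"
    and "f \<in> L2 (ivl L) \<Longrightarrow> pair_l2 (integral {0..T} (\<lambda>t. \<theta> t *\<^sub>R state r w0 t)) (emb L f)
      = (\<integral>t. \<theta> t * (\<integral>x. rep_l2 (state r w0 t) x * f x \<partial>ivl L) \<partial>ivl T)"
proof -
  interpret R: bounded_linear Rop by (rule bounded_linear_Rop)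
  have c: "continuous_on {0..T} (\<lambda>t. (\<theta> t * exp (- r * t)) *\<^sub>R Sh t w0)"
    by (intro continuous_intros \<theta> continuous_on_subset[OF continuous_on_S]) auto
  have cs: "continuous_on {0..T} (\<lambda>t. \<theta> t *\<^sub>R state r w0 t)"
    by (intro continuous_intros \<theta> continuous_on_subset[OF state_continuous]) auto
  have "Rop (integral {0..T} (\<lambda>t. (\<theta> t * exp (- r * t)) *\<^sub>R Sh t w0))
      = integral {0..T} (Rop \<circ> (\<lambda>t. (\<theta> t * exp (- r * t)) *\<^sub>R Sh t w0))"
    by (rule integral_linear[symmetric, OF integrable_continuous_real[OF c] bounded_linear_Rop])
  also have "\<dots> = integral {0..T} (\<lambda>t. \<theta> t *\<^sub>R state r w0 t)"
    by (rule integral_cong) (simp add: state_def R.scaleR)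
  finally show "Rop (integral {0..T} (\<lambda>t. (\<theta> t * exp (- r * t)) *\<^sub>R Sh t w0)) = integral {0..T} (\<lambda>t. \<theta> t *\<^sub>R state r w0 t)" .
  assume f: "f \<in> L2 (ivl L)"
  interpret p: bounded_linear "\<lambda>a. pair_l2 a (emb L f)" by (rule bounded_linear_pair)
  have pr: "pair_l2 (state r w0 t) (emb L f) = (\<integral>x. rep_l2 (state r w0 t) x * f x \<partial>ivl L)" for t
    by (subst emb_rep_state[symmetric], rule pair_emb[OF rep_l2_ivl f])
  have "pair_l2 (integral {0..T} (\<lambda>t. \<theta> t *\<^sub>R state r w0 t)) (emb L f)
      = integral {0..T} ((\<lambda>a. pair_l2 a (emb L f)) \<circ> (\<lambda>t. \<theta> t *\<^sub>R state r w0 t))"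
    by (rule integral_linear[symmetric, OF integrable_continuous_real[OF cs] bounded_linear_pair])
  also have "\<dots> = integral {0..T} (\<lambda>t. \<theta> t * (\<integral>x. rep_l2 (state r w0 t) x * f x \<partial>ivl L))"
    by (rule integral_cong) (simp add: p.scaleR pr scaleR_conv_of_real)
  also have "\<dots> = (\<integral>t. \<theta> t * (\<integral>x. rep_l2 (state r w0 t) x * f x \<partial>ivl L) \<partial>ivl T)"
    unfolding pr[symmetric]
    by (intro integral_ivl_continuous(2)[symmetric] continuous_intros \<theta>
        bounded_linear.continuous_on[OF bounded_linear_pair] continuous_on_subset[OF state_continuous]) auto
  finally show "pair_l2 (integral {0..T} (\<lambda>t. \<theta> t *\<^sub>R state r w0 t)) (emb L f)
      = (\<integral>t. \<theta> t * (\<integral>x. rep_l2 (state r w0 t) x * f x \<partial>ivl L) \<partial>ivl T)" .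
qed

text \<open>The damping factor exp(-rt) is absorbed into the weight, so averages of the damped
  target solution are weighted integrals of the undamped semigroup.\<close>

lemma test_function_weight:
  assumes "test_function T \<theta>" "T > 0"
  obtains \<eta>' a b where "\<And>t. ((\<lambda>t. \<theta> t * exp (- r * t)) has_real_derivative \<eta>' t) (at t)" "continuous_on UNIV \<eta>'"
    "0 < a" "b < T" "\<And>t. t \<notin> {a..b} \<Longrightarrow> \<theta> t * exp (- r * t) = 0" "continuous_on UNIV \<theta>"
proof -
  from assms obtain a b where ab: "0 < a" "b < T" "\<And>t. t \<notin> {a..b} \<Longrightarrow> \<theta> t = 0"
    and d: "\<And>n t. (deriv ^^ n) \<theta> differentiable (at t)"
    unfolding test_function_def by blast
  have d0: "(\<theta> has_real_derivative deriv \<theta> t) (at t)" for t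
    using d[of 0 t] by (simp add: DERIV_deriv_iff_real_differentiable)
  have c1: "continuous_on UNIV (deriv \<theta>)"
    using d[of 1] by (auto intro!: differentiable_imp_continuous_on simp: differentiable_on_def)
  have c0: "continuous_on UNIV \<theta>"
    using d[of 0] by (auto intro!: differentiable_imp_continuous_on simp: differentiable_on_def)
  show ?thesis
  proof (rule that[of "\<lambda>t. deriv \<theta> t * exp (- r * t) + \<theta> t * (- r * exp (- r * t))" a b])
    show "((\<lambda>t. \<theta> t * exp (- r * t)) has_real_derivative deriv \<theta> t * exp (- r * t) + \<theta> t * (- r * exp (- r * t))) (at t)" for t
      by (auto intro!: derivative_eq_intros d0)
    show "continuous_on UNIV (\<lambda>t. deriv \<theta> t * exp (- r * t) + \<theta> t * (- r * exp (- r * t)))"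
      by (intro continuous_intros c0 c1)
  qed (use ab c0 in auto)
qed

text \<open>Differentiating the Volterra term twice brings in the diagonal value of k_x times f,
  which is square integrable. The first derivative of u at 0 is that of w plus the integral of
  k_x(0,y) U(y); at L the Volterra contribution vanishes.\<close>

lemma lift_H2:
  assumes A: "Arel W AW vW cW" and U: "U - V 0 U = W" and pU: "proj L U = U"
  shows "\<exists>D. sobolev_rep L 2 D (rep_l2 U) \<and> D 1 L = 0 \<and> D 1 0 = cW + (\<integral>y. K 1 0 0 y * rep_l2 U y \<partial>ivl L)"
proof -
  from A obtain D :: "nat \<Rightarrow> real \<Rightarrow> complex" where a0: "ac L (D 0) (D 1)" and a1: "ac L (D 1) (D 2)"
    and bc: "D 1 L = 0" and x: "W = emb L (D 0)" and c: "cW = D 1 0"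
    unfolding A_rel_def by (elim exE conjE) (rule that, assumption+)
  define f where "f = rep_l2 U"
  have f: "f \<in> L2 (ivl L)" by (simp add: f_def)
  have ef: "emb L f = U" using pU by (simp add: f_def proj_def)
  define F0 where "F0 x = D 0 x + (\<integral>t. upper (K 0 0) x t * f t \<partial>ivl L)" for x
  define F1 where "F1 x = D 1 x + (\<integral>t. upper (K 1 0) x t * f t \<partial>ivl L)" for x
  define F2 where "F2 x = D 2 x + ((\<integral>t. upper (K 2 0) x t * f t \<partial>ivl L) - K 1 0 x x * f x)" for x
  have b0: "ac L (\<lambda>x. \<integral>t. upper (K 0 0) x t * f t \<partial>ivl L) (\<lambda>x. \<integral>t. upper (K 1 0) x t * f t \<partial>ivl L)"
    by (rule ac_derivative_cong[OF V_ac[OF f, of 0]]) (simp add: K_diag)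
  have b1: "ac L (\<lambda>x. \<integral>t. upper (K 1 0) x t * f t \<partial>ivl L) (\<lambda>x. (\<integral>t. upper (K 2 0) x t * f t \<partial>ivl L) - K 1 0 x x * f x)"
    using V_ac[OF f, of 1] by (simp add: numeral_2_eq_2)
  have A0: "ac L F0 F1" unfolding F0_def[abs_def] F1_def[abs_def] by (rule ac_add[OF a0 b0])
  have A1: "ac L F1 F2" unfolding F1_def[abs_def] F2_def[abs_def] by (rule ac_add[OF a1 b1])
  have F0L: "F0 \<in> L2 (ivl L)" by (rule continuous_L2_ivl[OF ac_continuous[OF A0]])
  define E where "E j = (if j = 0 then F0 else if j = 1 then F1 else F2)" for j :: nat
  have e0: "emb L F0 = emb L f"
  proof -
    have "emb L F0 = emb L (D 0) + V 0 (emb L f)"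
      unfolding F0_def[abs_def] V_emb[OF f]
      by (intro emb_add continuous_L2_ivl ac_continuous[OF a0] ac_continuous[OF b0])
    also have "\<dots> = U" using U by (simp add: ef x[symmetric] algebra_simps)
    finally show ?thesis using ef by simp
  qed
  have "sobolev_rep L 2 E f"
    unfolding sobolev_rep_def
  proof (intro conjI allI impI ballI)
    show "E j \<in> L2 (ivl L)" for j unfolding E_def using F0L ac_L2[OF A0] ac_L2[OF A1] by simp
    show "E j x = E j 0 + (\<integral>y. E (Suc j) y \<partial>lebesgue_on {0..x})" if "j < 2" "x \<in> {0..L}" for j x
    proof -
      have "F0 x = F0 0 + (\<integral>y. F1 y \<partial>lebesgue_on {0..x})" "F1 x = F1 0 + (\<integral>y. F2 y \<partial>lebesgue_on {0..x})"
        using A0 A1 that(2) unfolding ac_def by blast+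
      moreover have "j = 0 \<or> j = 1" using that(1) by auto
      ultimately show ?thesis unfolding E_def by (elim disjE) (simp_all only:, simp_all)
    qed
    show "AE x in ivl L. f x = E 0 x"
      using e0 f F0L by (simp add: emb_eq_iff[symmetric] E_def)
  qed
  moreover have "E 1 L = 0" by (simp add: E_def F1_def bc[simplified] upper_endpoints)
  moreover have "E 1 0 = cW + (\<integral>y. K 1 0 0 y * f y \<partial>ivl L)" by (simp add: E_def F1_def c upper_endpoints)
  ultimately show ?thesis unfolding f_def by blast
qed

end

text \<open>Measurability of g is a conclusion, by completeness of Lebesgue measure. It is needed
  for the Sobolev norm of u(t), which is known only almost everywhere as a limit of measurable
  functions.\<close>

lemma integrable_ivl_AE_eq:
  fixes f g :: "real \<Rightarrow> 'b::euclidean_space"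
  assumes f: "integrable (ivl T) f" and ae: "AE t in ivl T. f t = g t"
  shows "integrable (ivl T) g"
proof -
  obtain N where N: "{t \<in> space lebesgue. \<not> (t \<in> {0<..<T} \<longrightarrow> f t = g t)} \<subseteq> N" "emeasure lebesgue N = 0" "N \<in> sets lebesgue"
    using ae unfolding AE_ivl by (rule AE_E)
  have neg: "negligible N" using N(2,3) by (simp add: negligible_iff_emeasure0)
  have "f absolutely_integrable_on {0<..<T}"
    using f by (simp add: set_integrable_def integrable_restrict_space)
  then have "g absolutely_integrable_on {0<..<T}"
    by (rule absolutely_integrable_spike[OF _ neg]) (use N(1) in auto)
  then show ?thesis by (simp add: set_integrable_def integrable_restrict_space)
qed

lemma le_one_plus_square: "a\<^sup>2 \<le> b \<Longrightarrow> a \<le> 1 + b" for a b :: real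
  using sum_squares_bound[of a 1] by (smt (verit) power_one zero_le_power2)

context closed_loop
begin

lemma continuous_on_Sh: "continuous_on {0..T} (\<lambda>t. Sh t x)"
  by (rule continuous_on_subset[OF continuous_on_S]) auto

lemma weighted_average_proj:
  assumes "continuous_on {0..T} \<eta>" "proj L w0 = w0"
  shows "proj L (integral {0..T} (\<lambda>t. \<eta> t *\<^sub>R Sh t w0)) = integral {0..T} (\<lambda>t. \<eta> t *\<^sub>R Sh t w0)"
proof -
  have "(\<lambda>t. \<eta> t *\<^sub>R Sh t w0) integrable_on {0..T}"
    by (intro integrable_continuous_real continuous_intros assms(1) continuous_on_Sh)
  from integral_linear[OF this bounded_linear_proj[of L]]
  have "proj L (integral {0..T} (\<lambda>t. \<eta> t *\<^sub>R Sh t w0)) = integral {0..T} (proj L \<circ> (\<lambda>t. \<eta> t *\<^sub>R Sh t w0))" by simp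
  also have "\<dots> = integral {0..T} (\<lambda>t. \<eta> t *\<^sub>R Sh t w0)"
    by (rule integral_cong) (simp add: proj_scaleR proj_Sh_eq assms(2))
  finally show ?thesis .
qed

text \<open>The semigroup is contractive on the range of \<open>proj L\<close>, so the integrands
  differ by at most a constant times the distance of the initial values, uniformly in time.\<close>

lemma weighted_average_tendsto:
  assumes \<eta>: "continuous_on {0..T} \<eta>" and x: "x \<longlonglongrightarrow> w0" and T: "T > 0"
    and px: "\<And>n. proj L (x n) = x n" and pw: "proj L w0 = w0"
  shows "(\<lambda>n. integral {0..T} (\<lambda>t. \<eta> t *\<^sub>R Sh t (x n))) \<longlonglongrightarrow> integral {0..T} (\<lambda>t. \<eta> t *\<^sub>R Sh t w0)"
proof -
  obtain M where M: "\<forall>t\<in>{0..T}. norm (\<eta> t) \<le> M"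
    using continuous_Icc_bounded[OF \<eta>] by blast
  have i: "(\<lambda>t. \<eta> t *\<^sub>R Sh t z) integrable_on {0..T}" for z
    by (intro integrable_continuous_real continuous_intros \<eta> continuous_on_Sh)
  have bd: "norm (integral {0..T} (\<lambda>t. \<eta> t *\<^sub>R Sh t (x n)) - integral {0..T} (\<lambda>t. \<eta> t *\<^sub>R Sh t w0)) \<le> (M * norm (x n - w0)) * (T - 0)" for n
  proof -
    have "integral {0..T} (\<lambda>t. \<eta> t *\<^sub>R Sh t (x n)) - integral {0..T} (\<lambda>t. \<eta> t *\<^sub>R Sh t w0)
        = integral {0..T} (\<lambda>t. \<eta> t *\<^sub>R Sh t (x n) - \<eta> t *\<^sub>R Sh t w0)"
      by (rule Henstock_Kurzweil_Integration.integral_diff[symmetric, OF i i])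
    also have "\<dots> = integral {0..T} (\<lambda>t. \<eta> t *\<^sub>R Sh t (x n - w0))"
      by (rule integral_cong) (simp add: S_diff scaleR_diff_right)
    also have "norm \<dots> \<le> (M * norm (x n - w0)) * (T - 0)"
    proof (rule integral_bound)
      fix t assume t: "t \<in> {0..T}"
      have "proj L (x n - w0) = x n - w0" by (simp add: proj_diff px pw)
      then have n: "norm (Sh t (x n - w0)) \<le> norm (x n - w0)" using t by (intro contraction) auto
      have m: "\<bar>\<eta> t\<bar> \<le> M" using M t by auto
      show "norm (\<eta> t *\<^sub>R Sh t (x n - w0)) \<le> M * norm (x n - w0)"
        unfolding norm_scaleR by (rule mult_mono[OF m n order_trans[OF abs_ge_zero m] norm_ge_zero])
    qed (use T in \<open>auto intro!: continuous_intros \<eta> continuous_on_Sh\<close>)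
    finally show ?thesis .
  qed
  have "(\<lambda>n. (M * norm (x n - w0)) * (T - 0)) \<longlonglongrightarrow> (M * norm (w0 - w0)) * (T - 0)"
    by (intro tendsto_intros x)
  then have z: "(\<lambda>n. (M * norm (x n - w0)) * (T - 0)) \<longlonglongrightarrow> 0" by simp
  show ?thesis
    by (rule LIM_zero_cancel, rule Lim_null_comparison[OF always_eventually z], rule allI, rule bd)
qed

text \<open>Integration by parts in time, with no end terms because the weight has compact support.
  It eliminates y, which need not converge when x runs through approximations of a rough initial
  value.\<close>

lemma gen_weighted_average:
  assumes g: "gen x y" and T: "T > 0"
    and d: "\<And>t. (\<eta> has_real_derivative \<eta>' t) (at t)" and c': "continuous_on UNIV \<eta>'"
    and supp: "0 < a" "b < T" "\<And>t. t \<notin> {a..b} \<Longrightarrow> \<eta> t = 0"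
  shows "integral {0..T} (\<lambda>t. \<eta> t *\<^sub>R Sh t y) = - integral {0..T} (\<lambda>t. \<eta>' t *\<^sub>R Sh t x)"
proof -
  have \<eta>c: "continuous_on {0..T} \<eta>"
    using d by (meson DERIV_isCont continuous_at_imp_continuous_on)
  have i: "(\<lambda>t. \<eta> t *\<^sub>R Sh t y) integrable_on {0..T}" "(\<lambda>t. \<eta>' t *\<^sub>R Sh t x) integrable_on {0..T}"
    by (intro integrable_continuous_real continuous_intros \<eta>c continuous_on_subset[OF c'] continuous_on_Sh; simp)+
  have "((\<lambda>t. \<eta> t *\<^sub>R Sh t y + \<eta>' t *\<^sub>R Sh t x) has_integral (\<eta> T *\<^sub>R Sh T x - \<eta> 0 *\<^sub>R Sh 0 x)) {0..T}"
  proof (rule fundamental_theorem_of_calculus)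
    fix t assume t: "t \<in> {0..T}"
    have "((\<lambda>t. Sh t x) has_vector_derivative Sh t y) (at t within {0..T})"
      by (rule has_vector_derivative_within_subset[OF S_has_vector_derivative[OF g]]) (use t in auto)
    then show "((\<lambda>t. \<eta> t *\<^sub>R Sh t x) has_vector_derivative \<eta> t *\<^sub>R Sh t y + \<eta>' t *\<^sub>R Sh t x) (at t within {0..T})"
      by (intro has_vector_derivative_scaleR DERIV_subset[OF d]) auto
  qed (use T in simp)
  moreover have "\<eta> T = 0" "\<eta> 0 = 0" using supp by auto
  ultimately have "integral {0..T} (\<lambda>t. \<eta> t *\<^sub>R Sh t y + \<eta>' t *\<^sub>R Sh t x) = 0"
    by (simp add: integral_unique)
  then show ?thesis
    using i by (simp add: Henstock_Kurzweil_Integration.integral_add add_eq_0_iff2)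
qed

text \<open>Collects, for one test function, the average, its membership in the domain and its
  two-derivative representation; the traces at both ends start from it.\<close>

lemma test_average:
  assumes w0: "proj L w0 = w0" and T: "T > 0" and test: "test_function T \<theta>"
  obtains \<eta>' a b vW cW D where
    "\<And>t. ((\<lambda>t. \<theta> t * exp (- r * t)) has_real_derivative \<eta>' t) (at t)" "continuous_on UNIV \<eta>'"
    "0 < a" "b < T" "\<And>t. t \<notin> {a..b} \<Longrightarrow> \<theta> t * exp (- r * t) = 0" "continuous_on UNIV \<theta>"
    "Arel (integral {0..T} (\<lambda>t. (\<theta> t * exp (- r * t)) *\<^sub>R Sh t w0)) (- integral {0..T} (\<lambda>t. \<eta>' t *\<^sub>R Sh t w0)) vW cW"
    "time_average L T \<theta> (\<lambda>t. rep_l2 (state r w0 t)) (rep_l2 (integral {0..T} (\<lambda>t. \<theta> t *\<^sub>R state r w0 t)))"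
    "sobolev_rep L 2 D (rep_l2 (integral {0..T} (\<lambda>t. \<theta> t *\<^sub>R state r w0 t)))" "D 1 L = 0"
    "D 1 0 = cW + (\<integral>y. K 1 0 0 y * rep_l2 (integral {0..T} (\<lambda>t. \<theta> t *\<^sub>R state r w0 t)) y \<partial>ivl L)"
    "proj L (integral {0..T} (\<lambda>t. \<theta> t *\<^sub>R state r w0 t)) = integral {0..T} (\<lambda>t. \<theta> t *\<^sub>R state r w0 t)"
proof -
  obtain \<eta>' a b where d: "\<And>t. ((\<lambda>t. \<theta> t * exp (- r * t)) has_real_derivative \<eta>' t) (at t)" and c': "continuous_on UNIV \<eta>'"
    and ab: "0 < a" "b < T" "\<And>t. t \<notin> {a..b} \<Longrightarrow> \<theta> t * exp (- r * t) = 0" and c0: "continuous_on UNIV \<theta>"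
    by (rule test_function_weight[OF test T, of r]) (rule that, assumption+)
  define W where "W = integral {0..T} (\<lambda>t. (\<theta> t * exp (- r * t)) *\<^sub>R Sh t w0)"
  define U where "U = integral {0..T} (\<lambda>t. \<theta> t *\<^sub>R state r w0 t)"
  have \<theta>c: "continuous_on {0..T} \<theta>" by (rule continuous_on_subset[OF c0]) simp
  have gW: "gen W (- integral {0..T} (\<lambda>t. \<eta>' t *\<^sub>R Sh t w0))"
    unfolding W_def by (rule gen_weighted_integral[OF d c' ab(1,2) T ab(3)])
  have pW: "proj L W = W"
    unfolding W_def by (intro weighted_average_proj w0 continuous_intros \<theta>c)
  obtain vW cW where A: "Arel W (- integral {0..T} (\<lambda>t. \<eta>' t *\<^sub>R Sh t w0)) vW cW"
    using gen_A_rel[OF gW pW] by blast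
  have UR: "U = Rop W" unfolding U_def W_def by (rule state_average(1)[OF \<theta>c, symmetric])
  have U: "U - V 0 U = W" "proj L U = U" unfolding UR Rop_spec pW by simp_all
  obtain D where D: "sobolev_rep L 2 D (rep_l2 U)" "D 1 L = 0" "D 1 0 = cW + (\<integral>y. K 1 0 0 y * rep_l2 U y \<partial>ivl L)"
    using lift_H2[OF A U] by blast
  have ta: "time_average L T \<theta> (\<lambda>t. rep_l2 (state r w0 t)) (rep_l2 U)"
    unfolding time_average_def
  proof (intro conjI ballI rep_l2_ivl)
    fix f assume f: "f \<in> L2 (ivl L)"
    have "(\<integral>x. rep_l2 U x * f x \<partial>ivl L) = pair_l2 U (emb L f)"
      using pair_emb[OF rep_l2_ivl f, of U] U(2) by (simp add: proj_def)
    then show "(\<integral>x. rep_l2 U x * f x \<partial>ivl L) = (\<integral>t. \<theta> t * (\<integral>x. rep_l2 (state r w0 t) x * f x \<partial>ivl L) \<partial>ivl T)"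
      unfolding U_def using state_average(2)[OF \<theta>c f] by simp
  qed
  show ?thesis
    by (rule that[OF d c' ab c0 A[unfolded W_def] ta[unfolded U_def] D[unfolded U_def] U(2)[unfolded U_def]])
qed

lemma dx_trace_right:
  assumes "proj L w0 = w0" "T > 0"
  shows "dx_trace L T (\<lambda>t. rep_l2 (state r w0 t)) L (\<lambda>t. 0)"
  unfolding dx_trace_def
proof (intro allI impI)
  fix \<theta> assume test: "test_function T \<theta>"
  obtain D where
    "time_average L T \<theta> (\<lambda>t. rep_l2 (state r w0 t)) (rep_l2 (integral {0..T} (\<lambda>t. \<theta> t *\<^sub>R state r w0 t)))"
    "sobolev_rep L 2 D (rep_l2 (integral {0..T} (\<lambda>t. \<theta> t *\<^sub>R state r w0 t)))" "D 1 L = 0"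
    by (rule test_average[OF assms test, of r]) (rule that, assumption+)
  then show "\<exists>U D. time_average L T \<theta> (\<lambda>t. rep_l2 (state r w0 t)) U \<and> sobolev_rep L 2 D U \<and>
      D 1 L = (\<integral>t. complex_of_real (\<theta> t) * 0 \<partial>ivl T)"
    by (intro exI[of _ "rep_l2 (integral {0..T} (\<lambda>t. \<theta> t *\<^sub>R state r w0 t))"] exI[of _ D]) simp
qed

section \<open>Regularity of the closed-loop state for rough initial values\<close>

lemma state_regularity:
  fixes r T :: real and w0 :: l2
  assumes w0: "proj L w0 = w0" and T: "T > 0"
  defines "u \<equiv> \<lambda>t. rep_l2 (state r w0 t)"
  shows "AE t in ivl T. \<exists>D. sobolev_rep L 1 D (u t) \<and> D 0 0 = boundary_feedback L k u t \<and> D 0 L = 0"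
    and "L2_sobolev L 1 T u"
    and "\<exists>h\<in>L2 (ivl T). dx_trace L T u 0 h"
proof -
  obtain x y v c G Gc where
    g: "\<And>n. gen (x n) (y n)" and px: "\<And>n. proj L (x n) = x n" and xl: "x \<longlonglongrightarrow> w0"
    and A: "\<And>n t. t \<ge> 0 \<Longrightarrow> Arel (Sh t (x n)) (Sh t (y n)) (v n t) (c n t)"
    and cv: "\<And>n. continuous_on {0..} (v n)" and cc: "\<And>n. continuous_on {0..} (c n)"
    and Gi: "integrable (ivl T) G"
    and Gae: "AE t in ivl T. (\<lambda>n. v n t) \<longlonglongrightarrow> lim (\<lambda>n. v n t) \<and> (\<forall>n. (norm (v n t - lim (\<lambda>n. v n t)))\<^sup>2 \<le> G t / 4 ^ n)"
    and Gci: "integrable (ivl T) Gc"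
    and Gcae: "AE t in ivl T. (\<lambda>n. c n t) \<longlonglongrightarrow> lim (\<lambda>n. c n t) \<and> (\<forall>n. (norm (c n t - lim (\<lambda>n. c n t)))\<^sup>2 \<le> Gc t / 4 ^ n)"
    by (rule trajectory_regularity[OF w0 T]) (rule that, assumption+)
  define vl where "vl t = lim (\<lambda>n. v n t)" for t
  define cl where "cl t = lim (\<lambda>n. c n t)" for t
  define e where "e t = exp (- r * t)" for t
  have ec: "continuous_on I e" for I unfolding e_def by (intro continuous_intros)
  have one: "(\<lambda>x. 1) \<in> L2 (ivl L)" by (rule L2_ivl_bounded[of _ L 1]) auto
  define ua where "ua n t = state r (x n) t" for n t
  \<comment> \<open>The pairs \<open>Zn\<close> and \<open>Z\<close> hold the classes of u and u_x,
    so convergence in H^1 becomes convergence in \<open>l2\<close> x \<open>l2\<close>.\<close>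
  define Zn where "Zn n t = (ua n t, e t *\<^sub>R v n t + V 1 (ua n t))" for n t
  define Z where "Z t = (state r w0 t, e t *\<^sub>R vl t + V 1 (state r w0 t))" for t
  interpret J: bounded_linear Jop by (rule bounded_linear_kop[OF kernel_prim])
  interpret R: bounded_linear Rop by (rule bounded_linear_Rop)
  interpret V1: bounded_linear "V 1" by (rule bounded_linear_V)
  have Jn: "Sh t (x n) = Jop (v n t)" if "t \<ge> 0" for n t
    using A_rel_first_derivative(1)[OF A[OF that]] by (simp add: kop_def prim_def)
  have ua_lim: "(\<lambda>n. ua n t) \<longlonglongrightarrow> state r w0 t" if t: "t \<ge> 0" for t
    unfolding ua_def state_def
    by (intro R.tendsto tendsto_intros bounded_linear.tendsto[OF lin[OF t]] xl)
  have ua_eq: "ua n t - V 0 (ua n t) = Jop (e t *\<^sub>R v n t)" if "t \<ge> 0" for n t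
    using state_equation[OF px that, of r n] Jn[OF that, of n] by (simp add: ua_def e_def J.scaleR)
  \<comment> \<open>The set of times at which the derivatives converge. The relations between
    trajectory and derivative are closed, hence hold for the limit at each of these times.\<close>
  have good: "AE t in ivl T. t \<in> {0<..<T} \<and> (\<lambda>n. v n t) \<longlonglongrightarrow> vl t \<and> Sh t w0 = Jop (vl t) \<and>
      proj L (vl t) = vl t \<and> pair_l2 (vl t) (emb L (\<lambda>x. 1)) = 0"
    using Gae AE_space
  proof eventually_elim
    case (elim t)
    then have t: "t \<in> {0<..<T}" "t \<ge> 0" and vt: "(\<lambda>n. v n t) \<longlonglongrightarrow> vl t" by (auto simp: vl_def)
    have "(\<lambda>n. Sh t (x n)) \<longlonglongrightarrow> Sh t w0" by (rule bounded_linear.tendsto[OF lin[OF t(2)] xl])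
    moreover have "(\<lambda>n. Sh t (x n)) \<longlonglongrightarrow> Jop (vl t)"
      unfolding Jn[OF t(2)] by (rule J.tendsto[OF vt])
    ultimately have 1: "Sh t w0 = Jop (vl t)" by (rule LIMSEQ_unique)
    have "(\<lambda>n. v n t) \<longlonglongrightarrow> proj L (vl t)"
      using bounded_linear.tendsto[OF bounded_linear_proj vt, of L] A_rel_proj(3)[OF A[OF t(2)]] by simp
    then have 2: "proj L (vl t) = vl t" using vt LIMSEQ_unique by blast
    have "(\<lambda>n. pair_l2 (v n t) (emb L (\<lambda>x. 1))) \<longlonglongrightarrow> pair_l2 (vl t) (emb L (\<lambda>x. 1))"
      by (rule bounded_linear.tendsto[OF bounded_linear_pair vt])
    then have 3: "pair_l2 (vl t) (emb L (\<lambda>x. 1)) = 0"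
      using A_rel_first_derivative(2)[OF A[OF t(2)]] by (simp add: LIMSEQ_const_iff)
    show ?case using t(1) vt 1 2 3 by blast
  qed
  have state_eq: "state r w0 t - V 0 (state r w0 t) = Jop (e t *\<^sub>R vl t)" if "t \<ge> 0" "Sh t w0 = Jop (vl t)" for t
    using state_equation[OF w0 that(1), of r] that(2) by (simp add: e_def J.scaleR)
  show "AE t in ivl T. \<exists>D. sobolev_rep L 1 D (u t) \<and> D 0 0 = boundary_feedback L k u t \<and> D 0 L = 0"
    using good
  proof eventually_elim
    case (elim t)
    then have t: "t \<ge> 0" by auto
    have "emb L (u t) = Jop (e t *\<^sub>R vl t) + V 0 (emb L (u t))"
      using state_eq[OF t] elim by (simp add: u_def emb_rep_state algebra_simps)
    from lift_H1(1)[OF _ this] elim show ?case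
      by (simp add: u_def proj_scaleR boundary_feedback_def linear_scale[OF bounded_linear.linear[OF bounded_linear_pair]])
  qed
  \<comment> \<open>Two separate times are allowed because u(t) is compared below with
    approximations frozen at an earlier grid time.\<close>
  have diff_norm: "sobolev_norm L 1 (\<lambda>x. u t x - rep_l2 (ua n s) x) = norm (Z t - Zn n s)"
    if t: "t \<ge> 0" "Sh t w0 = Jop (vl t)" "proj L (vl t) = vl t" and s: "s \<ge> 0" for t s n
  proof -
    let ?f = "\<lambda>x. u t x - rep_l2 (ua n s) x"
    let ?v = "e t *\<^sub>R vl t - e s *\<^sub>R v n s"
    have f: "?f \<in> L2 (ivl L)" unfolding u_def by (intro L2_diff rep_l2_ivl)
    have ef: "emb L ?f = state r w0 t - ua n s"
      unfolding u_def ua_def by (simp add: emb_diff emb_rep_state)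
    have "emb L ?f = Jop ?v + V 0 (emb L ?f)"
      unfolding ef using state_eq[OF t(1,2)] ua_eq[OF s, of n] by (simp add: J.diff V_diff algebra_simps)
    moreover have "proj L ?v = ?v"
      using A_rel_proj(3)[OF A[OF s]] t(3) by (simp add: proj_diff proj_scaleR)
    ultimately have "sobolev_norm L 1 ?f = norm (emb L ?f, ?v + V 1 (emb L ?f))"
      by (rule lift_H1(3)[OF f])
    also have "(emb L ?f, ?v + V 1 (emb L ?f)) = Z t - Zn n s"
      unfolding ef Z_def Zn_def by (simp add: V_diff algebra_simps)
    finally show ?thesis .
  qed
  have u_norm: "u t \<in> sobolev L 1" "sobolev_norm L 1 (u t) = norm (Z t)"
    if t: "t \<ge> 0" "Sh t w0 = Jop (vl t)" "proj L (vl t) = vl t" for t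
  proof -
    have "emb L (u t) = Jop (e t *\<^sub>R vl t) + V 0 (emb L (u t))"
      using state_eq[OF t(1,2)] by (simp add: u_def emb_rep_state algebra_simps)
    moreover have "proj L (e t *\<^sub>R vl t) = e t *\<^sub>R vl t" using t by (simp add: proj_scaleR)
    ultimately show "u t \<in> sobolev L 1" "sobolev_norm L 1 (u t) = norm (Z t)"
      using lift_H1(2,3)[of "u t" "e t *\<^sub>R vl t"] by (simp_all add: u_def emb_rep_state Z_def)
  qed
  have ua_sob: "rep_l2 (ua n s) \<in> sobolev L 1" if s: "s \<ge> 0" for n s
  proof -
    have "emb L (rep_l2 (ua n s)) = Jop (e s *\<^sub>R v n s) + V 0 (emb L (rep_l2 (ua n s)))"
      using ua_eq[OF s, of n] by (simp add: ua_def emb_rep_state algebra_simps)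
    then show ?thesis
      by (intro lift_H1(2)[of _ "e s *\<^sub>R v n s"]) (use A_rel_proj(3)[OF A[OF s]] in \<open>simp_all add: proj_scaleR\<close>)
  qed
  have uac: "continuous_on {0..} (ua n)" for n
    unfolding ua_def[abs_def] by (rule state_continuous)
  have Znc: "continuous_on {0..T} (Zn n)" for n
    unfolding Zn_def[abs_def]
    by (intro continuous_on_Pair continuous_intros ec bounded_linear.continuous_on[OF bounded_linear_V]
        continuous_on_subset[OF uac] continuous_on_subset[OF cv]) auto
  have Z_lim: "(\<lambda>n. Zn n t) \<longlonglongrightarrow> Z t" if "t \<ge> 0" "(\<lambda>n. v n t) \<longlonglongrightarrow> vl t" for t
    unfolding Zn_def Z_def using that ua_lim[OF that(1)]
    by (intro tendsto_Pair tendsto_intros V1.tendsto) auto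
  show "L2_sobolev L 1 T u"
    unfolding L2_sobolev_def
  proof (intro conjI)
    show "AE t in ivl T. u t \<in> sobolev L 1"
      using good by eventually_elim (rule u_norm(1), auto)
    \<comment> \<open>\<open>Zn n\<close> is uniformly continuous in time; the mesh 1/N is fine
      enough for an oscillation below 1/(n+1), which tends to 0 along the sequence.\<close>
    have "\<exists>N::nat. N > 0 \<and> (\<forall>s\<in>{0..T}. \<forall>t\<in>{0..T}. dist s t < 1 / N \<longrightarrow> dist (Zn n s) (Zn n t) < 1 / Suc n)" for n
    proof -
      have "uniformly_continuous_on {0..T} (Zn n)"
        by (rule compact_uniformly_continuous[OF Znc]) simp
      then obtain d where d: "d > 0" "\<And>s t. s \<in> {0..T} \<Longrightarrow> t \<in> {0..T} \<Longrightarrow> dist s t < d \<Longrightarrow> dist (Zn n s) (Zn n t) < 1 / Suc n"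
        unfolding uniformly_continuous_on_def by (metis of_nat_0_less_iff zero_less_Suc zero_less_divide_1_iff)
      obtain N :: nat where N: "N > 0" "1 / N < d"
        using reals_Archimedean[OF d(1)] by (metis inverse_eq_divide zero_less_Suc)
      then show ?thesis using d(2) by (intro exI[of _ N]) fastforce
    qed
    then obtain N :: "nat \<Rightarrow> nat" where N: "\<And>n. N n > 0"
      "\<And>n s t. s \<in> {0..T} \<Longrightarrow> t \<in> {0..T} \<Longrightarrow> dist s t < 1 / N n \<Longrightarrow> dist (Zn n s) (Zn n t) < 1 / Suc n"
      by metis
    \<comment> \<open>The largest multiple of the mesh not exceeding t. It stays in [0,T] and takes
      finitely many values there, so sampling gives simple functions.\<close>
    define grid where "grid n t = of_int \<lfloor>t * real (N n)\<rfloor> / real (N n)" for n t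
    have grid: "0 \<le> grid n t" "grid n t \<le> t" "t - grid n t < 1 / N n" if "t \<ge> 0" for n t
    proof -
      have f: "real_of_int \<lfloor>t * real (N n)\<rfloor> \<le> t * real (N n)" "t * real (N n) < real_of_int \<lfloor>t * real (N n)\<rfloor> + 1" by linarith+
      show "0 \<le> grid n t" using that by (simp add: grid_def)
      show "grid n t \<le> t" using f(1) N(1)[of n] by (simp add: grid_def field_simps)
      have "t < (real_of_int \<lfloor>t * real (N n)\<rfloor> + 1) / real (N n)"
        using f(2) N(1)[of n] by (simp add: pos_less_divide_eq)
      then show "t - grid n t < 1 / N n" by (simp add: grid_def add_divide_distrib)
    qed
    define s where "s n t = rep_l2 (ua n (grid n t))" for n t
    show "\<exists>s. (\<forall>n. simple_sobolev L 1 T (s n)) \<and>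
          (AE t in ivl T. (\<lambda>n. sobolev_norm L 1 (\<lambda>x. u t x - s n t x)) \<longlonglongrightarrow> 0)"
    proof (rule exI[where x = s], rule conjI, rule allI)
      fix n
      show "simple_sobolev L 1 T (s n)"
        unfolding simple_sobolev_def
      proof (intro conjI allI)
        have "s n ` {0<..<T} \<subseteq> (\<lambda>j::int. rep_l2 (ua n (of_int j / real (N n)))) ` {0..\<lfloor>T * real (N n)\<rfloor>}"
        proof
          fix f assume "f \<in> s n ` {0<..<T}"
          then obtain t where t: "0 < t" "t < T" "f = s n t" by auto
          have "0 \<le> t * real (N n)" "t * real (N n) \<le> T * real (N n)" using t by (auto intro: mult_right_mono)
          then have "\<lfloor>t * real (N n)\<rfloor> \<in> {0..\<lfloor>T * real (N n)\<rfloor>}" by (auto intro: floor_mono)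
          then show "f \<in> (\<lambda>j::int. rep_l2 (ua n (of_int j / real (N n)))) ` {0..\<lfloor>T * real (N n)\<rfloor>}"
            unfolding t(3) s_def grid_def by blast
        qed
        then show "finite (s n ` {0<..<T})" by (rule finite_subset) simp
        show "s n ` {0<..<T} \<subseteq> sobolev L 1"
        proof
          fix f assume "f \<in> s n ` {0<..<T}"
          then obtain t where t: "0 < t" "f = s n t" by auto
          show "f \<in> sobolev L 1"
            unfolding t(2) s_def using t(1) by (intro ua_sob grid(1)) simp
        qed
        fix f
        \<comment> \<open>A level set of the sampled function is the preimage, under the floor, of a
          set of integers.\<close>
        have "(\<lambda>t. \<lfloor>t * real (N n)\<rfloor>) \<in> measurable borel (count_space UNIV)" by measurable
        then have "(\<lambda>t. \<lfloor>t * real (N n)\<rfloor>) -` {j. rep_l2 (ua n (of_int j / real (N n))) = f} \<inter> space borel \<in> sets borel"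
          by (rule measurable_sets) simp
        then have "{0<..<T} \<inter> ((\<lambda>t. \<lfloor>t * real (N n)\<rfloor>) -` {j. rep_l2 (ua n (of_int j / real (N n))) = f} \<inter> space borel) \<in> sets borel"
          by (intro sets.Int) auto
        also have "{0<..<T} \<inter> ((\<lambda>t. \<lfloor>t * real (N n)\<rfloor>) -` {j. rep_l2 (ua n (of_int j / real (N n))) = f} \<inter> space borel)
            = {t \<in> {0<..<T}. s n t = f}" by (auto simp: s_def grid_def)
        finally show "{t \<in> {0<..<T}. s n t = f} \<in> sets lebesgue" by simp
      qed
    next
      show "AE t in ivl T. (\<lambda>n. sobolev_norm L 1 (\<lambda>x. u t x - s n t x)) \<longlonglongrightarrow> 0"
        using good
      proof eventually_elim
        case (elim t)
        then have t: "t \<ge> 0" "t \<in> {0..T}" by auto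
        have bd: "norm (sobolev_norm L 1 (\<lambda>x. u t x - s n t x)) \<le> norm (Zn n t - Z t) + 1 / Suc n" for n
        proof -
          have gT: "grid n t \<in> {0..T}" using grid(1,2)[OF t(1), of n] t by auto
          have "sobolev_norm L 1 (\<lambda>x. u t x - s n t x) = norm (Z t - Zn n (grid n t))"
            unfolding s_def using elim by (intro diff_norm t grid) auto
          also have "\<dots> \<le> norm (Z t - Zn n t) + norm (Zn n t - Zn n (grid n t))"
            using norm_triangle_ineq[of "Z t - Zn n t" "Zn n t - Zn n (grid n t)"] by simp
          also have "norm (Zn n t - Zn n (grid n t)) \<le> 1 / Suc n"
            using N(2)[OF t(2) gT, of n] grid(2,3)[OF t(1), of n] by (simp add: dist_norm)
          finally show ?thesis
            using \<open>sobolev_norm L 1 (\<lambda>x. u t x - s n t x) = norm (Z t - Zn n (grid n t))\<close>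
            by (simp add: norm_minus_commute)
        qed
        have "(\<lambda>n. norm (Zn n t - Z t) + 1 / Suc n) \<longlonglongrightarrow> norm (Z t - Z t) + 0"
          using elim by (intro tendsto_intros Z_lim t LIMSEQ_Suc[OF lim_1_over_n]) auto
        then have z: "(\<lambda>n. norm (Zn n t - Z t) + 1 / Suc n) \<longlonglongrightarrow> 0" by simp
        show ?case
          by (rule Lim_null_comparison[OF always_eventually z], rule allI, rule bd)
      qed
    qed
    \<comment> \<open>The limit of the squared norms is measurable as a limit of continuous
      functions of time and agrees almost everywhere with the squared Sobolev norm.\<close>
    have Zi: "integrable (ivl T) (\<lambda>t. lim (\<lambda>n. (norm (Zn n t))\<^sup>2))"
      and Zae: "AE t in ivl T. lim (\<lambda>n. (norm (Zn n t))\<^sup>2) = (sobolev_norm L 1 (u t))\<^sup>2"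
    proof -
      have zc: "continuous_on {0..T} (\<lambda>t. (norm (Zn n t))\<^sup>2)" for n
        by (intro continuous_intros Znc)
      have m: "(\<lambda>t. lim (\<lambda>n. (norm (Zn n t))\<^sup>2)) \<in> borel_measurable (ivl T)"
        by (intro borel_measurable_lim_metric continuous_ivl_measurable zc)
      have lims: "AE t in ivl T. (\<lambda>n. (norm (Zn n t))\<^sup>2) \<longlonglongrightarrow> (norm (Z t))\<^sup>2"
        using good by eventually_elim (auto intro!: tendsto_intros Z_lim)
      then have ae: "AE t in ivl T. lim (\<lambda>n. (norm (Zn n t))\<^sup>2) = (norm (Z t))\<^sup>2"
        by eventually_elim (rule limI)
      show "AE t in ivl T. lim (\<lambda>n. (norm (Zn n t))\<^sup>2) = (sobolev_norm L 1 (u t))\<^sup>2"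
        using ae good
      proof eventually_elim
        case (elim t)
        then have "sobolev_norm L 1 (u t) = norm (Z t)" by (intro u_norm(2)) auto
        then show ?case using elim(1) by simp
      qed
      obtain C1 where C1: "\<And>x. norm (V 1 x) \<le> norm x * C1" "C1 > 0" using V1.pos_bounded by blast
      \<comment> \<open>A tuple of continuous functions has one bound, which then bounds every
        component.\<close>
      have "continuous_on {0..T} (\<lambda>t. (state r w0 t, ua 0 t, e t, v 0 t))"
        by (intro continuous_intros ec continuous_on_subset[OF uac] continuous_on_subset[OF cv]
            continuous_on_subset[OF state_continuous]) auto
      then have "bounded ((\<lambda>t. (state r w0 t, ua 0 t, e t, v 0 t)) ` {0..T})"
        by (intro compact_imp_bounded compact_continuous_image) auto
      then obtain B where "\<forall>z\<in>(\<lambda>t. (state r w0 t, ua 0 t, e t, v 0 t)) ` {0..T}. norm z \<le> B" unfolding bounded_iff by blast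
      then have B4: "norm (state r w0 t, ua 0 t, e t, v 0 t) \<le> B" if "t \<in> {0..T}" for t using that by blast
      have B: "norm (state r w0 t) \<le> B" "norm (v 0 t) \<le> B" "norm (e t) \<le> B" if "t \<in> {0..T}" for t
        using order_trans[OF norm_fst_le B4[OF that]] 
          order_trans[OF norm_fst_le order_trans[OF norm_snd_le order_trans[OF norm_snd_le B4[OF that]]]]
          order_trans[OF norm_snd_le order_trans[OF norm_snd_le order_trans[OF norm_snd_le B4[OF that]]]]
        by simp_all
      have B0: "B \<ge> 0" using order_trans[OF norm_ge_zero B(1)[of 0]] T by simp
      show "integrable (ivl T) (\<lambda>t. lim (\<lambda>n. (norm (Zn n t))\<^sup>2))"
      proof (rule Bochner_Integration.integrable_bound[OF _ m])
        \<comment> \<open>The majorant arises from two uses of (a+b)^2 \<le> 2a^2 + 2b^2: one splits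
          the derivative component of Z into its two summands, the other splits \<open>vl t\<close>
          into \<open>v 0 t\<close> and a deviation whose square is at most
          \<open>G t\<close>.\<close>
        show "integrable (ivl T) (\<lambda>t. (B\<^sup>2 + 2 * (B * C1)\<^sup>2 + 4 * B\<^sup>2 * B\<^sup>2) + 4 * B\<^sup>2 * G t)"
          using Gi by (intro Bochner_Integration.integrable_add integrable_mult_right
              finite_measure.integrable_const finite_measure_ivl)
        show "AE t in ivl T. norm (lim (\<lambda>n. (norm (Zn n t))\<^sup>2)) \<le> norm ((B\<^sup>2 + 2 * (B * C1)\<^sup>2 + 4 * B\<^sup>2 * B\<^sup>2) + 4 * B\<^sup>2 * G t)"
          using ae good Gae
        proof eventually_elim
          case (elim t)
          then have t: "t \<in> {0..T}" by auto
          have sq: "(a + b)\<^sup>2 \<le> 2 * a\<^sup>2 + 2 * b\<^sup>2" for a b :: real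
            using sum_squares_bound[of a b] by (simp add: power2_sum)
          have "(norm (v 0 t - vl t))\<^sup>2 \<le> G t / 4 ^ 0"
            using elim(3) unfolding vl_def by blast
          then have G0: "(norm (v 0 t - vl t))\<^sup>2 \<le> G t" by simp
          have "norm (vl t) \<le> norm (v 0 t) + norm (v 0 t - vl t)"
            using norm_triangle_ineq4[of "v 0 t" "v 0 t - vl t"] by simp
          then have "(norm (vl t))\<^sup>2 \<le> (norm (v 0 t) + norm (v 0 t - vl t))\<^sup>2" by (intro power_mono) auto
          also have "\<dots> \<le> 2 * (norm (v 0 t))\<^sup>2 + 2 * (norm (v 0 t - vl t))\<^sup>2" by (rule sq)
          also have "\<dots> \<le> 2 * B\<^sup>2 + 2 * G t"
            using B(2)[OF t] G0 by (intro add_mono mult_left_mono power_mono) auto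
          finally have vl2: "(norm (vl t))\<^sup>2 \<le> 2 * B\<^sup>2 + 2 * G t" .
          have "norm (e t *\<^sub>R vl t + V 1 (state r w0 t)) \<le> B * norm (vl t) + B * C1"
            using B[OF t] C1 B0
            by (intro norm_triangle_le add_mono order_trans[OF C1(1)]) (auto intro: mult_right_mono)
          then have "(norm (e t *\<^sub>R vl t + V 1 (state r w0 t)))\<^sup>2 \<le> (B * norm (vl t) + B * C1)\<^sup>2" by (intro power_mono) auto
          also have "\<dots> \<le> 2 * (B * norm (vl t))\<^sup>2 + 2 * (B * C1)\<^sup>2" by (rule sq)
          also have "\<dots> = 2 * B\<^sup>2 * (norm (vl t))\<^sup>2 + 2 * (B * C1)\<^sup>2" by (simp add: power_mult_distrib)
          also have "\<dots> \<le> 2 * B\<^sup>2 * (2 * B\<^sup>2 + 2 * G t) + 2 * (B * C1)\<^sup>2"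
            by (intro add_right_mono mult_left_mono vl2) auto
          finally have "(norm (Z t))\<^sup>2 \<le> B\<^sup>2 + (2 * B\<^sup>2 * (2 * B\<^sup>2 + 2 * G t) + 2 * (B * C1)\<^sup>2)"
            unfolding Z_def norm_Pair using power_mono[OF B(1)[OF t], of 2] by simp
          also have "\<dots> = (B\<^sup>2 + 2 * (B * C1)\<^sup>2 + 4 * B\<^sup>2 * B\<^sup>2) + 4 * B\<^sup>2 * G t" by (simp add: algebra_simps)
          finally show ?case using elim(1) by simp
        qed
      qed
    qed
    show "integrable (ivl T) (\<lambda>t. (sobolev_norm L 1 (u t))\<^sup>2)"
      by (rule integrable_ivl_AE_eq[OF Zi Zae])
  qed
  have ccT: "continuous_on {0..T} (c n)" for n by (rule continuous_on_subset[OF cc]) auto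
  have clm: "cl \<in> borel_measurable (ivl T)"
    unfolding cl_def[abs_def] by (intro borel_measurable_lim_metric continuous_ivl_measurable ccT)
  have clL: "cl \<in> L2 (ivl T)"
  proof -
    have "(\<lambda>t. c 0 t - cl t) \<in> L2 (ivl T)"
    proof (rule L2_I)
      show cm: "(\<lambda>t. c 0 t - cl t) \<in> borel_measurable (ivl T)"
        by (intro borel_measurable_diff clm continuous_ivl_measurable ccT)
      show "integrable (ivl T) (\<lambda>t. (cmod (c 0 t - cl t))\<^sup>2)"
      proof (rule Bochner_Integration.integrable_bound[OF Gci])
        show "(\<lambda>t. (cmod (c 0 t - cl t))\<^sup>2) \<in> borel_measurable (ivl T)" using cm by measurable
        show "AE t in ivl T. norm ((cmod (c 0 t - cl t))\<^sup>2) \<le> norm (Gc t)"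
          using Gcae
        proof eventually_elim
          case (elim t)
          then have "(norm (c 0 t - cl t))\<^sup>2 \<le> Gc t / 4 ^ 0" unfolding cl_def by blast
          then show ?case by simp
        qed
      qed
    qed
    from L2_diff[OF continuous_L2_ivl[OF ccT[of 0]] this] show ?thesis by simp
  qed
  have K0: "K 1 0 0 \<in> L2 (ivl L)"
    using continuous_triangle_sections(2)[OF K_continuous[of 1 0], of 0] by (intro continuous_L2_ivl) simp
  have KU: "(\<integral>y. K 1 0 0 y * rep_l2 U y \<partial>ivl L) = pair_l2 U (emb L (K 1 0 0))" if "proj L U = U" for U
    using pair_emb[OF rep_l2_ivl K0, of U] that by (simp add: proj_def mult.commute)
  \<comment> \<open>The x-derivative at 0 of u = w + \<Upsilon>u: the damped trace of the target
    solution plus the integral of k_x(0,y) u(y,t).\<close>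
  define h where "h t = e t * cl t + pair_l2 (state r w0 t) (emb L (K 1 0 0))" for t
  have pc: "continuous_on {0..T} (\<lambda>t. pair_l2 (state r w0 t) (emb L (K 1 0 0)))"
    by (intro bounded_linear.continuous_on[OF bounded_linear_pair] continuous_on_subset[OF state_continuous]) auto
  have ecc: "continuous_on {0..T} (\<lambda>t. complex_of_real (e t))" by (intro continuous_intros ec)
  have hL: "h \<in> L2 (ivl T)"
    unfolding h_def[abs_def] by (intro L2_add L2_mult_continuous clL continuous_L2_ivl pc ecc)
  have "dx_trace L T u 0 h"
    unfolding dx_trace_def
  proof (intro allI impI)
    fix \<theta> assume test: "test_function T \<theta>"
    define U where "U = integral {0..T} (\<lambda>t. \<theta> t *\<^sub>R state r w0 t)"
    obtain \<eta>' a b vW cW D where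
      d: "\<And>t. ((\<lambda>t. \<theta> t * exp (- r * t)) has_real_derivative \<eta>' t) (at t)" and c': "continuous_on UNIV \<eta>'"
      and ab: "0 < a" "b < T" "\<And>t. t \<notin> {a..b} \<Longrightarrow> \<theta> t * exp (- r * t) = 0" and c0: "continuous_on UNIV \<theta>"
      and AW: "Arel (integral {0..T} (\<lambda>t. (\<theta> t * exp (- r * t)) *\<^sub>R Sh t w0)) (- integral {0..T} (\<lambda>t. \<eta>' t *\<^sub>R Sh t w0)) vW cW"
      and ta: "time_average L T \<theta> (\<lambda>t. rep_l2 (state r w0 t)) (rep_l2 (integral {0..T} (\<lambda>t. \<theta> t *\<^sub>R state r w0 t)))"
      and D: "sobolev_rep L 2 D (rep_l2 (integral {0..T} (\<lambda>t. \<theta> t *\<^sub>R state r w0 t)))" "D 1 L = 0"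
        "D 1 0 = cW + (\<integral>y. K 1 0 0 y * rep_l2 (integral {0..T} (\<lambda>t. \<theta> t *\<^sub>R state r w0 t)) y \<partial>ivl L)"
      and pU: "proj L (integral {0..T} (\<lambda>t. \<theta> t *\<^sub>R state r w0 t)) = integral {0..T} (\<lambda>t. \<theta> t *\<^sub>R state r w0 t)"
      by (rule test_average[OF w0 T test, of r]) (rule that, assumption+)
    define \<eta> where "\<eta> t = \<theta> t * exp (- r * t)" for t
    have \<theta>c: "continuous_on {0..T} \<theta>" by (rule continuous_on_subset[OF c0]) simp
    have \<eta>c: "continuous_on {0..T} \<eta>" unfolding \<eta>_def by (intro continuous_intros \<theta>c)
    have \<eta>'c: "continuous_on {0..T} \<eta>'" by (rule continuous_on_subset[OF c']) simp
    define W where "W = integral {0..T} (\<lambda>t. \<eta> t *\<^sub>R Sh t w0)"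
    define Y where "Y = - integral {0..T} (\<lambda>t. \<eta>' t *\<^sub>R Sh t w0)"
    define q where "q = emb L trace_q"
    define p where "p = emb L trace_p"
    have cW: "cW = (pair_l2 W q - pair_l2 Y p) / \<beta>"
      unfolding W_def Y_def \<eta>_def p_def q_def by (rule A_rel_trace[OF AW])
    \<comment> \<open>The trace formula integrated in time, with the generator values replaced by a
      derivative on the weight; the right side depends continuously on \<open>x n\<close>.\<close>
    have cn: "(\<integral>t. \<eta> t * c n t \<partial>ivl T) = (pair_l2 (integral {0..T} (\<lambda>t. \<eta> t *\<^sub>R Sh t (x n))) q
        - pair_l2 (- integral {0..T} (\<lambda>t. \<eta>' t *\<^sub>R Sh t (x n))) p) / \<beta>" for n
    proof -
      have pi: "pair_l2 (integral {0..T} (\<lambda>t. \<eta> t *\<^sub>R Sh t z)) p' = integral {0..T} (\<lambda>t. \<eta> t * pair_l2 (Sh t z) p')"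
        "(\<lambda>t. \<eta> t * pair_l2 (Sh t z) p') integrable_on {0..T}" for z p'
      proof -
        interpret P: bounded_linear "\<lambda>a. pair_l2 a p'" by (rule bounded_linear_pair)
        have "(\<lambda>t. \<eta> t *\<^sub>R Sh t z) integrable_on {0..T}"
          by (intro integrable_continuous_real continuous_intros \<eta>c continuous_on_Sh)
        from integral_linear[OF this bounded_linear_pair[of p']]
        show "pair_l2 (integral {0..T} (\<lambda>t. \<eta> t *\<^sub>R Sh t z)) p' = integral {0..T} (\<lambda>t. \<eta> t * pair_l2 (Sh t z) p')"
          by (simp add: o_def P.scaleR scaleR_conv_of_real)
        show "(\<lambda>t. \<eta> t * pair_l2 (Sh t z) p') integrable_on {0..T}"
          by (intro integrable_continuous_real continuous_intros \<eta>c bounded_linear.continuous_on[OF bounded_linear_pair] continuous_on_Sh)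
      qed
      have "(\<integral>t. \<eta> t * c n t \<partial>ivl T) = integral {0..T} (\<lambda>t. \<eta> t * c n t)"
        by (intro integral_ivl_continuous(2) continuous_intros \<eta>c ccT)
      also have "\<dots> = integral {0..T} (\<lambda>t. (\<eta> t * pair_l2 (Sh t (x n)) q - \<eta> t * pair_l2 (Sh t (y n)) p) / \<beta>)"
        using A_rel_trace[OF A] by (intro integral_cong) (simp add: p_def q_def right_diff_distrib)
      also have "\<dots> = (integral {0..T} (\<lambda>t. \<eta> t * pair_l2 (Sh t (x n)) q) - integral {0..T} (\<lambda>t. \<eta> t * pair_l2 (Sh t (y n)) p)) / \<beta>"
        by (simp add: Henstock_Kurzweil_Integration.integral_diff[OF pi(2) pi(2), symmetric])
      also have "\<dots> = (pair_l2 (integral {0..T} (\<lambda>t. \<eta> t *\<^sub>R Sh t (x n))) q - pair_l2 (integral {0..T} (\<lambda>t. \<eta> t *\<^sub>R Sh t (y n))) p) / \<beta>"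
        unfolding pi(1) ..
      also have "integral {0..T} (\<lambda>t. \<eta> t *\<^sub>R Sh t (y n)) = - integral {0..T} (\<lambda>t. \<eta>' t *\<^sub>R Sh t (x n))"
        by (rule gen_weighted_average[OF g T d[folded \<eta>_def] c' ab(1,2) ab(3)[folded \<eta>_def]])
      finally show ?thesis .
    qed
    have lim1: "(\<lambda>n. \<integral>t. \<eta> t * c n t \<partial>ivl T) \<longlonglongrightarrow> cW"
      unfolding cn cW W_def Y_def using \<beta>
      by (intro tendsto_intros bounded_linear.tendsto[OF bounded_linear_pair]
          weighted_average_tendsto \<eta>c \<eta>'c xl T px w0) simp
    obtain M where M: "\<forall>t\<in>{0..T}. norm (\<eta> t) \<le> M"
      using continuous_Icc_bounded[OF \<eta>c] by blast
    have lim2: "(\<lambda>n. \<integral>t. \<eta> t * c n t \<partial>ivl T) \<longlonglongrightarrow> (\<integral>t. \<eta> t * cl t \<partial>ivl T)"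
    proof (rule integral_dominated_convergence[where w = "\<lambda>t. M * (cmod (c 0 t) + 2 * (1 + Gc t))"])
      have \<eta>m: "(\<lambda>t. complex_of_real (\<eta> t)) \<in> borel_measurable (ivl T)"
        by (intro continuous_ivl_measurable continuous_intros \<eta>c)
      show "(\<lambda>t. \<eta> t * cl t) \<in> borel_measurable (ivl T)"
        by (rule borel_measurable_times[OF \<eta>m clm])
      show "(\<lambda>t. \<eta> t * c n t) \<in> borel_measurable (ivl T)" for n
        by (rule borel_measurable_times[OF \<eta>m continuous_ivl_measurable[OF ccT]])
      show "integrable (ivl T) (\<lambda>t. M * (cmod (c 0 t) + 2 * (1 + Gc t)))"
        using Gci integral_ivl_continuous(1)[OF continuous_on_norm[OF ccT[of 0]]]
        by (intro integrable_mult_right Bochner_Integration.integrable_add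
            finite_measure.integrable_const finite_measure_ivl)
      show "AE t in ivl T. (\<lambda>n. \<eta> t * c n t) \<longlonglongrightarrow> \<eta> t * cl t"
        using Gcae by eventually_elim (auto simp: cl_def intro!: tendsto_intros)
      show "AE t in ivl T. norm (\<eta> t * c n t) \<le> M * (cmod (c 0 t) + 2 * (1 + Gc t))" for n
        using Gcae AE_space
      proof eventually_elim
        case (elim t)
        then have t: "t \<in> {0..T}" by simp
        \<comment> \<open>The majorant controls squares; a \<le> 1 + a^2 turns it into an integrable
          bound on the deviation itself, used once for \<open>c n\<close> and once for
          \<open>c 0\<close>.\<close>
        have G4: "cmod (c m t - cl t) \<le> 1 + Gc t" for m
        proof (rule le_one_plus_square)
          have "0 \<le> Gc t / 4 ^ 0" using elim(1) by (blast intro: order_trans[OF zero_le_power2])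
          then have G0: "Gc t \<ge> 0" by simp
          have "(cmod (c m t - cl t))\<^sup>2 \<le> Gc t / 4 ^ m" using elim(1) unfolding cl_def by blast
          also have "\<dots> \<le> Gc t / 1" using G0 by (intro divide_left_mono) auto
          finally show "(cmod (c m t - cl t))\<^sup>2 \<le> Gc t" by simp
        qed
        have "cmod (c n t) \<le> cmod (c 0 t) + (cmod (c n t - cl t) + cmod (c 0 t - cl t))"
          using norm_triangle_ineq[of "c 0 t" "(c n t - cl t) - (c 0 t - cl t)"]
            norm_triangle_ineq4[of "c n t - cl t" "c 0 t - cl t"] by simp
        also have "\<dots> \<le> cmod (c 0 t) + 2 * (1 + Gc t)" using G4[of n] G4[of 0] by simp
        finally have "cmod (c n t) \<le> cmod (c 0 t) + 2 * (1 + Gc t)" .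
        then show ?case
          using M t unfolding norm_mult norm_of_real by (intro mult_mono) (auto intro: order_trans[OF abs_ge_zero])
      qed
    qed
    have cW2: "cW = (\<integral>t. \<eta> t * cl t \<partial>ivl T)" by (rule LIMSEQ_unique[OF lim1 lim2])
    have ci: "integrable (ivl T) (\<lambda>t. \<eta> t * cl t)"
      by (intro L2_ivl_integrable L2_mult_continuous clL continuous_intros \<eta>c)
    have tc: "continuous_on {0..T} (\<lambda>t. \<theta> t * pair_l2 (state r w0 t) (emb L (K 1 0 0)))"
      by (intro continuous_intros \<theta>c pc)
    have "D 1 0 = (\<integral>t. \<eta> t * cl t \<partial>ivl T) + (\<integral>t. \<theta> t * pair_l2 (state r w0 t) (emb L (K 1 0 0)) \<partial>ivl T)"
    proof -
      have "pair_l2 (state r w0 t) (emb L (K 1 0 0)) = (\<integral>x. rep_l2 (state r w0 t) x * K 1 0 0 x \<partial>ivl L)" for t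
        by (subst emb_rep_state[symmetric], rule pair_emb[OF rep_l2_ivl K0])
      then show ?thesis
        unfolding D(3) KU[OF pU] cW2 state_average(2)[OF \<theta>c K0] by simp
    qed
    also have "\<dots> = (\<integral>t. \<eta> t * cl t + \<theta> t * pair_l2 (state r w0 t) (emb L (K 1 0 0)) \<partial>ivl T)"
      by (rule Bochner_Integration.integral_add[symmetric, OF ci integral_ivl_continuous(1)[OF tc]])
    also have "\<dots> = (\<integral>t. \<theta> t * h t \<partial>ivl T)"
      by (simp add: h_def \<eta>_def e_def algebra_simps)
    finally show "\<exists>U D. time_average L T \<theta> u U \<and> sobolev_rep L 2 D U \<and> D 1 0 = (\<integral>t. \<theta> t * h t \<partial>ivl T)"
      using ta D(1) unfolding u_def by blast
  qed
  with hL show "\<exists>h\<in>L2 (ivl T). dx_trace L T u 0 h" by blast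
qed

end

theorem theorem1p2:
  fixes L T \<alpha> \<beta> \<delta> r :: real
    and u0 :: "real \<Rightarrow> complex"
    and k :: "real \<Rightarrow> real \<Rightarrow> complex"
    and S :: "real \<Rightarrow> (real \<Rightarrow> complex) \<Rightarrow> real \<Rightarrow> complex"
  assumes "L > 0" and "T > 0" and "\<beta> > 0" and "r > 0"
    and "u0 \<in> L2 (ivl L)"
    and "backstepping_kernel L \<alpha> \<beta> \<delta> r k"
    and "generates L (A_graph L \<alpha> \<beta> \<delta>) S"
  shows "0 \<le> decay_constant L k \<and>
    (\<exists>u. closed_loop_mild_solution L r S k u0 {0..} u \<and>
      (\<forall>v. closed_loop_mild_solution L r S k u0 {0..T} v \<longrightarrow>
         (\<forall>t\<in>{0..T}. AE x in ivl L. v t x = u t x)) \<and>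
      closed_loop_boundary_conditions L T (boundary_feedback L k u) u \<and>
      cont_L2 L T u \<and>
      L2_sobolev L 1 T u \<and>
      (\<exists>h\<in>L2 (ivl T). dx_trace L T u 0 h) \<and>
      (\<forall>t\<ge>0. L2_norm (ivl L) (u t) \<le> decay_constant L k * L2_norm (ivl L) u0 * exp (- r * t)))"
proof -
  obtain K where K: "smooth_jet (\<Delta> L) K k" and diag: "\<forall>x\<in>{0..L}. k x x = 0 \<and> k x L = 0"
    using assms(6) unfolding backstepping_kernel_def kernel_problem_def by blast
  interpret closed_loop L \<alpha> \<beta> \<delta> S k K
    by unfold_locales (use assms K diag in auto)
  define w0 where "w0 = emb L (I_minus_Upsilon L k u0)"
  have w0: "proj L w0 = w0" unfolding w0_def by (intro proj_emb I_minus_Upsilon_L2 assms)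
  \<comment> \<open>One function for all t \<ge> 0, built without reference to T; the statements on
    [0,T] are then read off its restriction.\<close>
  define u where "u t = rep_l2 (state r w0 t)" for t
  note reg = state_regularity[OF w0 assms(2), of r, folded u_def]
  show ?thesis
  proof (intro conjI exI[of _ u] allI impI ballI)
    show "0 \<le> decay_constant L k" by (rule decay_constant_nonneg)
    show "closed_loop_mild_solution L r S k u0 {0..} u"
      unfolding u_def w0_def by (rule state_is_mild_solution[OF assms(5)])
    show "AE x in ivl L. v t x = u t x" if "closed_loop_mild_solution L r S k u0 {0..T} v" "t \<in> {0..T}" for v t
      unfolding u_def w0_def using that by (intro mild_solution_unique[OF assms(5)]) auto
    show "closed_loop_boundary_conditions L T (boundary_feedback L k u) u"
      unfolding closed_loop_boundary_conditions_def
      using reg(1) dx_trace_right[OF w0 assms(2), of r, folded u_def] by simp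
    show "cont_L2 L T u" unfolding u_def by (rule state_cont_L2)
    show "L2_sobolev L 1 T u" by (rule reg(2))
    show "\<exists>h\<in>L2 (ivl T). dx_trace L T u 0 h" by (rule reg(3))
    show "L2_norm (ivl L) (u t) \<le> decay_constant L k * L2_norm (ivl L) u0 * exp (- r * t)" if "0 \<le> t" for t
      unfolding u_def w0_def by (rule state_decay[OF assms(5) that])
  qed
qed

end
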